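(* Let $\rho,\sigma\in\mathcal{D}(\mathcal{H})$ be quantum states with $\operatorname{supp}\rho\subseteq\operatorname{supp}\sigma$, let $\gamma\in(0,1]$ and let $$c_\gamma(\rho\|\sigma):=\frac1\gamma\log\big(2^{\gamma D_{1+\gamma}(\rho\|\sigma)}+2^{-\gamma D_{1-\gamma}(\rho\|\sigma)}+1\big).$$ Then for all $\varepsilon\in(0,1)$ and $n\in\mathbb{N}$: $$\frac1nD_{\max}^\varepsilon(\rho^{\otimes n}\|\sigma^{\otimes n})\ge D(\rho\|\sigma)-\frac{c_\gamma(\rho\|\sigma)}{\sqrt n}\Big[\frac{\ln(2)\log(3)}{2}\cosh\!\Big(\frac{\log 3}{2}\Big)+\frac{4}{\log 3}\log\frac{1}{1-\varepsilon}\Big],$$ $$\frac1nD_{\max}^\varepsilon(\rho^{\otimes n}\|\sigma^{\otimes n})\le D(\rho\|\sigma)+\frac{c_\gamma(\rho\|\sigma)}{\sqrt n}\Big[\frac{\ln(2)\log(3)}{2}+\frac{4}{\log 3}\log\frac1\varepsilon\Big]+\frac1n\log\frac{1}{1-\varepsilon^2},$$ which implies $$\frac1nD_{\max}^\varepsilon(\rho^{\otimes n}\|\sigma^{\otimes n})\ge D(\rho\|\sigma)-\frac{4c_\gamma(\rho\|\sigma)}{\sqrt n}\log\frac{2}{1-\varepsilon},$$ $$\frac1nD_{\max}^\varepsilon(\rho^{\otimes n}\|\sigma^{\otimes n})\le D(\rho\|\sigma)+\frac{4c_\gamma(\rho\|\sigma)}{\sqrt n}\log\frac2\varepsilon+\frac1n\log\frac{1}{1-\varepsilon^2}.$$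 Moreover, let $K_1:=2\sqrt{2\ln(2)\cosh(\frac{\log 3}{2})}\le2.72$ and $K_2:=2\sqrt{2\ln 2}\le2.36$. If $$n\ge\log\Big(\frac1{1-\varepsilon}\Big)\Big(\frac{8}{\log(3)K_1}\Big)^2,$$ then $$\frac1nD_{\max}^\varepsilon(\rho^{\otimes n}\|\sigma^{\otimes n})\ge D(\rho\|\sigma)-\frac{K_1}{\sqrt n}c_\gamma(\rho\|\sigma)\sqrt{\log\frac{1}{1-\varepsilon}}.$$ Similarly, if $$n\ge\log\Big(\frac1\varepsilon\Big)\Big(\frac{8}{\gamma c_\gamma(\rho\|\sigma)K_2}\Big)^2,$$ then $$\frac1nD_{\max}^\varepsilon(\rho^{\otimes n}\|\sigma^{\otimes n})\le D(\rho\|\sigma)+\frac{K_2}{\sqrt n}c_\gamma(\rho\|\sigma)\sqrt{\log\frac1\varepsilon}+\frac1n\log\frac{1}{1-\varepsilon^2}.$$ Since $\gamma c_\gamma(\rho\|\sigma)\ge\log 3$, the last condition on $n$ is always satisfied if $n\ge\log(\frac1\varepsilon)\big(\frac{8}{\log(3)K_2}\big)^2$.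
   Context: $\mathcal{H}$ is a finite-dimensional complex Hilbert space, $\mathcal{D}(\mathcal{H})$ its set of density matrices; $\log$ is base two, $\ln$ natural. Relative entropy: $D(\rho\|\sigma):=\operatorname{Tr}(\rho(\log\rho-\log\sigma))$ for $\operatorname{supp}\rho\subseteq\operatorname{supp}\sigma$. Petz--Rényi divergence, $\alpha\in[0,1)\cup(1,2]$, $\operatorname{supp}\rho\subseteq\operatorname{supp}\sigma$: $D_\alpha(\rho\|\sigma):=\frac{1}{\alpha-1}\log\operatorname{Tr}(\rho^\alpha\sigma^{1-\alpha})$, with negative powers taken on the support and $\rho^0$ the projection onto the support of $\rho$. Max-divergence: $D_{\max}(\rho\|\sigma):=\log\inf\{\lambda\in\mathbb{R}:\rho\le\lambda\sigma\}$. Fidelity and sine distance: $F(\rho,\sigma):=\operatorname{Tr}\sqrt{\sqrt\sigma\rho\sqrt\sigma}$, $P(\rho,\sigma):=\sqrt{1-F(\rho,\sigma)^2}$. Smoothed max-divergence (smoothing over normalized states only): $D_{\max}^\varepsilon(\rho\|\sigma):=\inf\{D_{\max}(\tilde\rho\|\sigma):\tilde\rho\in\mathcal{D}(\mathcal{H}),\ P(\rho,\tilde\rho)\le\varepsilon\}$. *)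

theory Defs
  imports
    "Jordan_Normal_Form.Schur_Decomposition"
    "Jordan_Normal_Form.Matrix_Kernel"
    "HOL-Library.Extended_Real"
begin

text \<open>The finite-dimensional Hilbert space is \<open>\<complex>\<^sup>d\<close> with \<open>d\<close> arbitrary; operators on it are
  complex \<open>d \<times> d\<close> matrices. The inner product \<open>u \<bullet>c v\<close> is linear in \<open>u\<close>. Traces of operator
  expressions that are real for mathematical reasons are turned into real numbers by \<open>Re\<close>.\<close>

definition mat_trace :: "complex mat \<Rightarrow> complex" where
  "mat_trace A = (\<Sum>i<dim_row A. A $$ (i, i))"

text \<open>Here \<open>0 \<le> z\<close> for complex \<open>z\<close> means that \<open>z\<close> is real and nonnegative.\<close>

definition psd :: "complex mat \<Rightarrow> bool" where
  "psd A \<longleftrightarrow> A \<in> carrier_mat (dim_row A) (dim_row A) \<and> mat_adjoint A = A \<and>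
     (\<forall>v \<in> carrier_vec (dim_row A). 0 \<le> (A *\<^sub>v v) \<bullet>c v)"

definition loewner_le :: "complex mat \<Rightarrow> complex mat \<Rightarrow> bool" where
  "loewner_le A B \<longleftrightarrow> psd (B - A)"

definition density_ops :: "nat \<Rightarrow> complex mat set" where
  "density_ops d = {A. A \<in> carrier_mat d d \<and> psd A \<and> mat_trace A = 1}"

definition supp :: "complex mat \<Rightarrow> complex vec set" where
  "supp A = {v \<in> carrier_vec (dim_col A). \<forall>w \<in> mat_kernel A. v \<bullet>c w = 0}"

text \<open>Functional calculus for Hermitian \<open>A\<close>: if \<open>A = U diag(e\<^sub>0, \<dots>) U*\<close> with \<open>U\<close> unitary and real
  \<open>e\<^sub>i\<close>, then \<open>f(A) = U diag(f(e\<^sub>0), \<dots>) U*\<close>. Such a diagonalisation exists by the spectral theorem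
  and the result does not depend on its choice.\<close>

definition herm_fun :: "(real \<Rightarrow> real) \<Rightarrow> complex mat \<Rightarrow> complex mat" where
  "herm_fun f A = (let n = dim_row A in
     THE B. \<exists>U e. U \<in> carrier_mat n n \<and> mat_adjoint U * U = 1\<^sub>m n \<and>
       A = U * mat_diag n (\<lambda>i. complex_of_real (e i)) * mat_adjoint U \<and>
       B = U * mat_diag n (\<lambda>i. complex_of_real (f (e i))) * mat_adjoint U)"

text \<open>Logarithms and powers act on the support only. For powers this is built into
  \<open>(powr)\<close>: \<open>0 powr a = 0\<close> for every \<open>a\<close>, including negative \<open>a\<close> and \<open>a = 0\<close>, so that
  \<open>mat_powr A 0\<close> is the projection onto the support of \<open>A\<close>.\<close>

definition mat_log :: "complex mat \<Rightarrow> complex mat" where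
  "mat_log = herm_fun (\<lambda>x. if x = 0 then 0 else log 2 x)"

definition mat_powr :: "complex mat \<Rightarrow> real \<Rightarrow> complex mat" where
  "mat_powr A a = herm_fun (\<lambda>x. x powr a) A"

definition mat_sqrt :: "complex mat \<Rightarrow> complex mat" where
  "mat_sqrt = herm_fun sqrt"

text \<open>The Kronecker product and the tensor powers \<open>A \<otimes> \<dots> \<otimes> A\<close>.\<close>

definition tensor_mat :: "complex mat \<Rightarrow> complex mat \<Rightarrow> complex mat" where
  "tensor_mat A B = mat (dim_row A * dim_row B) (dim_col A * dim_col B)
     (\<lambda>(i, j). A $$ (i div dim_row B, j div dim_col B) * B $$ (i mod dim_row B, j mod dim_col B))"

fun tensor_pow :: "complex mat \<Rightarrow> nat \<Rightarrow> complex mat" where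
  "tensor_pow A 0 = 1\<^sub>m 1"
| "tensor_pow A (Suc n) = tensor_mat A (tensor_pow A n)"

text \<open>The following two divergences are meant for states with \<open>supp \<rho> \<subseteq> supp \<sigma>\<close>.\<close>

definition rel_entropy :: "complex mat \<Rightarrow> complex mat \<Rightarrow> real" where
  "rel_entropy \<rho> \<sigma> = Re (mat_trace (\<rho> * (mat_log \<rho> - mat_log \<sigma>)))"

definition petz_renyi :: "real \<Rightarrow> complex mat \<Rightarrow> complex mat \<Rightarrow> real" where
  "petz_renyi \<alpha> \<rho> \<sigma> =
     1 / (\<alpha> - 1) * log 2 (Re (mat_trace (mat_powr \<rho> \<alpha> * mat_powr \<sigma> (1 - \<alpha>))))"

text \<open>The infimum over the empty set is \<open>\<infinity>\<close>; this occurs when \<open>supp \<rho> \<subseteq> supp \<sigma>\<close> fails.\<close>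

definition D_max :: "complex mat \<Rightarrow> complex mat \<Rightarrow> ereal" where
  "D_max \<rho> \<sigma> = (let S = {l::real. loewner_le \<rho> (complex_of_real l \<cdot>\<^sub>m \<sigma>)} in
     if S = {} then \<infinity> else ereal (log 2 (Inf S)))"

definition fidelity :: "complex mat \<Rightarrow> complex mat \<Rightarrow> real" where
  "fidelity \<rho> \<sigma> = Re (mat_trace (mat_sqrt (mat_sqrt \<sigma> * \<rho> * mat_sqrt \<sigma>)))"

definition sine_distance :: "complex mat \<Rightarrow> complex mat \<Rightarrow> real" where
  "sine_distance \<rho> \<sigma> = sqrt (1 - (fidelity \<rho> \<sigma>)\<^sup>2)"

definition D_max_smooth :: "real \<Rightarrow> complex mat \<Rightarrow> complex mat \<Rightarrow> ereal" where
  "D_max_smooth \<epsilon> \<rho> \<sigma> =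
     (INF \<tau> \<in> {\<tau> \<in> density_ops (dim_row \<rho>). sine_distance \<rho> \<tau> \<le> \<epsilon>}. D_max \<tau> \<sigma>)"

definition c_gamma :: "real \<Rightarrow> complex mat \<Rightarrow> complex mat \<Rightarrow> real" where
  "c_gamma \<gamma> \<rho> \<sigma> = 1 / \<gamma> * log 2
     (2 powr (\<gamma> * petz_renyi (1 + \<gamma>) \<rho> \<sigma>) + 2 powr (- \<gamma> * petz_renyi (1 - \<gamma>) \<rho> \<sigma>) + 1)"

definition K\<^sub>1 :: real where
  "K\<^sub>1 = 2 * sqrt (2 * ln 2 * cosh (log 2 3 / 2))"

definition K\<^sub>2 :: real where
  "K\<^sub>2 = 2 * sqrt (2 * ln 2)"

end

theory Submission
  imports Defs "HOL-Analysis.Convex" "Jordan_Normal_Form.Spectral_Radius"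
begin

text \<open>Let \<open>\<lambda>\<^sub>i\<close>, \<open>\<mu>\<^sub>j\<close> be the eigenvalues of \<open>\<rho>\<close>, \<open>\<sigma>\<close> and \<open>w\<^sub>i\<^sub>j\<close> the squared overlaps of the eigenvectors. The
  distributions \<open>P = w \<lambda>\<close> and \<open>Q = w \<mu>\<close> reproduce the relative entropy and all Petz divergences, so their
  continuity at order one is a statement about the moment generating function of \<open>ln (P / Q)\<close>.

  Lower bound: if \<open>\<tau> \<le> l \<sigma>\<close>, then \<open>F(\<rho>,\<tau>)\<^sup>2 \<le> l\<^sup>s Tr \<rho>\<^bsup>1-s\<^esup> \<sigma>\<^sup>s\<close>. The sum of \<open>P Q / (P + t Q)\<close> is the minimum over
  matrices \<open>X\<close> of a form that is monotone in \<open>\<sigma>\<close> and dominates the fidelity by Cauchy--Schwarz, and at the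
  right \<open>t\<close> a weighted AM-GM inequality compares it with \<open>P\<^bsup>1-s\<^esup> Q\<^sup>s\<close> without loss.

  Upper bound: a projection \<open>N\<close> with \<open>Tr N \<rho> \<ge> l Tr N \<sigma>\<close> satisfies \<open>Tr N \<rho> \<le> l\<^bsup>-s\<^esup> Tr \<rho>\<^bsup>1+s\<^esup> \<sigma>\<^bsup>-s\<^esup>\<close>, again by a single
  resolvent. Cutting off such an \<open>N\<close> gives, for every test operator \<open>M \<ge> 0\<close>, a state near \<open>\<rho>\<close> on which \<open>M\<close> is
  dominated by \<open>K \<sigma>\<close>; a Frank--Wolfe descent then finds one state near \<open>\<rho>\<close> that works for all \<open>M\<close>.\<close>

text \<open>The form of \<open>c_gamma\<close> reflects a concavity threshold. For
  \<open>0 < u\<close> and \<open>u <= 1/2\<close>, the function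
  \<open>z powr u + z powr (- u)\<close> is concave where
  \<open>z powr (2 * u) >= (1 + u) / (1 - u)\<close>. This holds from \<open>z = 3\<close> on, and 3
  is sharp at \<open>u = 1/2\<close>. Since \<open>X + 1 / X + 1 >= 3\<close>, the summand 1 moves a
  power \<open>X\<close> of the likelihood ratio into that range. Jensen's inequality then bounds
  the symmetrised moment generating function by \<open>2 * cosh (u * ln W)\<close>, where
  \<open>W\<close> is the argument of the logarithm in \<open>c_gamma\<close>. Hence
  \<open>log 3\<close> and the range \<open>s <= \<gamma> / 2\<close>, with
  \<open>u = s / \<gamma>\<close>. Per copy, a one-shot bound costs a term of order
  \<open>1 / (n * s)\<close>, and the divergence of order \<open>1 + s\<close> or
  \<open>1 - s\<close> is off by at most order \<open>s * c^2\<close>. Balancing the two gives the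
  rate \<open>1 / sqrt n\<close>. The factor \<open>cosh\<close> occurs on one side only: for order
  above one the nonnegative term \<open>s * D\<close> can be absorbed into an exponential, while for
  order below one it has the wrong sign.\<close>

abbreviation adj :: "complex mat \<Rightarrow> complex mat" where
  "adj \<equiv> mat_adjoint"

abbreviation rdiag :: "nat \<Rightarrow> (nat \<Rightarrow> real) \<Rightarrow> complex mat" where
  "rdiag n e \<equiv> mat_diag n (\<lambda>i. complex_of_real (e i))"

section \<open>Adjoints, traces and the Frobenius norm\<close>

lemma adj_carrier[simp, intro]: "A \<in> carrier_mat n m \<Longrightarrow> adj A \<in> carrier_mat m n"
  unfolding mat_adjoint_def by (auto simp: mat_of_rows_def)

lemma adj_dim[simp]: "dim_row (adj A) = dim_col A" "dim_col (adj A) = dim_row A"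
  unfolding mat_adjoint_def by auto

lemma adj_index[simp]:
  fixes A :: "complex mat"
  shows "i < dim_col A \<Longrightarrow> j < dim_row A \<Longrightarrow> adj A $$ (i,j) = cnj (A $$ (j,i))"
  unfolding mat_adjoint_def by (simp add: mat_of_rows_index conjugate_vec_def)

lemma adj_adj[simp]: "adj (adj A) = (A :: complex mat)"
  by (rule eq_matI) auto

lemma mult_index_sum:
  assumes "A \<in> carrier_mat n m" "B \<in> carrier_mat m k" "i < n" "j < k"
  shows "(A * B) $$ (i,j) = (\<Sum>l<m. A $$ (i,l) * B $$ (l,j))"
  using assms by (auto simp: scalar_prod_def atLeast0LessThan)

lemma adj_mult:
  fixes A B :: "complex mat"
  assumes "A \<in> carrier_mat n m" "B \<in> carrier_mat m k"
  shows "adj (A * B) = adj B * adj A"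
  by (rule eq_matI) (use assms in \<open>auto simp: scalar_prod_def mult.commute\<close>)

text \<open>Equations between dimensions can be discharged by the simplifier, whereas
  \<open>carrier_mat\<close> premises leave the dimensions to be guessed. Long matrix products are
  regrouped with this form throughout.\<close>

lemma mult_assoc_dim:
  "dim_col A = dim_row B \<Longrightarrow> dim_col B = dim_row C \<Longrightarrow> (A :: complex mat) * B * C = A * (B * C)"
  by (rule assoc_mult_mat[of _ "dim_row A" "dim_row B" _ "dim_row C" _ "dim_col C"]) auto

lemma adj_mult_dim:
  fixes A B :: "complex mat"
  shows "dim_col A = dim_row B \<Longrightarrow> adj (A * B) = adj B * adj A"
  by (rule adj_mult[of _ "dim_row A" "dim_row B" _ "dim_col B"]) auto

lemma mult_one_dim[simp]:
  fixes A :: "complex mat"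
  shows "dim_row A = n \<Longrightarrow> 1\<^sub>m n * A = A" "dim_col A = n \<Longrightarrow> A * 1\<^sub>m n = A"
  by auto

lemma adj_add:
  fixes A B :: "complex mat"
  assumes "A \<in> carrier_mat n m" "B \<in> carrier_mat n m"
  shows "adj (A + B) = adj A + adj B"
  by (rule eq_matI) (use assms in auto)

lemma adj_minus:
  fixes A B :: "complex mat"
  assumes "A \<in> carrier_mat n m" "B \<in> carrier_mat n m"
  shows "adj (A - B) = adj A - adj B"
  by (rule eq_matI) (use assms in auto)

lemma adj_smult: "adj (c \<cdot>\<^sub>m (A :: complex mat)) = cnj c \<cdot>\<^sub>m adj A"
  by (rule eq_matI) auto

lemma adj_one[simp]: "adj (1\<^sub>m n :: complex mat) = 1\<^sub>m n"
  by (rule eq_matI) auto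

lemma mat_diag_index[simp]: "i < n \<Longrightarrow> j < n \<Longrightarrow> mat_diag n f $$ (i,j) = (if i = j then f j else 0)"
  by (auto simp: mat_diag_def)

lemma mat_diag_dims[simp]: "dim_row (mat_diag n f) = n" "dim_col (mat_diag n f) = n"
  by (auto simp: mat_diag_def)

lemma adj_diag[simp]:
  "adj (rdiag n f) = rdiag n f"
  by (rule eq_matI) auto

lemma trace_sum: "A \<in> carrier_mat n m \<Longrightarrow> mat_trace A = (\<Sum>i<n. A $$ (i,i))"
  by (auto simp: mat_trace_def)

lemma trace_mult_sum:
  assumes "A \<in> carrier_mat n m" "B \<in> carrier_mat m n"
  shows "mat_trace (A * B) = (\<Sum>i<n. \<Sum>k<m. A $$ (i,k) * B $$ (k,i))"
  by (subst trace_sum[of _ n n])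
     (use assms in \<open>auto simp: mult_index_sum[OF assms] simp del: index_mult_mat(1) intro!: sum.cong\<close>)

lemma trace_comm:
  assumes "A \<in> carrier_mat n m" "B \<in> carrier_mat m n"
  shows "mat_trace (A * B) = mat_trace (B * A)"
  unfolding trace_mult_sum[OF assms] trace_mult_sum[OF assms(2,1)]
  by (subst sum.swap) (simp add: mult.commute)

lemma trace_add:
  "A \<in> carrier_mat n n \<Longrightarrow> B \<in> carrier_mat n n \<Longrightarrow> mat_trace (A + B) = mat_trace A + mat_trace B"
  by (simp add: mat_trace_def sum.distrib)

lemma trace_minus:
  "A \<in> carrier_mat n n \<Longrightarrow> B \<in> carrier_mat n n \<Longrightarrow> mat_trace (A - B) = mat_trace A - mat_trace B"
  by (simp add: mat_trace_def sum_subtractf)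

lemma trace_smult: "A \<in> carrier_mat n n \<Longrightarrow> mat_trace (c \<cdot>\<^sub>m A) = c * mat_trace A"
  by (simp add: mat_trace_def sum_distrib_left)

lemma trace_adj: "A \<in> carrier_mat n n \<Longrightarrow> mat_trace (adj A) = cnj (mat_trace A)"
  by (simp add: mat_trace_def)

definition frob2 :: "complex mat \<Rightarrow> real" where
  "frob2 A = (\<Sum>i<dim_row A. \<Sum>j<dim_col A. (cmod (A $$ (i,j)))\<^sup>2)"

lemma frob2_sum: "A \<in> carrier_mat n m \<Longrightarrow> frob2 A = (\<Sum>i<n. \<Sum>j<m. (cmod (A $$ (i,j)))\<^sup>2)"
  by (auto simp: frob2_def)

lemma frob2_nonneg[simp]: "0 \<le> frob2 A"
  unfolding frob2_def by (intro sum_nonneg) auto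

lemma frob2_trace:
  assumes "A \<in> carrier_mat n m"
  shows "mat_trace (adj A * A) = complex_of_real (frob2 A)"
    and "mat_trace (A * adj A) = complex_of_real (frob2 A)"
proof -
  show 2: "mat_trace (A * adj A) = complex_of_real (frob2 A)"
    using assms
    by (auto simp: trace_mult_sum[OF assms adj_carrier[OF assms]] frob2_sum[OF assms]
        complex_norm_square simp del: of_real_power intro!: sum.cong)
  then show "mat_trace (adj A * A) = complex_of_real (frob2 A)"
    using trace_comm[OF assms adj_carrier[OF assms]] by simp
qed

lemma frob2_adj: "frob2 (adj A) = frob2 A"
  unfolding frob2_def by (subst sum.swap) simp

lemma trace_Cauchy_Schwarz:
  assumes "A \<in> carrier_mat n m" "B \<in> carrier_mat m n"
  shows "cmod (mat_trace (A * B)) \<le> sqrt (frob2 A) * sqrt (frob2 B)"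
proof -
  have "cmod (mat_trace (A * B)) \<le> (\<Sum>i<n. cmod (\<Sum>k<m. A $$ (i,k) * B $$ (k,i)))"
    unfolding trace_mult_sum[OF assms] by (rule norm_sum)
  also have "\<dots> \<le> (\<Sum>i<n. \<Sum>k<m. cmod (A $$ (i,k) * B $$ (k,i)))"
    by (intro sum_mono norm_sum)
  also have "\<dots> = (\<Sum>(i,k)\<in>{..<n}\<times>{..<m}. cmod (A $$ (i,k)) * cmod (B $$ (k,i)))"
    by (simp add: sum.cartesian_product norm_mult)
  also have "\<dots> = (\<Sum>p\<in>{..<n}\<times>{..<m}. cmod (A $$ (fst p, snd p)) * cmod (B $$ (snd p, fst p)))"
    by (simp add: case_prod_unfold)
  also have "\<dots> \<le> sqrt (\<Sum>p\<in>{..<n}\<times>{..<m}. (cmod (A $$ (fst p, snd p)))\<^sup>2) *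
      sqrt (\<Sum>p\<in>{..<n}\<times>{..<m}. (cmod (B $$ (snd p, fst p)))\<^sup>2)"
  proof -
    let ?S = "{..<n}\<times>{..<m}"
    let ?a = "\<lambda>p. cmod (A $$ (fst p, snd p))" and ?b = "\<lambda>p. cmod (B $$ (snd p, fst p))"
    have "(\<Sum>p\<in>?S. ?a p * ?b p)\<^sup>2 \<le> (\<Sum>p\<in>?S. (?a p)\<^sup>2) * (\<Sum>p\<in>?S. (?b p)\<^sup>2)"
      by (rule Cauchy_Schwarz_ineq_sum)
    then show ?thesis by (simp add: real_le_rsqrt flip: real_sqrt_mult)
  qed
  also have "(\<Sum>p\<in>{..<n}\<times>{..<m}. (cmod (A $$ (fst p, snd p)))\<^sup>2) = frob2 A"
    unfolding frob2_sum[OF assms(1)] by (simp add: sum.cartesian_product case_prod_unfold)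
  also have "(\<Sum>p\<in>{..<n}\<times>{..<m}. (cmod (B $$ (snd p, fst p)))\<^sup>2) = frob2 B"
    unfolding frob2_sum[OF assms(2)]
    by (subst sum.swap) (simp add: sum.cartesian_product case_prod_unfold)
  finally show ?thesis .
qed

section \<open>The spectral theorem and the functional calculus\<close>

lemma unitary_right:
  fixes U :: "complex mat"
  assumes "U \<in> carrier_mat n n" "adj U * U = 1\<^sub>m n"
  shows "U * adj U = 1\<^sub>m n"
  using mat_mult_left_right_inverse[OF adj_carrier[OF assms(1)] assms(1,2)] .

lemma unitary_cancel:
  fixes U X :: "complex mat"
  assumes "U \<in> carrier_mat n n" "adj U * U = 1\<^sub>m n" "dim_row X = n"
  shows "adj U * (U * X) = X" "U * (adj U * X) = X"
  using assms unitary_right[OF assms(1,2)]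
  by (simp_all add: carrier_matD[OF assms(1)] flip: mult_assoc_dim)

lemma unitary_mult:
  fixes U V :: "complex mat"
  assumes "U \<in> carrier_mat n n" "adj U * U = 1\<^sub>m n"
    and "V \<in> carrier_mat n n" "adj V * V = 1\<^sub>m n"
  shows "adj (U * V) * (U * V) = 1\<^sub>m n"
  using assms carrier_matD[OF assms(1)] carrier_matD[OF assms(3)]
  by (simp add: adj_mult_dim mult_assoc_dim unitary_cancel[OF assms(1,2)])

text \<open>This is the deflation step of the spectral theorem: in a unitary basis that begins with
  an eigenvector, a Hermitian matrix splits off a block of size one. \<open>gram_schmidt\<close>
  makes the columns orthogonal, and division by their norms \<open>N\<close> makes them orthonormal
  while keeping the unit vector \<open>v\<close>.\<close>

lemma unitary_with_first_column:
  fixes v :: "complex vec"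
  assumes v: "v \<in> carrier_vec n" and v1: "v \<bullet>c v = 1" and n: "n \<noteq> 0"
  obtains W where "W \<in> carrier_mat n n" "adj W * W = 1\<^sub>m n" "col W 0 = v"
proof -
  interpret cof_vec_space n "TYPE(complex)" .
  have v0: "v \<noteq> 0\<^sub>v n" using v1 by auto
  define b where "b = basis_completion v"
  define ws where "ws = gram_schmidt n b"
  from basis_completion[OF v v0, folded b_def]
  have dist_b: "distinct b" and indep: "\<not> lin_dep (set b)" and b: "set b \<subseteq> carrier_vec n"
    and hdb: "hd b = v" and len_b: "length b = n" by auto
  from hdb len_b n obtain vs where bv: "b = v # vs" by (cases b, auto)
  from gram_schmidt_result[OF b dist_b indep refl, folded ws_def]
  have ws: "set ws \<subseteq> carrier_vec n" "corthogonal ws" "length ws = n"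
    by (auto simp: len_b)
  from gram_schmidt_hd[OF v, of vs, folded bv] have hdws: "hd ws = v" unfolding ws_def .
  then have ws0: "ws ! 0 = v" using ws(3) n by (metis hd_conv_nth list.size(3))
  have wsc: "ws ! i \<in> carrier_vec n" if "i < n" for i using ws that by auto
  define N where "N i = sqrt (Re (ws ! i \<bullet>c ws ! i))" for i
  have N2: "ws ! i \<bullet>c ws ! i = complex_of_real (N i * N i)" and Npos: "N i > 0" if "i < n" for i
  proof -
    have "ws ! i \<bullet>c ws ! i \<noteq> 0" using corthogonalD[OF ws(2), of i i] ws(3) that by auto
    moreover have "ws ! i \<bullet>c ws ! i \<ge> 0" by (rule conjugate_square_ge_0_vec)
    ultimately have "Re (ws ! i \<bullet>c ws ! i) > 0" "Im (ws ! i \<bullet>c ws ! i) = 0"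
      by (auto simp: less_eq_complex_def complex_eq_iff)
    then show "ws ! i \<bullet>c ws ! i = complex_of_real (N i * N i)" "N i > 0"
      by (auto simp: N_def complex_eq_iff)
  qed
  define W where "W = Matrix.mat n n (\<lambda>(i,j). ws ! j $ i / complex_of_real (N j))"
  have W: "W \<in> carrier_mat n n" by (simp add: W_def)
  have "adj W * W = 1\<^sub>m n"
  proof (rule eq_matI)
    fix i j assume "i < dim_row (1\<^sub>m n :: complex mat)" "j < dim_col (1\<^sub>m n :: complex mat)"
    then have i: "i < n" and j: "j < n" by auto
    have "(adj W * W) $$ (i,j) = (\<Sum>l<n. cnj (ws ! i $ l / N i) * (ws ! j $ l / N j))"
      using mult_index_sum[OF adj_carrier[OF W] W i j] i j W by (simp add: W_def)
    also have "\<dots> = (\<Sum>l<n. ws ! j $ l * cnj (ws ! i $ l)) / (N i * N j)"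
      by (simp add: sum_divide_distrib mult.commute)
    also have "(\<Sum>l<n. ws ! j $ l * cnj (ws ! i $ l)) = ws ! j \<bullet>c ws ! i"
      using wsc[OF i] wsc[OF j] by (auto simp: scalar_prod_def atLeast0LessThan)
    also have "ws ! j \<bullet>c ws ! i / (N i * N j) = (if i = j then 1 else 0)"
      using corthogonalD[OF ws(2), of j i] ws(3) i j N2[OF i] Npos[OF i] by auto
    finally show "(adj W * W) $$ (i,j) = (1\<^sub>m n :: complex mat) $$ (i,j)"
      using i j by simp
  qed (use W in auto)
  moreover have "N 0 = 1" using v1 by (simp add: N_def ws0)
  then have "col W 0 = v" using v n by (auto simp: W_def ws0)
  ultimately show thesis using that W by blast
qed

text \<open>These are the data over which \<open>herm_fun\<close> quantifies. With \<open>U\<close>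
  and \<open>e\<close> named, functions of a matrix become arithmetic on \<open>e\<close>.\<close>

definition diagonalizes :: "nat \<Rightarrow> complex mat \<Rightarrow> complex mat \<Rightarrow> (nat \<Rightarrow> real) \<Rightarrow> bool" where
  "diagonalizes n A U e \<longleftrightarrow> U \<in> carrier_mat n n \<and> adj U * U = 1\<^sub>m n \<and>
     A = U * rdiag n e * adj U"

lemma diagonalizesD:
  assumes "diagonalizes n A U e"
  shows "U \<in> carrier_mat n n" "adj U * U = 1\<^sub>m n" "U * adj U = 1\<^sub>m n"
    "A = U * rdiag n e * adj U"
    "A \<in> carrier_mat n n" "adj A = A"
proof -
  show U: "U \<in> carrier_mat n n" and UU: "adj U * U = 1\<^sub>m n"
    and A: "A = U * rdiag n e * adj U"
    using assms unfolding diagonalizes_def by auto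
  show "U * adj U = 1\<^sub>m n" using unitary_right[OF U UU] .
  show "A \<in> carrier_mat n n" unfolding A using U by auto
  show "adj A = A"
    unfolding A using carrier_matD[OF U] by (simp add: adj_mult_dim mult_assoc_dim)
qed

lemma conj_diag_index:
  fixes U :: "complex mat"
  assumes U: "U \<in> carrier_mat n n" and "i < n" "j < n"
  shows "(U * mat_diag n f * adj U) $$ (i,j) = (\<Sum>k<n. U $$ (i,k) * f k * cnj (U $$ (j,k)))"
proof -
  have "U * mat_diag n f = Matrix.mat n n (\<lambda>(i,j). U $$ (i,j) * f j)"
    using mat_diag_mult_right[OF U] .
  then show ?thesis
    using assms by (subst mult_index_sum[of _ n n _ n]) (auto intro!: sum.cong)
qed

lemma conj_diag_mult:
  fixes U :: "complex mat"
  assumes U: "U \<in> carrier_mat n n" "adj U * U = 1\<^sub>m n" and w: "\<And>i. i < n \<Longrightarrow> u i * v i = w i"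
  shows "U * rdiag n u * adj U * (U * rdiag n v * adj U) =
    U * rdiag n w * adj U"
proof -
  have "rdiag n u * rdiag n v = rdiag n w"
    unfolding mat_diag_diag using w by (auto intro!: eq_matI simp flip: of_real_mult)
  moreover have "U * rdiag n u * adj U * (U * rdiag n v * adj U) =
      U * (rdiag n u * rdiag n v) * adj U"
    using carrier_matD[OF U(1)] by (simp add: mult_assoc_dim unitary_cancel[OF U] del: mat_diag_diag)
  ultimately show ?thesis by simp
qed

text \<open>Induction on the dimension. After a change to a basis that begins with an eigenvector,
  the first column is \<open>ev\<close> times a unit vector. Hermiticity clears the first row too
  and makes \<open>ev\<close> real, so the induction hypothesis applies to the remaining block
  \<open>A3\<close>.\<close>

theorem hermitian_diagonalizable:
  assumes "A \<in> carrier_mat n n" "adj A = A"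
  obtains U e where "diagonalizes n A U e"
proof -
  have "\<exists>U e. diagonalizes n A U e"
    using assms
  proof (induction n arbitrary: A)
    case 0
    then show ?case
      by (intro exI[of _ "1\<^sub>m 0"] exI) (auto simp: diagonalizes_def)
  next
    case (Suc n A)
    note A = Suc.prems(1) and herm = Suc.prems(2)
    from spectrum_non_empty[OF A] obtain ev where "eigenvalue A ev"
      unfolding spectrum_def by auto
    then obtain v0 where v0: "v0 \<in> carrier_vec (Suc n)" "v0 \<noteq> 0\<^sub>v (Suc n)" "A *\<^sub>v v0 = ev \<cdot>\<^sub>v v0"
      unfolding eigenvalue_def eigenvector_def using A by auto
    define c where "c = complex_of_real (1 / sqrt (Re (v0 \<bullet>c v0)))"
    define v where "v = c \<cdot>\<^sub>v v0"
    have v: "v \<in> carrier_vec (Suc n)" using v0 by (simp add: v_def)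
    have Av: "A *\<^sub>v v = ev \<cdot>\<^sub>v v"
      unfolding v_def using v0 A by (simp add: mult_mat_vec[OF A v0(1)] smult_smult_assoc mult.commute)
    have "v0 \<bullet>c v0 \<noteq> 0" "v0 \<bullet>c v0 \<ge> 0"
      using v0 conjugate_square_eq_0_vec[OF v0(1)] conjugate_square_ge_0_vec by blast+
    then have "Re (v0 \<bullet>c v0) > 0" "Im (v0 \<bullet>c v0) = 0"
      by (auto simp: less_eq_complex_def complex_eq_iff)
    then obtain r where r: "r > 0" "v0 \<bullet>c v0 = complex_of_real r"
      by (metis complex_of_real_def complex_surj)
    have "v \<bullet>c v = c * (cnj c * (v0 \<bullet>c v0))"
      unfolding v_def using v0(1) by (auto simp: scalar_prod_def sum_distrib_left algebra_simps)
    also have "\<dots> = complex_of_real ((1 / sqrt r)\<^sup>2 * r)"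
      using r(1) by (simp add: c_def r(2) power2_eq_square flip: of_real_mult)
    also have "\<dots> = 1" using r(1) by (simp add: power_divide)
    finally have v1: "v \<bullet>c v = 1" .
    obtain W where W: "W \<in> carrier_mat (Suc n) (Suc n)" "adj W * W = 1\<^sub>m (Suc n)" "col W 0 = v"
      using unitary_with_first_column[OF v v1] by blast
    define A' where "A' = adj W * A * W"
    have A': "A' \<in> carrier_mat (Suc n) (Suc n)" using carrier_matD[OF W(1)] carrier_matD[OF A] by (intro carrier_matI) (simp_all add: A'_def)
    have herm': "adj A' = A'"
      unfolding A'_def using W(1) A herm
      carrier_matD[OF W(1)] carrier_matD[OF A] by (simp add: adj_mult_dim mult_assoc_dim)
    have col0: "A' $$ (i,0) = (if i = 0 then ev else 0)" if i: "i < Suc n" for i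
    proof -
      have "A' = adj W * (A * W)"
        unfolding A'_def using carrier_matD[OF W(1)] carrier_matD[OF A] by (simp add: mult_assoc_dim)
      then have "A' $$ (i,0) = row (adj W) i \<bullet> col (A * W) 0"
        using W A i by simp
      also have "col (A * W) 0 = ev \<cdot>\<^sub>v v"
        using W A Av by (metis col_mult2 zero_less_Suc)
      also have "row (adj W) i \<bullet> (ev \<cdot>\<^sub>v v) = ev * (row (adj W) i \<bullet> col W 0)"
        using W(1) i W(3) v by (simp add: scalar_prod_smult_distrib[of _ "Suc n"])
      also have "row (adj W) i \<bullet> col W 0 = (adj W * W) $$ (i,0)"
        using W(1) i by simp
      also have "\<dots> = (if i = 0 then 1 else 0)" using W(2) i by simp
      finally show ?thesis by simp
    qed
    have A'cnj: "A' $$ (i,j) = cnj (A' $$ (j,i))" if "i < Suc n" "j < Suc n" for i j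
      using herm' that A' by (metis adj_index carrier_matD)
    have row0: "A' $$ (0,i) = (if i = 0 then cnj ev else 0)" if "i < Suc n" for i
      using A'cnj[of 0 i] col0[OF that] that by auto
    have evr: "complex_of_real (Re ev) = ev"
      using col0[of 0] row0[of 0] by (simp add: complex_eq_iff)
    define A3 where "A3 = Matrix.mat n n (\<lambda>(i,j). A' $$ (Suc i, Suc j))"
    have A3: "A3 \<in> carrier_mat n n" by (simp add: A3_def)
    have "adj A3 = A3"
      by (rule eq_matI) (auto simp: A3_def intro: A'cnj[symmetric])
    from Suc.IH[OF A3 this] obtain U e where U: "U \<in> carrier_mat n n" "adj U * U = 1\<^sub>m n"
      "A3 = U * rdiag n e * adj U"
      unfolding diagonalizes_def by auto
    define U' where "U' = Matrix.mat (Suc n) (Suc n) (\<lambda>(i,j). if i = 0 then (if j = 0 then 1 else 0)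
      else if j = 0 then 0 else U $$ (i-1,j-1))"
    define e' where "e' i = (if i = 0 then Re ev else e (i-1))" for i
    have U': "U' \<in> carrier_mat (Suc n) (Suc n)" by (simp add: U'_def)
    have UU: "adj U' * U' = 1\<^sub>m (Suc n)"
    proof (rule eq_matI)
      fix i j assume "i < dim_row (1\<^sub>m (Suc n) :: complex mat)" "j < dim_col (1\<^sub>m (Suc n) :: complex mat)"
      then have i: "i < Suc n" and j: "j < Suc n" by auto
      have UUi: "(\<Sum>k<n. cnj (U $$ (k,i)) * U $$ (k,j)) = (if i = j then 1 else 0)"
        if "i < n" "j < n" for i j
        using mult_index_sum[OF adj_carrier[OF U(1)] U(1) that] U(1,2) that by simp
      have "(adj U' * U') $$ (i,j) = (\<Sum>k<Suc n. cnj (U' $$ (k,i)) * U' $$ (k,j))"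
        using mult_index_sum[OF adj_carrier[OF U'] U' i j] U' i j by simp
      also have "\<dots> = (if i = j then 1 else 0)"
        unfolding sum.lessThan_Suc_shift
        using i j UUi by (cases i; cases j) (auto simp: U'_def)
      finally show "(adj U' * U') $$ (i,j) = (1\<^sub>m (Suc n) :: complex mat) $$ (i,j)"
        using i j by simp
    qed (use U' in auto)
    have A'U: "A' = U' * rdiag (Suc n) e' * adj U'"
    proof (rule eq_matI)
      fix i j assume "i < dim_row (U' * rdiag (Suc n) e' * adj U')"
        and "j < dim_col (U' * rdiag (Suc n) e' * adj U')"
      then have i: "i < Suc n" and j: "j < Suc n" using U' by auto
      have A3i: "(\<Sum>k<n. U $$ (i,k) * e k * cnj (U $$ (j,k))) = A' $$ (Suc i, Suc j)"
        if "i < n" "j < n" for i j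
      proof -
        have "A' $$ (Suc i, Suc j) = A3 $$ (i,j)" using that by (simp add: A3_def)
        then show ?thesis unfolding U(3) conj_diag_index[OF U(1) that] by simp
      qed
      show "A' $$ (i,j) = (U' * rdiag (Suc n) e' * adj U') $$ (i,j)"
        unfolding conj_diag_index[OF U' i j] sum.lessThan_Suc_shift
        using i j A3i col0[OF i] row0[OF j] evr by (cases i; cases j) (auto simp: U'_def e'_def)
    qed (use A' U' in auto)
    have "A = W * A' * adj W"
      unfolding A'_def using carrier_matD[OF W(1)] carrier_matD[OF A] unitary_right[OF W(1,2)]
      by (simp add: mult_assoc_dim unitary_cancel[OF W(1,2)])
    also have "\<dots> = (W * U') * rdiag (Suc n) e' * adj (W * U')"
      unfolding A'U using carrier_matD[OF W(1)] carrier_matD[OF U']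
      by (simp add: adj_mult_dim mult_assoc_dim)
    finally have "diagonalizes (Suc n) A (W * U') e'"
      unfolding diagonalizes_def using W U' unitary_mult[OF W(1,2) U' UU] by auto
    then show ?case by blast
  qed
  then show thesis using that by blast
qed

text \<open>Two diagonalisations of \<open>A\<close> are related by \<open>W = adj V * U\<close>,
  which intertwines the diagonal matrices. So an entry of \<open>W\<close> vanishes unless the two
  eigenvalues agree, and then \<open>W\<close> also intertwines their images under \<open>f\<close>.
  This makes the \<open>THE\<close> in \<open>herm_fun\<close> well defined.\<close>

lemma herm_fun_diagonalizes:
  assumes D: "diagonalizes n A U e"
  shows "herm_fun f A = U * rdiag n (\<lambda>i. f (e i)) * adj U"
proof -
  note U = diagonalizesD[OF D]
  have dim: "dim_row A = n" using U by auto
  show ?thesis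
    unfolding herm_fun_def Let_def dim
  proof (rule the_equality)
    show "\<exists>V g. V \<in> carrier_mat n n \<and> adj V * V = 1\<^sub>m n \<and>
      A = V * rdiag n g * adj V \<and>
      U * rdiag n (\<lambda>i. f (e i)) * adj U =
      V * rdiag n (\<lambda>i. f (g i)) * adj V"
      using U by blast
  next
    fix B assume "\<exists>V g. V \<in> carrier_mat n n \<and> adj V * V = 1\<^sub>m n \<and>
      A = V * rdiag n g * adj V \<and>
      B = V * rdiag n (\<lambda>i. f (g i)) * adj V"
    then obtain V g where V: "V \<in> carrier_mat n n" "adj V * V = 1\<^sub>m n"
      "A = V * rdiag n g * adj V"
      "B = V * rdiag n (\<lambda>i. f (g i)) * adj V" by blast
    note d[simp] = carrier_matD[OF U(1)] carrier_matD[OF V(1)]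
    note cancel = unitary_cancel[OF U(1,2)] unitary_cancel[OF V(1,2)]
    define W where "W = adj V * U"
    have W: "W \<in> carrier_mat n n" unfolding W_def by (rule mult_carrier_mat[OF adj_carrier[OF V(1)] U(1)])
    have comm: "W * rdiag n e = rdiag n g * W"
    proof -
      have "W * rdiag n e = adj V * A * U"
        unfolding W_def U(4) by (simp add: mult_assoc_dim cancel U(2))
      also have "\<dots> = rdiag n g * W"
        unfolding W_def V(3) by (simp add: mult_assoc_dim cancel)
      finally show ?thesis .
    qed
    have ent: "W $$ (i,j) * complex_of_real (e j) = complex_of_real (g i) * W $$ (i,j)"
      if "i < n" "j < n" for i j
    proof -
      have "(W * rdiag n e) $$ (i,j) = W $$ (i,j) * complex_of_real (e j)"
        using mat_diag_mult_right[OF W] that by auto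
      moreover have "(rdiag n g * W) $$ (i,j) = complex_of_real (g i) * W $$ (i,j)"
        using mat_diag_mult_left[OF W] that by auto
      ultimately show ?thesis using comm by metis
    qed
    have "W * rdiag n (\<lambda>i. f (e i)) = rdiag n (\<lambda>i. f (g i)) * W"
      unfolding mat_diag_mult_right[OF W] mat_diag_mult_left[OF W]
    proof (rule eq_matI, goal_cases)
      case (1 i j)
      then have ij: "i < n" "j < n" by auto
      have "W $$ (i,j) = 0 \<or> g i = e j"
        using ent[OF ij] by auto
      then show ?case using ij by auto
    qed auto
    then have "V * (W * rdiag n (\<lambda>i. f (e i)) * adj U) =
        V * (rdiag n (\<lambda>i. f (g i)) * W * adj U)"
      by simp
    then show "B = U * rdiag n (\<lambda>i. f (e i)) * adj U"
      unfolding W_def V(4) by (simp add: mult_assoc_dim cancel U(3))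
  qed
qed

lemma diagonalizes_herm_fun:
  "diagonalizes n A U e \<Longrightarrow> diagonalizes n (herm_fun f A) U (\<lambda>i. f (e i))"
  using herm_fun_diagonalizes unfolding diagonalizes_def by blast

section \<open>Positive semidefinite matrices and Nussbaum--Szkola weights\<close>

lemma qf_sum:
  assumes "A \<in> carrier_mat n n" "v \<in> carrier_vec n"
  shows "(A *\<^sub>v v) \<bullet>c v = (\<Sum>i<n. \<Sum>j<n. A $$ (i,j) * v $ j * cnj (v $ i))"
  using assms by (simp add: scalar_prod_def atLeast0LessThan sum_distrib_right)

lemma adj_mult_mult_index:
  fixes A X Y :: "complex mat"
  assumes A: "A \<in> carrier_mat n n'" and X: "X \<in> carrier_mat n m" and Y: "Y \<in> carrier_mat n' k"
    and "i < m" "j < k"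
  shows "(adj X * A * Y) $$ (i,j) = (\<Sum>a<n. \<Sum>b<n'. cnj (X $$ (a,i)) * A $$ (a,b) * Y $$ (b,j))"
proof -
  have "(adj X * A * Y) $$ (i,j) = (\<Sum>b<n'. (adj X * A) $$ (i,b) * Y $$ (b,j))"
    using assms by (intro mult_index_sum) auto
  also have "\<dots> = (\<Sum>b<n'. (\<Sum>a<n. cnj (X $$ (a,i)) * A $$ (a,b)) * Y $$ (b,j))"
  proof (intro sum.cong refl)
    fix b assume "b \<in> {..<n'}"
    then show "(adj X * A) $$ (i,b) * Y $$ (b,j) = (\<Sum>a<n. cnj (X $$ (a,i)) * A $$ (a,b)) * Y $$ (b,j)"
      using mult_index_sum[OF adj_carrier[OF X] A, of i b] assms by simp
  qed
  also have "\<dots> = (\<Sum>a<n. \<Sum>b<n'. cnj (X $$ (a,i)) * A $$ (a,b) * Y $$ (b,j))"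
    by (subst sum.swap) (simp add: sum_distrib_right)
  finally show ?thesis .
qed

lemma qf_col:
  fixes A X :: "complex mat"
  assumes A: "A \<in> carrier_mat n n" and X: "X \<in> carrier_mat n m" and k: "k < m"
  shows "(A *\<^sub>v col X k) \<bullet>c col X k = (adj X * A * X) $$ (k,k)"
  unfolding adj_mult_mult_index[OF A X X k k]
  using X k by (subst qf_sum[OF A]) (auto simp: algebra_simps intro!: sum.cong)

lemma qf_herm_real:
  assumes "A \<in> carrier_mat n n" "adj A = A" "v \<in> carrier_vec n"
  shows "Im ((A *\<^sub>v v) \<bullet>c v) = 0"
proof -
  have h: "cnj (A $$ (i,j)) = A $$ (j,i)" if "i < n" "j < n" for i j
    using assms(1,2) that by (metis adj_index carrier_matD)
  have "cnj ((A *\<^sub>v v) \<bullet>c v) = (\<Sum>i<n. \<Sum>j<n. A $$ (j,i) * v $ i * cnj (v $ j))"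
    unfolding qf_sum[OF assms(1,3)] by (auto simp: h algebra_simps intro!: sum.cong)
  also have "\<dots> = (A *\<^sub>v v) \<bullet>c v"
    unfolding qf_sum[OF assms(1,3)] by (rule sum.swap)
  finally show ?thesis by (simp add: complex_eq_iff)
qed

lemma psdI:
  assumes "A \<in> carrier_mat n n" "adj A = A"
    and "\<And>v. v \<in> carrier_vec n \<Longrightarrow> 0 \<le> Re ((A *\<^sub>v v) \<bullet>c v)"
  shows "psd A"
  unfolding psd_def using assms qf_herm_real[OF assms(1,2)] carrier_matD[OF assms(1)]
  by (auto simp: less_eq_complex_def)

lemma psdD:
  assumes "psd A" "A \<in> carrier_mat n n"
  shows "adj A = A" "v \<in> carrier_vec n \<Longrightarrow> 0 \<le> Re ((A *\<^sub>v v) \<bullet>c v)"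
  using assms unfolding psd_def by (auto simp: less_eq_complex_def)

lemma psd_trace_quad:
  fixes A X :: "complex mat"
  assumes "psd A" "A \<in> carrier_mat n n" "X \<in> carrier_mat n m"
  shows "0 \<le> Re (mat_trace (adj X * A * X))"
proof -
  have "mat_trace (adj X * A * X) = (\<Sum>k<m. (adj X * A * X) $$ (k,k))"
    using assms by (intro trace_sum[of _ m m]) auto
  also have "\<dots> = (\<Sum>k<m. (A *\<^sub>v col X k) \<bullet>c col X k)"
    using qf_col[OF assms(2,3)] by simp
  finally show ?thesis
    using psdD(2)[OF assms(1,2)] assms(3) by (auto intro!: sum_nonneg)
qed

lemma psd_gram:
  fixes B :: "complex mat"
  assumes B: "B \<in> carrier_mat n m"
  shows "psd (B * adj B)"
proof (rule psdI[of _ n])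
  show "B * adj B \<in> carrier_mat n n" using B by auto
  show "adj (B * adj B) = B * adj B"
    by (simp add: adj_mult_dim)
  fix v :: "complex vec" assume v: "v \<in> carrier_vec n"
  have "(B * adj B *\<^sub>v v) \<bullet>c v =
      (\<Sum>i<n. \<Sum>j<n. \<Sum>l<m. B $$ (i,l) * cnj (B $$ (j,l)) * v $ j * cnj (v $ i))"
    unfolding qf_sum[OF \<open>B * adj B \<in> carrier_mat n n\<close> v]
  proof (intro sum.cong refl)
    fix i j assume "i \<in> {..<n}" "j \<in> {..<n}"
    then show "(B * adj B) $$ (i,j) * v $ j * cnj (v $ i) =
      (\<Sum>l<m. B $$ (i,l) * cnj (B $$ (j,l)) * v $ j * cnj (v $ i))"
      using mult_index_sum[OF B adj_carrier[OF B], of i j] B by (simp add: sum_distrib_right)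
  qed
  also have "\<dots> = (\<Sum>l<m. \<Sum>i<n. \<Sum>j<n. B $$ (i,l) * cnj (B $$ (j,l)) * v $ j * cnj (v $ i))"
    by (simp add: sum.swap[of _ "{..<n}" "{..<m}"])
  also have "\<dots> = (\<Sum>l<m. (\<Sum>i<n. B $$ (i,l) * cnj (v $ i)) * cnj (\<Sum>i<n. B $$ (i,l) * cnj (v $ i)))"
    by (simp add: sum_product) (simp add: algebra_simps)
  also have "\<dots> = complex_of_real (\<Sum>l<m. (cmod (\<Sum>i<n. B $$ (i,l) * cnj (v $ i)))\<^sup>2)"
    by (simp only: of_real_sum complex_norm_square)
  finally show "0 \<le> Re ((B * adj B *\<^sub>v v) \<bullet>c v)"
    by (simp only: Re_complex_of_real) (auto intro!: sum_nonneg)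
qed

lemma diagonalizes_conj:
  assumes "diagonalizes n A U e"
  shows "adj U * A * U = rdiag n e"
  using diagonalizesD[OF assms] carrier_matD[OF diagonalizesD(1)[OF assms]]
  by (simp add: mult_assoc_dim unitary_cancel)

lemma psd_eigenvalues_nonneg:
  assumes D: "diagonalizes n A U e" and "psd A" "i < n"
  shows "0 \<le> e i"
proof -
  note U = diagonalizesD[OF D]
  have "(A *\<^sub>v col U i) \<bullet>c col U i = complex_of_real (e i)"
    using qf_col[OF U(5,1) assms(3)] diagonalizes_conj[OF D] assms(3) by simp
  moreover have "0 \<le> Re ((A *\<^sub>v col U i) \<bullet>c col U i)"
    using psdD(2)[OF assms(2) U(5)] U(1) assms(3) by auto
  ultimately show ?thesis by simp
qed

lemma psd_diagonalizable:
  assumes "psd A" "A \<in> carrier_mat n n"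
  obtains U e where "diagonalizes n A U e" "\<And>i. i < n \<Longrightarrow> 0 \<le> e i"
  using hermitian_diagonalizable[OF assms(2) psdD(1)[OF assms]] psd_eigenvalues_nonneg assms(1) by metis

lemma conj_diag_eq_gram:
  assumes U: "U \<in> carrier_mat n n" and "\<And>i. i < n \<Longrightarrow> 0 \<le> e i"
  shows "U * rdiag n e * adj U =
    (U * rdiag n (\<lambda>i. sqrt (e i))) * adj (U * rdiag n (\<lambda>i. sqrt (e i)))"
proof -
  have "rdiag n e =
      rdiag n (\<lambda>i. sqrt (e i)) * rdiag n (\<lambda>i. sqrt (e i))"
    unfolding mat_diag_diag by (rule eq_matI) (use assms(2) in \<open>auto simp flip: of_real_mult\<close>)
  then show ?thesis
    using carrier_matD[OF U] by (simp add: adj_mult_dim mult_assoc_dim del: mat_diag_diag)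
qed

lemma psd_conj_diag:
  assumes "U \<in> carrier_mat n n" "\<And>i. i < n \<Longrightarrow> 0 \<le> e i"
  shows "psd (U * rdiag n e * adj U)"
proof -
  have "psd ((U * rdiag n (\<lambda>i. sqrt (e i))) *
      adj (U * rdiag n (\<lambda>i. sqrt (e i))))"
    using assms(1) by (intro psd_gram[of _ n n]) auto
  moreover have "U * rdiag n e * adj U =
    (U * rdiag n (\<lambda>i. sqrt (e i))) * adj (U * rdiag n (\<lambda>i. sqrt (e i)))"
    by (rule conj_diag_eq_gram) (use assms in auto)
  ultimately show ?thesis by simp
qed

lemma trace_quad_diag:
  fixes x :: "complex mat"
  assumes x: "x \<in> carrier_mat n m"
  shows "mat_trace (adj x * rdiag n e * x) =
    complex_of_real (\<Sum>i<n. \<Sum>j<m. e i * (cmod (x $$ (i,j)))\<^sup>2)"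
proof -
  have "mat_trace (adj x * rdiag n e * x) =
      (\<Sum>k<m. (adj x * rdiag n e * x) $$ (k,k))"
    using x by (intro trace_sum[of _ m m]) (auto intro!: mult_carrier_mat[of _ _ n])
  also have "\<dots> = (\<Sum>k<m. \<Sum>a<n. \<Sum>b<n. cnj (x $$ (a,k)) * (if a = b then complex_of_real (e b) else 0) * x $$ (b,k))"
    by (intro sum.cong refl) (subst adj_mult_mult_index[OF mat_diag_dim x x], auto intro!: sum.cong)
  also have "\<dots> = (\<Sum>k<m. \<Sum>a<n. \<Sum>b<n. if a = b then cnj (x $$ (a,k)) * complex_of_real (e b) * x $$ (b,k) else 0)"
    by (intro sum.cong refl) auto
  also have "\<dots> = (\<Sum>k<m. \<Sum>a<n. complex_of_real (e a * (cmod (x $$ (a,k)))\<^sup>2))"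
    by (simp add: sum.delta' complex_norm_square algebra_simps del: of_real_power)
  also have "\<dots> = complex_of_real (\<Sum>i<n. \<Sum>j<m. e i * (cmod (x $$ (i,j)))\<^sup>2)"
    by (subst sum.swap) simp
  finally show ?thesis .
qed

lemma trace_quad_diagonalizes:
  fixes Y :: "complex mat"
  assumes D: "diagonalizes n A U e" and Y: "Y \<in> carrier_mat n m"
  shows "mat_trace (adj Y * A * Y) =
    complex_of_real (\<Sum>i<n. \<Sum>j<m. e i * (cmod ((adj U * Y) $$ (i,j)))\<^sup>2)"
proof -
  note U = diagonalizesD[OF D]
  have "adj Y * A * Y =
      adj (adj U * Y) * rdiag n e * (adj U * Y)"
    unfolding U(4) using carrier_matD[OF U(1)] carrier_matD[OF Y]
    by (simp add: mult_assoc_dim adj_mult_dim)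
  then show ?thesis
    using trace_quad_diag[OF mult_carrier_mat[OF adj_carrier[OF U(1)] Y]] by simp
qed

section \<open>Overlaps of two eigenbases and traces of mixed products\<close>

definition overlap :: "complex mat \<Rightarrow> complex mat \<Rightarrow> nat \<Rightarrow> nat \<Rightarrow> real" where
  "overlap U V i j = (cmod ((adj U * V) $$ (i,j)))\<^sup>2"

lemma overlap_nonneg[simp]: "0 \<le> overlap U V i j"
  by (simp add: overlap_def)

lemma overlap_row_sum:
  assumes "U \<in> carrier_mat n n" "adj U * U = 1\<^sub>m n" "V \<in> carrier_mat n n" "adj V * V = 1\<^sub>m n"
    and i: "i < n"
  shows "(\<Sum>j<n. overlap U V i j) = 1"
proof -
  let ?W = "adj U * V"
  have W: "?W \<in> carrier_mat n n" using assms by auto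
  have "?W * adj ?W = 1\<^sub>m n"
    using carrier_matD[OF assms(1)] carrier_matD[OF assms(3)] assms(2)
    by (simp add: adj_mult_dim mult_assoc_dim unitary_cancel[OF assms(3,4)])
  then have "(1\<^sub>m n :: complex mat) $$ (i,i) = (?W * adj ?W) $$ (i,i)" by simp
  also have "\<dots> = (\<Sum>j<n. ?W $$ (i,j) * adj ?W $$ (j,i))"
    by (rule mult_index_sum[OF W adj_carrier[OF W] i i])
  also have "\<dots> = (\<Sum>j<n. complex_of_real (overlap U V i j))"
  proof (intro sum.cong refl)
    fix j assume "j \<in> {..<n}"
    then have "adj ?W $$ (j,i) = cnj (?W $$ (i,j))"
      using W i by (intro adj_index) auto
    then show "?W $$ (i,j) * adj ?W $$ (j,i) = complex_of_real (overlap U V i j)"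
      by (simp add: overlap_def complex_norm_square del: of_real_power)
  qed
  finally have "complex_of_real (\<Sum>j<n. overlap U V i j) = 1" using i by simp
  then show ?thesis by (metis of_real_eq_1_iff)
qed

lemma overlap_sym:
  assumes "U \<in> carrier_mat n n" "V \<in> carrier_mat n n" "i < n" "j < n"
  shows "overlap U V i j = overlap V U j i"
proof -
  have "adj V * U = adj (adj U * V)"
    using carrier_matD[OF assms(1)] carrier_matD[OF assms(2)] by (simp add: adj_mult_dim)
  then have "(adj V * U) $$ (j,i) = cnj ((adj U * V) $$ (i,j))"
    using assms by simp
  then show ?thesis by (simp add: overlap_def)
qed

lemma overlap_col_sum:
  assumes "U \<in> carrier_mat n n" "adj U * U = 1\<^sub>m n" "V \<in> carrier_mat n n" "adj V * V = 1\<^sub>m n"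
    and "j < n"
  shows "(\<Sum>i<n. overlap U V i j) = 1"
  using overlap_row_sum[OF assms(3,4,1,2,5)] overlap_sym[OF assms(1,3) _ assms(5)] by simp

text \<open>Here noncommuting matrices turn into a classical double sum: cyclicity moves both
  unitaries into \<open>adj U * V\<close>, and only the squared moduli of its entries
  survive.\<close>

lemma trace_conj_diag_mult:
  assumes U: "U \<in> carrier_mat n n" and V: "V \<in> carrier_mat n n"
  shows "mat_trace (U * rdiag n f * adj U *
      (V * rdiag n g * adj V)) =
    complex_of_real (\<Sum>i<n. \<Sum>j<n. overlap U V i j * (f i * g j))"
proof -
  let ?F = "rdiag n f" and ?G = "rdiag n g"
  let ?W = "adj U * V"
  have W: "?W \<in> carrier_mat n n" using U V by auto
  note d = carrier_matD[OF U] carrier_matD[OF V]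
  have "mat_trace (U * ?F * adj U * (V * ?G * adj V)) =
      mat_trace (U * (?F * ?W * ?G * adj V))"
    using d by (simp add: mult_assoc_dim)
  also have "\<dots> = mat_trace (?F * ?W * ?G * adj V * U)"
    using U V by (intro trace_comm[of _ n n]) (auto intro!: mult_carrier_mat[of _ n n])
  also have "?F * ?W * ?G * adj V * U = (?F * ?W * ?G) * adj ?W"
    using d by (simp add: mult_assoc_dim adj_mult_dim)
  also have "?F * ?W * ?G = Matrix.mat n n (\<lambda>(i,j). f i * ?W $$ (i,j) * g j)"
    unfolding mat_diag_mult_left[OF W]
    by (subst mat_diag_mult_right[of _ n n]) (auto intro!: eq_matI)
  also have "mat_trace (\<dots> * adj ?W) = (\<Sum>i<n. \<Sum>j<n. f i * ?W $$ (i,j) * g j * cnj (?W $$ (i,j)))"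
    using W by (subst trace_mult_sum[of _ n n]) (auto intro!: sum.cong simp del: index_mult_mat)
  also have "\<dots> = complex_of_real (\<Sum>i<n. \<Sum>j<n. overlap U V i j * (f i * g j))"
    by (auto simp: overlap_def complex_norm_square algebra_simps simp del: of_real_power index_mult_mat intro!: sum.cong)
  finally show ?thesis .
qed

lemma trace_herm_fun_mult:
  assumes "diagonalizes n A U e" "diagonalizes n B V g"
  shows "mat_trace (herm_fun f A * herm_fun h B) =
    complex_of_real (\<Sum>i<n. \<Sum>j<n. overlap U V i j * (f (e i) * h (g j)))"
  unfolding herm_fun_diagonalizes[OF assms(1)] herm_fun_diagonalizes[OF assms(2)]
  by (rule trace_conj_diag_mult[OF diagonalizesD(1)[OF assms(1)] diagonalizesD(1)[OF assms(2)]])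

lemma trace_diagonalizes:
  assumes D: "diagonalizes n A U e"
  shows "mat_trace A = complex_of_real (\<Sum>i<n. e i)"
proof -
  note U = diagonalizesD[OF D]
  have "mat_trace A = mat_trace (U * (rdiag n e * adj U))"
    unfolding U(4) using carrier_matD[OF U(1)] by (simp add: mult_assoc_dim)
  also have "\<dots> = mat_trace (rdiag n e * adj U * U)"
    using U by (intro trace_comm[of _ n n]) auto
  also have "rdiag n e * adj U * U = rdiag n e"
    using carrier_matD[OF U(1)] U(2) by (simp add: mult_assoc_dim)
  also have "mat_trace \<dots> = complex_of_real (\<Sum>i<n. e i)"
    by (simp add: mat_trace_def)
  finally show ?thesis .
qed

lemma herm_fun_id:
  assumes "diagonalizes n A U e"
  shows "herm_fun (\<lambda>x. x) A = A"
  using herm_fun_diagonalizes[OF assms] diagonalizesD(4)[OF assms] by simp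

section \<open>Fidelity\<close>

lemma mat_sqrt_psd:
  assumes "psd A" "A \<in> carrier_mat n n"
  shows "mat_sqrt A \<in> carrier_mat n n" "adj (mat_sqrt A) = mat_sqrt A" "mat_sqrt A * mat_sqrt A = A"
proof -
  obtain U e where D: "diagonalizes n A U e" and e: "\<And>i. i < n \<Longrightarrow> 0 \<le> e i"
    using psd_diagonalizable[OF assms] by blast
  note U = diagonalizesD[OF D]
  have D': "diagonalizes n (mat_sqrt A) U (\<lambda>i. sqrt (e i))"
    unfolding mat_sqrt_def by (rule diagonalizes_herm_fun[OF D])
  show "mat_sqrt A \<in> carrier_mat n n" "adj (mat_sqrt A) = mat_sqrt A"
    using diagonalizesD[OF D'] by auto
  have "A = (U * rdiag n (\<lambda>i. sqrt (e i))) * adj (U * rdiag n (\<lambda>i. sqrt (e i)))"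
    by (subst U(4), rule conj_diag_eq_gram) (use U e in auto)
  also have "\<dots> = mat_sqrt A * mat_sqrt A"
    unfolding diagonalizesD(4)[OF D'] using carrier_matD[OF U(1)]
    by (simp add: mult_assoc_dim adj_mult_dim unitary_cancel[OF U(1,2)])
  finally show "mat_sqrt A * mat_sqrt A = A" by simp
qed

lemma frob2_mat_sqrt:
  assumes "psd A" "A \<in> carrier_mat n n"
  shows "complex_of_real (frob2 (mat_sqrt A)) = mat_trace A"
  using frob2_trace(2)[of "mat_sqrt A"] mat_sqrt_psd[OF assms] by metis

lemma fidelity_diag:
  assumes \<rho>: "psd \<rho>" "\<rho> \<in> carrier_mat n n" and \<tau>: "psd \<tau>" "\<tau> \<in> carrier_mat n n"
  obtains X s where "diagonalizes n (mat_sqrt \<tau> * \<rho> * mat_sqrt \<tau>) X s" "\<And>k. k < n \<Longrightarrow> 0 \<le> s k"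
    "fidelity \<rho> \<tau> = (\<Sum>k<n. sqrt (s k))"
proof -
  note r = mat_sqrt_psd[OF \<rho>] and t = mat_sqrt_psd[OF \<tau>]
  let ?S = "mat_sqrt \<tau> * \<rho> * mat_sqrt \<tau>"
  have "?S = (mat_sqrt \<tau> * mat_sqrt \<rho>) * adj (mat_sqrt \<tau> * mat_sqrt \<rho>)"
    using carrier_matD[OF r(1)] carrier_matD[OF t(1)] carrier_matD[OF \<rho>(2)] r(2) t(2)
    by (subst r(3)[symmetric]) (simp add: adj_mult_dim mult_assoc_dim)
  then have S: "psd ?S"
    using psd_gram[of "mat_sqrt \<tau> * mat_sqrt \<rho>" n n] r(1) t(1) by auto
  have Sc: "?S \<in> carrier_mat n n" using t(1) \<rho>(2) by auto
  obtain X s where D: "diagonalizes n ?S X s" and s: "\<And>k. k < n \<Longrightarrow> 0 \<le> s k"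
    using psd_diagonalizable[OF S Sc] by blast
  have "fidelity \<rho> \<tau> = (\<Sum>k<n. sqrt (s k))"
    unfolding fidelity_def
    using trace_diagonalizes[OF diagonalizes_herm_fun[OF D, of sqrt]] by (simp add: mat_sqrt_def)
  then show thesis using that D s by blast
qed

lemma fidelity_nonneg:
  assumes "psd \<rho>" "\<rho> \<in> carrier_mat n n" "psd \<tau>" "\<tau> \<in> carrier_mat n n"
  shows "0 \<le> fidelity \<rho> \<tau>"
  by (rule fidelity_diag[OF assms]) (auto intro!: sum_nonneg)

text \<open>The hypothesis \<open>WW\<close> makes \<open>W * adj W\<close> an orthogonal
  projection. By Pythagoras, \<open>frob2 Z\<close> is \<open>frob2 (adj W * Z)\<close> plus the
  norm of the part of \<open>Z\<close> orthogonal to the range of \<open>W\<close>.\<close>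

lemma frob2_mult_partial_isometry:
  fixes W Z :: "complex mat"
  assumes W: "W \<in> carrier_mat n m" and WW: "W * (adj W * W) = W" and Z: "Z \<in> carrier_mat n k"
  shows "frob2 (adj W * Z) \<le> frob2 Z"
proof -
  note d = carrier_matD[OF W] carrier_matD[OF Z]
  let ?P = "W * adj W"
  have P: "?P \<in> carrier_mat n n" using W by auto
  have WW': "adj W * (W * adj W) = adj W"
    using arg_cong[OF WW, of adj] d by (simp add: adj_mult_dim mult_assoc_dim)
  have Q: "adj (Z - ?P * Z) * (Z - ?P * Z) = adj Z * Z - adj (adj W * Z) * (adj W * Z)"
  proof -
    have PP: "?P * (?P * Z) = ?P * Z"
      using d WW' by (metis adj_dim(1) adj_dim(2) index_mult_mat(2,3) mult_assoc_dim)
    have "adj (Z - ?P * Z) * (Z - ?P * Z) = (adj Z - adj Z * ?P) * (Z - ?P * Z)"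
      using d by (subst adj_minus[of _ n k]) (auto simp: adj_mult_dim mult_assoc_dim Z W intro!: mult_carrier_mat[of _ n n] P)
    also have "\<dots> = adj Z * (Z - ?P * Z) - adj Z * ?P * (Z - ?P * Z)"
      using d by (intro minus_mult_distrib_mat[of _ k n _ _ k] carrier_matI) simp_all
    also have "?P * (Z - ?P * Z) = 0\<^sub>m n k"
    proof -
      have "?P * (Z - ?P * Z) = ?P * Z - ?P * (?P * Z)"
        using Z P by (intro mult_minus_distrib_mat[of _ n n _ k]) auto
      then show ?thesis using PP Z P by (auto simp: minus_r_inv_mat)
    qed
    then have "adj Z * ?P * (Z - ?P * Z) = 0\<^sub>m k k"
      using Z P d by (simp add: mult_assoc_dim)
    moreover have "adj Z * (Z - ?P * Z) = adj Z * Z - adj Z * (?P * Z)"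
      using Z P by (intro mult_minus_distrib_mat[of _ k n _ k]) auto
    ultimately show ?thesis
      using d by (auto simp: adj_mult_dim mult_assoc_dim intro!: eq_matI)
  qed
  have "complex_of_real (frob2 (Z - ?P * Z)) = complex_of_real (frob2 Z) - complex_of_real (frob2 (adj W * Z))"
  proof -
    have "Z - ?P * Z \<in> carrier_mat n k" "adj W * Z \<in> carrier_mat m k"
      using d by (auto intro!: carrier_matI)
    note f = frob2_trace(1)[OF this(1)] frob2_trace(1)[OF Z] frob2_trace(1)[OF this(2)]
    have "mat_trace (adj Z * Z - adj (adj W * Z) * (adj W * Z)) =
      mat_trace (adj Z * Z) - mat_trace (adj (adj W * Z) * (adj W * Z))"
      using d by (intro trace_minus[of _ k] carrier_matI) simp_all
    then show ?thesis using f Q by metis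
  qed
  then have "frob2 (Z - ?P * Z) = frob2 Z - frob2 (adj W * Z)"
    by (metis of_real_diff of_real_eq_iff)
  then show ?thesis using frob2_nonneg[of "Z - ?P * Z"] by simp
qed

lemma frob2_mult_unitary:
  fixes Z V :: "complex mat"
  assumes V: "V \<in> carrier_mat n n" "adj V * V = 1\<^sub>m n" and Z: "Z \<in> carrier_mat k n"
  shows "frob2 (Z * V) = frob2 Z"
proof -
  have "(Z * V) * adj (Z * V) = Z * adj Z"
    using carrier_matD[OF V(1)] carrier_matD[OF Z]
    by (simp add: adj_mult_dim mult_assoc_dim unitary_cancel[OF V])
  then show ?thesis
    using frob2_trace(2)[OF Z] frob2_trace(2)[OF mult_carrier_mat[OF Z V(1)]] by simp
qed

text \<open>The fidelity is the trace norm of \<open>r * t\<close> for the square roots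
  \<open>r\<close>, \<open>t\<close> of the two states, that is, a trace against a partial isometry.
  Inserting \<open>X + (1 - X)\<close> between \<open>r\<close> and \<open>t\<close> gives two
  traces. Cauchy-Schwarz bounds each of them by one of the quadratic forms, because \<open>r\<close>
  and \<open>t\<close> have Frobenius norm 1.\<close>

lemma fidelity_split:
  assumes \<rho>: "\<rho> \<in> density_ops n" and \<tau>: "\<tau> \<in> density_ops n" and X: "X \<in> carrier_mat n n"
  shows "fidelity \<rho> \<tau> \<le> sqrt (Re (mat_trace (adj X * \<rho> * X))) +
    sqrt (Re (mat_trace ((1\<^sub>m n - X) * \<tau> * adj (1\<^sub>m n - X))))"
proof -
  have \<rho>': "psd \<rho>" "\<rho> \<in> carrier_mat n n" "mat_trace \<rho> = 1"
    and \<tau>': "psd \<tau>" "\<tau> \<in> carrier_mat n n" "mat_trace \<tau> = 1"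
    using \<rho> \<tau> by (auto simp: density_ops_def)
  define r where "r = mat_sqrt \<rho>"
  define t where "t = mat_sqrt \<tau>"
  note r = mat_sqrt_psd[OF \<rho>'(1,2), folded r_def] and t = mat_sqrt_psd[OF \<tau>'(1,2), folded t_def]
  obtain V s where D: "diagonalizes n (t * \<rho> * t) V s" and s: "\<And>k. k < n \<Longrightarrow> 0 \<le> s k"
    and F: "fidelity \<rho> \<tau> = (\<Sum>k<n. sqrt (s k))"
    using fidelity_diag[OF \<rho>'(1,2) \<tau>'(1,2)] unfolding t_def by blast
  note V = diagonalizesD[OF D]
  define Y where "Y = r * t * V"
  \<comment> \<open>Pseudo-inverse of the singular values of \<open>Y\<close>: zero is sent to zero,
    so \<open>W\<close> is the polar factor of \<open>Y\<close> and in general only a partial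
    isometry.\<close>
  define g where "g k = (if s k = 0 then 0 else 1 / sqrt (s k))" for k
  define W where "W = Y * mat_diag n (\<lambda>k. complex_of_real (g k))"
  define Q where "Q = 1\<^sub>m n - X"
  have Qc: "Q \<in> carrier_mat n n" using X by (auto simp: Q_def intro!: carrier_matI)
  have Y: "Y \<in> carrier_mat n n" using r(1) t(1) V(1) by (simp add: Y_def)
  have W: "W \<in> carrier_mat n n" using Y by (simp add: W_def)
  note d = carrier_matD[OF r(1)] carrier_matD[OF t(1)] carrier_matD[OF V(1)] carrier_matD[OF X]
    carrier_matD[OF Qc] carrier_matD[OF Y] carrier_matD[OF W] carrier_matD[OF \<rho>'(2)] carrier_matD[OF \<tau>'(2)]
  have YY: "adj Y * Y = mat_diag n (\<lambda>k. complex_of_real (s k))"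
  proof -
    have "adj Y * Y = adj V * (t * (r * r) * t) * V"
      unfolding Y_def using d r(2) t(2) by (simp add: adj_mult_dim mult_assoc_dim)
    then show ?thesis using diagonalizes_conj[OF D] r(3) by simp
  qed
  have WY: "adj W * Y = mat_diag n (\<lambda>k. complex_of_real (sqrt (s k)))"
  proof -
    have "adj W * Y = mat_diag n (\<lambda>k. complex_of_real (g k)) * (adj Y * Y)"
      unfolding W_def using d by (simp add: adj_mult_dim mult_assoc_dim)
    then show ?thesis
      unfolding YY mat_diag_diag
      by (auto simp: g_def real_div_sqrt s simp flip: of_real_mult intro!: eq_matI)
  qed
  have WW: "W * (adj W * W) = W"
  proof -
    have "W * (adj W * W) = Y * (mat_diag n (\<lambda>k. complex_of_real (g k)) *
       ((adj W * Y) * mat_diag n (\<lambda>k. complex_of_real (g k))))"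
      unfolding W_def using d by (simp add: mult_assoc_dim)
    also have "mat_diag n (\<lambda>k. complex_of_real (g k)) * ((adj W * Y) * mat_diag n (\<lambda>k. complex_of_real (g k)))
      = mat_diag n (\<lambda>k. complex_of_real (g k))"
      unfolding WY mat_diag_diag
      by (auto simp: g_def s simp flip: of_real_mult intro!: eq_matI)
    finally show ?thesis by (simp add: W_def)
  qed
  have "complex_of_real (fidelity \<rho> \<tau>) = mat_trace (adj W * Y)"
    unfolding WY F by (simp add: mat_trace_def)
  also have "adj W * Y = adj W * (r * X) * (t * V) + adj W * r * (Q * t * V)"
  proof -
    have "X + Q = 1\<^sub>m n" using X by (auto simp: Q_def intro!: eq_matI)
    then have "Y = r * ((X + Q) * (t * V))" unfolding Y_def using d by (simp add: mult_assoc_dim)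
    also have "(X + Q) * (t * V) = X * (t * V) + Q * (t * V)"
      using d by (intro add_mult_distrib_mat[of _ n n _ _ n] carrier_matI) simp_all
    also have "r * \<dots> = r * (X * (t * V)) + r * (Q * (t * V))"
      using d by (intro mult_add_distrib_mat[of _ n n _ n] carrier_matI) simp_all
    also have "adj W * \<dots> = adj W * (r * (X * (t * V))) + adj W * (r * (Q * (t * V)))"
      using d by (intro mult_add_distrib_mat[of _ n n _ n] carrier_matI) simp_all
    finally show ?thesis using d by (simp add: mult_assoc_dim)
  qed
  also have "mat_trace \<dots> = mat_trace (adj W * (r * X) * (t * V)) + mat_trace (adj W * r * (Q * t * V))"
    using d by (intro trace_add[of _ n] carrier_matI) simp_all
  finally have "fidelity \<rho> \<tau> = Re (mat_trace (adj W * (r * X) * (t * V)) + mat_trace (adj W * r * (Q * t * V)))"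
    by (metis Re_complex_of_real)
  also have "\<dots> \<le> cmod (mat_trace (adj W * (r * X) * (t * V))) + cmod (mat_trace (adj W * r * (Q * t * V)))"
    using complex_Re_le_cmod norm_triangle_ineq order_trans by blast
  also have "\<dots> \<le> sqrt (frob2 (adj W * (r * X))) * sqrt (frob2 (t * V)) +
      sqrt (frob2 (adj W * r)) * sqrt (frob2 (Q * t * V))"
    using d by (intro add_mono trace_Cauchy_Schwarz[of _ n n] carrier_matI) simp_all
  also have "\<dots> \<le> sqrt (frob2 (r * X)) * sqrt (frob2 t) + sqrt (frob2 r) * sqrt (frob2 (Q * t))"
  proof -
    have "frob2 (adj W * (r * X)) \<le> frob2 (r * X)"
      by (rule frob2_mult_partial_isometry[OF W WW mult_carrier_mat[OF r(1) X]])
    moreover have "frob2 (adj W * r) \<le> frob2 r"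
      by (rule frob2_mult_partial_isometry[OF W WW r(1)])
    moreover have "frob2 (t * V) = frob2 t" "frob2 (Q * t * V) = frob2 (Q * t)"
      using frob2_mult_unitary[OF V(1,2) t(1)] frob2_mult_unitary[OF V(1,2) mult_carrier_mat[OF Qc t(1)]] by auto
    ultimately show ?thesis by (intro add_mono mult_mono) auto
  qed
  also have "frob2 t = 1"
    using frob2_mat_sqrt[OF \<tau>'(1,2)] \<tau>'(3) unfolding t_def by (metis of_real_eq_1_iff)
  also have "frob2 r = 1"
    using frob2_mat_sqrt[OF \<rho>'(1,2)] \<rho>'(3) unfolding r_def by (metis of_real_eq_1_iff)
  also have "frob2 (r * X) = Re (mat_trace (adj X * \<rho> * X))"
  proof -
    have "adj (r * X) * (r * X) = adj X * (r * r) * X"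
      using d r(2) by (simp add: adj_mult_dim mult_assoc_dim)
    then show ?thesis
      using frob2_trace(1)[OF mult_carrier_mat[OF r(1) X]] r(3) by simp
  qed
  also have "frob2 (Q * t) = Re (mat_trace (Q * \<tau> * adj Q))"
  proof -
    have "Q * t * adj (Q * t) = Q * (t * t) * adj Q"
      using d t(2) by (simp add: adj_mult_dim mult_assoc_dim)
    then show ?thesis
      using frob2_trace(2)[OF mult_carrier_mat[OF Qc t(1)]] t(3) by simp
  qed
  finally show ?thesis by (simp add: Q_def)
qed

lemma frob2_eq_0D:
  assumes "frob2 A = 0" "A \<in> carrier_mat n m"
  shows "A = 0\<^sub>m n m"
proof (rule eq_matI)
  fix i j assume ij: "i < dim_row (0\<^sub>m n m :: complex mat)" "j < dim_col (0\<^sub>m n m :: complex mat)"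
  have "(\<Sum>j<m. (cmod (A $$ (i,j)))\<^sup>2) = 0"
    using assms ij by (simp add: frob2_sum[OF assms(2)] sum_nonneg_eq_0_iff sum_nonneg)
  then show "A $$ (i,j) = 0\<^sub>m n m $$ (i,j)"
    using ij by (simp add: sum_nonneg_eq_0_iff)
qed (use assms in auto)

text \<open>Cauchy-Schwarz is applied to each row separately. In a basis where
  \<open>Y * adj Y\<close> is diagonal, this gives a sum of singular values, hence a trace norm,
  where the global inequality would give a product of Frobenius norms.\<close>

lemma trace_adj_mult_rows:
  fixes Y Z :: "complex mat"
  assumes Y: "Y \<in> carrier_mat n m" and Z: "Z \<in> carrier_mat n m"
  shows "Re (mat_trace (adj Y * Z)) \<le>
    (\<Sum>k<n. sqrt (Re ((Y * adj Y) $$ (k,k))) * sqrt (Re ((Z * adj Z) $$ (k,k))))"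
proof -
  have row: "Re ((A * adj A) $$ (k,k)) = (\<Sum>l<m. (cmod (A $$ (k,l)))\<^sup>2)"
    if "A \<in> carrier_mat n m" "k < n" for A k
  proof -
    have "(A * adj A) $$ (k,k) = (\<Sum>l<m. A $$ (k,l) * adj A $$ (l,k))"
      using that by (intro mult_index_sum) auto
    also have "\<dots> = (\<Sum>l<m. complex_of_real ((cmod (A $$ (k,l)))\<^sup>2))"
      using that by (auto simp: complex_norm_square simp del: of_real_power intro!: sum.cong)
    finally show ?thesis by (simp flip: of_real_sum)
  qed
  have "mat_trace (adj Y * Z) = (\<Sum>l<m. \<Sum>k<n. cnj (Y $$ (k,l)) * Z $$ (k,l))"
    using Y Z by (subst trace_mult_sum[of _ m n]) (auto intro!: sum.cong)
  also have "\<dots> = (\<Sum>k<n. \<Sum>l<m. cnj (Y $$ (k,l)) * Z $$ (k,l))"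
    by (rule sum.swap)
  finally have "Re (mat_trace (adj Y * Z)) \<le> cmod (\<Sum>k<n. \<Sum>l<m. cnj (Y $$ (k,l)) * Z $$ (k,l))"
    using complex_Re_le_cmod by metis
  also have "\<dots> \<le> (\<Sum>k<n. \<Sum>l<m. cmod (Y $$ (k,l)) * cmod (Z $$ (k,l)))"
    by (intro order_trans[OF norm_sum] sum_mono order_trans[OF norm_sum]) (simp add: norm_mult)
  also have "\<dots> \<le> (\<Sum>k<n. sqrt (\<Sum>l<m. (cmod (Y $$ (k,l)))\<^sup>2) * sqrt (\<Sum>l<m. (cmod (Z $$ (k,l)))\<^sup>2))"
  proof (intro sum_mono)
    fix k
    have "(\<Sum>l<m. cmod (Y $$ (k,l)) * cmod (Z $$ (k,l)))\<^sup>2 \<le>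
        (\<Sum>l<m. (cmod (Y $$ (k,l)))\<^sup>2) * (\<Sum>l<m. (cmod (Z $$ (k,l)))\<^sup>2)"
      by (rule Cauchy_Schwarz_ineq_sum)
    then show "(\<Sum>l<m. cmod (Y $$ (k,l)) * cmod (Z $$ (k,l))) \<le>
        sqrt (\<Sum>l<m. (cmod (Y $$ (k,l)))\<^sup>2) * sqrt (\<Sum>l<m. (cmod (Z $$ (k,l)))\<^sup>2)"
      by (simp add: real_le_rsqrt flip: real_sqrt_mult)
  qed
  finally show ?thesis using row[OF Y] row[OF Z] by simp
qed

text \<open>The easy half of Uhlmann's theorem.\<close>

lemma fidelity_ge_purifications:
  assumes A: "A \<in> carrier_mat n m" and B: "B \<in> carrier_mat n m"
  shows "Re (mat_trace (adj A * B)) \<le> fidelity (A * adj A) (B * adj B)"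
proof -
  define \<rho> where "\<rho> = A * adj A"
  define \<tau> where "\<tau> = B * adj B"
  have \<rho>': "psd \<rho>" "\<rho> \<in> carrier_mat n n" and \<tau>': "psd \<tau>" "\<tau> \<in> carrier_mat n n"
    using psd_gram[OF A] psd_gram[OF B] A B by (auto simp: \<rho>_def \<tau>_def)
  define t where "t = mat_sqrt \<tau>"
  note t = mat_sqrt_psd[OF \<tau>', folded t_def]
  obtain G e where DG: "diagonalizes n \<tau> G e" and e: "\<And>i. i < n \<Longrightarrow> 0 \<le> e i"
    using psd_diagonalizable[OF \<tau>'] by blast
  note G = diagonalizesD[OF DG]
  have tG: "t = G * rdiag n (\<lambda>i. sqrt (e i)) * adj G"
    unfolding t_def mat_sqrt_def by (rule herm_fun_diagonalizes[OF DG])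
  \<comment> \<open>\<open>T\<close> is the pseudo-inverse of \<open>t\<close> and \<open>P\<close>
    the projection onto the support of \<open>\<tau>\<close>; the zero eigenvalues are sent to zero
    in both.\<close>
  define p where "p i = (if e i = 0 then 0 else 1 / sqrt (e i))" for i
  define f where "f i = (if e i = 0 then 0 else 1 :: real)" for i
  define T where "T = G * rdiag n p * adj G"
  define P where "P = G * rdiag n f * adj G"
  have T: "T \<in> carrier_mat n n" and P: "P \<in> carrier_mat n n" using G(1) by (auto simp: T_def P_def)
  note d = carrier_matD[OF A] carrier_matD[OF B] carrier_matD[OF t(1)] carrier_matD[OF T] carrier_matD[OF P]
    carrier_matD[OF G(1)] carrier_matD[OF \<rho>'(2)] carrier_matD[OF \<tau>'(2)]
  note conj = conj_diag_mult[OF G(1,2)]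
  have tT: "t * T = P" unfolding tG T_def P_def by (rule conj) (use e in \<open>auto simp: p_def f_def\<close>)
  have Tt: "T * t = P" unfolding tG T_def P_def by (rule conj) (use e in \<open>auto simp: p_def f_def\<close>)
  have PP: "P * P = P" unfolding P_def by (rule conj) (auto simp: f_def)
  have P\<tau>: "P * \<tau> = \<tau>" unfolding P_def by (subst (1 2) G(4), rule conj) (auto simp: f_def)
  have adjP: "adj P = P" and adjT: "adj T = T"
    unfolding P_def T_def using d by (simp_all add: adj_mult_dim mult_assoc_dim)
  \<comment> \<open>The columns of \<open>B\<close> lie in the support of \<open>B * adj B\<close>,
    because the component \<open>Q * B\<close> outside has squared norm
    \<open>Tr (Q \<tau> Q) = 0\<close>.\<close>
  have PB: "P * B = B"
  proof -
    define Q where "Q = 1\<^sub>m n - P"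
    have Q: "Q \<in> carrier_mat n n" using P by (auto simp: Q_def intro!: carrier_matI)
    have "Q * \<tau> = 1\<^sub>m n * \<tau> - P * \<tau>" unfolding Q_def
      by (rule minus_mult_distrib_mat[OF one_carrier_mat P \<tau>'(2)])
    then have "Q * \<tau> = 0\<^sub>m n n" using P\<tau> \<tau>'(2) by simp
    moreover have "(Q * B) * adj (Q * B) = Q * \<tau> * adj Q"
      unfolding \<tau>_def using d carrier_matD[OF Q] by (simp add: adj_mult_dim mult_assoc_dim)
    ultimately have "mat_trace ((Q * B) * adj (Q * B)) = 0"
      using Q by (simp add: mat_trace_def)
    then have "frob2 (Q * B) = 0"
      using frob2_trace(2)[OF mult_carrier_mat[OF Q B]] by simp
    then have "Q * B = 0\<^sub>m n m" using frob2_eq_0D[OF _ mult_carrier_mat[OF Q B]] by simp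
    moreover have "Q * B = 1\<^sub>m n * B - P * B" unfolding Q_def
      by (rule minus_mult_distrib_mat[OF one_carrier_mat P B])
    ultimately have "B - P * B = 0\<^sub>m n m" using B by simp
    show ?thesis
    proof (rule eq_matI)
      fix i j assume ij: "i < dim_row B" "j < dim_col B"
      have "(B - P * B) $$ (i,j) = 0" using \<open>B - P * B = 0\<^sub>m n m\<close> ij d by simp
      then show "(P * B) $$ (i,j) = B $$ (i,j)" using ij d by simp
    qed (use d in auto)
  qed
  \<comment> \<open>Polar decomposition \<open>B = t * W\<close>, where \<open>W * adj W\<close> is
    the projection \<open>P\<close>.\<close>
  define W where "W = T * B"
  have W: "W \<in> carrier_mat n m" using T B by (simp add: W_def)
  have tW: "t * W = B" unfolding W_def using d tT PB by (simp flip: mult_assoc_dim)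
  have WW: "W * adj W = P"
  proof -
    have "W * adj W = T * \<tau> * T"
      unfolding W_def \<tau>_def using d adjT by (simp add: adj_mult_dim mult_assoc_dim)
    also have "\<dots> = (T * t) * (t * T)" using t(3)[symmetric] d by (simp add: mult_assoc_dim)
    finally show ?thesis using tT Tt PP by simp
  qed
  obtain X s where D: "diagonalizes n (t * \<rho> * t) X s" and s: "\<And>k. k < n \<Longrightarrow> 0 \<le> s k"
    and F: "fidelity \<rho> \<tau> = (\<Sum>k<n. sqrt (s k))"
    using fidelity_diag[OF \<rho>' \<tau>'] unfolding t_def by blast
  note X = diagonalizesD[OF D]
  note d = d carrier_matD[OF X(1)] carrier_matD[OF W]
  \<comment> \<open>In the eigenbasis \<open>X\<close> the rows of \<open>Y\<close> have squared
    norms \<open>s k\<close> and those of \<open>Z\<close> at most 1, so the rowwise inequality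
    gives \<open>sum (sqrt (s k))\<close>, which is the fidelity.\<close>
  define Y where "Y = adj X * (t * A)"
  define Z where "Z = adj X * W"
  have Y: "Y \<in> carrier_mat n m" and Z: "Z \<in> carrier_mat n m"
    unfolding Y_def Z_def using d by (auto intro!: carrier_matI)
  have YY: "(Y * adj Y) $$ (k,k) = complex_of_real (s k)" if "k < n" for k
  proof -
    have "Y * adj Y = adj X * (t * \<rho> * t) * X"
      unfolding Y_def \<rho>_def using d t(2) by (simp add: adj_mult_dim mult_assoc_dim)
    then show ?thesis using diagonalizes_conj[OF D] that by simp
  qed
  have ZZ: "Re ((Z * adj Z) $$ (k,k)) \<le> 1" if k: "k < n" for k
  proof -
    define U where "U = adj X * G"
    have U: "U \<in> carrier_mat n n" unfolding U_def using d by (auto intro!: carrier_matI)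
    have "Z * adj Z = adj X * (W * adj W) * X"
      unfolding Z_def using d by (simp add: adj_mult_dim mult_assoc_dim)
    also have "\<dots> = U * rdiag n f * adj U"
      unfolding WW P_def U_def using d by (simp add: adj_mult_dim mult_assoc_dim)
    finally have "(Z * adj Z) $$ (k,k) = (\<Sum>l<n. U $$ (k,l) * complex_of_real (f l) * cnj (U $$ (k,l)))"
      using conj_diag_index[OF U k k] by simp
    also have "\<dots> = complex_of_real (\<Sum>l<n. f l * overlap X G k l)"
      by (auto simp: overlap_def U_def[symmetric] complex_norm_square simp del: of_real_power intro!: sum.cong)
    finally have "Re ((Z * adj Z) $$ (k,k)) = (\<Sum>l<n. f l * overlap X G k l)" by simp
    also have "\<dots> \<le> (\<Sum>l<n. 1 * overlap X G k l)"
      by (intro sum_mono mult_right_mono) (auto simp: f_def)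
    finally show ?thesis using overlap_row_sum[OF X(1,2) G(1,2) k] by simp
  qed
  have "adj A * B = adj Y * Z"
    unfolding Y_def Z_def using d t(2) tW
    by (simp add: adj_mult_dim mult_assoc_dim unitary_cancel[OF X(1,2)])
  then have "Re (mat_trace (adj A * B)) \<le>
    (\<Sum>k<n. sqrt (Re ((Y * adj Y) $$ (k,k))) * sqrt (Re ((Z * adj Z) $$ (k,k))))"
    using trace_adj_mult_rows[OF Y Z] by simp
  also have "\<dots> \<le> (\<Sum>k<n. sqrt (s k) * 1)"
  proof (rule sum_mono)
    fix k assume "k \<in> {..<n}"
    then show "sqrt (Re ((Y * adj Y) $$ (k,k))) * sqrt (Re ((Z * adj Z) $$ (k,k))) \<le> sqrt (s k) * 1"
      using YY[of k] s[of k] ZZ[of k] mult_left_mono[of "sqrt (Re ((Z * adj Z) $$ (k,k)))" 1 "sqrt (s k)"] by simp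
  qed
  finally show ?thesis using F by (simp add: \<rho>_def \<tau>_def)
qed

section \<open>Comparing one resolvent with a power\<close>

text \<open>The optimal constant in \<open>x\<^bsup>1-s\<^esup> y\<^bsup>s\<^esup> \<le> \<kappa> (x + y)\<close>. Using it at a single well-chosen resolvent
  parameter replaces the integral representation of operator powers.\<close>

definition young_const :: "real \<Rightarrow> real" where
  "young_const s = s powr s * (1 - s) powr (1 - s)"

lemma young_const_pos: "0 < s \<Longrightarrow> s < 1 \<Longrightarrow> 0 < young_const s"
  by (simp add: young_const_def)

lemma powr_mult_le_young:
  fixes x y s :: real
  assumes s: "0 < s" "s < 1" and "0 \<le> x" "0 \<le> y"
  shows "x powr (1 - s) * y powr s \<le> young_const s * (x + y)"
proof (cases "x = 0 \<or> y = 0")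
  case True
  then show ?thesis using assms young_const_pos[OF s] by auto
next
  case False
  then have xy: "0 < x" "0 < y" using assms by auto
  define m where "m = x + y"
  have m: "0 < m" using xy by (simp add: m_def)
  \<comment> \<open>The two arguments of \<open>ln\<close> both equal 1 exactly when
    \<open>x : y = (1 - s) : s\<close>, the equality case, so the linear bound on \<open>ln\<close>
    is sharp there.\<close>
  have l1: "ln (x / (m * (1 - s))) \<le> x / (m * (1 - s)) - 1"
    and l2: "ln (y / (m * s)) \<le> y / (m * s) - 1"
    using xy m s by (auto intro!: ln_le_minus_one)
  have "(1 - s) * ln (x / (m * (1 - s))) + s * ln (y / (m * s)) \<le>
      (1 - s) * (x / (m * (1 - s)) - 1) + s * (y / (m * s) - 1)"
    using l1 l2 s by (intro add_mono mult_left_mono) auto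
  also have "\<dots> = (x + y) / m - 1"
    using s m by (simp add: field_simps)
  also have "\<dots> = 0" using m by (simp add: m_def)
  finally have le: "(1 - s) * (ln x - (ln m + ln (1 - s))) + s * (ln y - (ln m + ln s)) \<le> 0"
    using xy m s by (simp add: ln_div ln_mult)
  have "x powr (1 - s) * y powr s = exp ((1 - s) * ln x + s * ln y)"
    using xy by (simp add: powr_def exp_add)
  also have "\<dots> \<le> exp (s * ln s + (1 - s) * ln (1 - s) + ln m)"
    using le by (simp add: algebra_simps)
  also have "\<dots> = young_const s * m"
    using s m by (simp add: young_const_def powr_def exp_add)
  finally show ?thesis by (simp add: m_def)
qed

lemma young_const_sym: "young_const (1 - s) = young_const s"
  by (simp add: young_const_def)

text \<open>The equality case \<open>x = 1\<close>, \<open>y = s / (1 - s)\<close> of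
  \<open>powr_mult_le_young\<close>. It later makes \<open>young_const s\<close> cancel exactly
  against the other constants.\<close>

lemma young_const_attained:
  assumes s: "0 < s" "s < 1"
  shows "young_const s * (1 + s / (1 - s)) = (s / (1 - s)) powr s"
proof -
  have "1 + s / (1 - s) = (1 - s) powr (-1)"
    using s by (simp add: powr_minus field_simps)
  moreover have "(s / (1 - s)) powr s = s powr s * (1 - s) powr (- s)"
    using s by (simp add: powr_divide powr_minus field_simps)
  moreover have "(1 - s) powr (1 - s) * (1 - s) powr (-1) = (1 - s) powr (- s)"
    by (subst powr_add[symmetric]) simp
  ultimately show ?thesis by (simp only: young_const_def mult.assoc)
qed

text \<open>Split \<open>a * (t * b)\<close> into the product with exponents \<open>s\<close>,
  \<open>1 - s\<close> and the one with \<open>1 - s\<close>, \<open>s\<close>. The inequality for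
  \<open>young_const\<close> absorbs the first factor into the denominator.\<close>

lemma parallel_sum_le_powr:
  fixes a b s t :: real
  assumes s: "0 < s" "s < 1" and "0 \<le> a" "0 \<le> b" "0 < t"
  shows "a * (t * b) / (a + t * b) \<le> young_const s * t powr s * (a powr (1 - s) * b powr s)"
proof (cases "a = 0 \<or> b = 0")
  case True
  then show ?thesis by auto
next
  case False
  then have ab: "0 < a" "0 < b" using assms by auto
  have y: "a powr s * (t * b) powr (1 - s) \<le> young_const s * (a + t * b)"
    using powr_mult_le_young[of "1 - s" a "t * b"] s ab assms(5) by (simp add: young_const_sym)
  have "a * (t * b) = (a powr s * (t * b) powr (1 - s)) * (a powr (1 - s) * (t * b) powr s)"
    using ab assms(5) by (simp add: algebra_simps flip: powr_add powr_mult)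
  also have "\<dots> \<le> (young_const s * (a + t * b)) * (a powr (1 - s) * (t * b) powr s)"
    using y by (intro mult_right_mono) auto
  finally have "a * (t * b) / (a + t * b) \<le> young_const s * (a powr (1 - s) * (t * b) powr s)"
    using ab assms(5) by (simp add: divide_le_eq add_pos_pos algebra_simps)
  then show ?thesis using ab assms(5) by (simp add: powr_mult algebra_simps)
qed

text \<open>Again one factor of the numerator is absorbed into the denominator; the other factor
  then carries the exponents \<open>1 + s\<close> and \<open>- s\<close> of a divergence of order
  above one.\<close>

lemma square_over_sum_le_powr:
  fixes a b s t :: real
  assumes s: "0 < s" "s < 1" and a: "0 \<le> a" and b: "0 < b" and t: "0 < t"
  shows "a\<^sup>2 / (a + t * b) \<le> young_const s * t powr (- s) * (a powr (1 + s) * b powr (- s))"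
proof (cases "a = 0")
  case True
  then show ?thesis by simp
next
  case False
  then have a: "0 < a" using a by simp
  have y: "a powr (1 - s) * (t * b) powr s \<le> young_const s * (a + t * b)"
    using powr_mult_le_young[OF s] a b t by simp
  have "a\<^sup>2 = (a powr (1 - s) * (t * b) powr s) * (a powr (1 + s) * (t * b) powr (- s))"
  proof -
    have "(t * b) powr s * (t * b) powr (- s) = 1" using b t by (simp flip: powr_add)
    moreover have "a powr (1 - s) * a powr (1 + s) = a\<^sup>2" using a by (simp flip: powr_add add: powr_numeral)
    ultimately show ?thesis by (metis mult.assoc mult.commute mult.right_neutral)
  qed
  also have "\<dots> \<le> (young_const s * (a + t * b)) * (a powr (1 + s) * (t * b) powr (- s))"
    using y by (intro mult_right_mono) auto
  finally have "a\<^sup>2 / (a + t * b) \<le> young_const s * (a powr (1 + s) * (t * b) powr (- s))"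
    using a b t by (simp add: divide_le_eq add_pos_pos algebra_simps)
  then show ?thesis using b t by (simp add: powr_mult algebra_simps)
qed

text \<open>Together with \<open>trace_quad_two_bases'\<close>, this writes a form with
  \<open>A\<close> inside \<open>adj X\<close> and \<open>X\<close>, and one with \<open>B\<close>
  inside \<open>X\<close> and \<open>adj X\<close>, over the same entries of
  \<open>adj U * X * V\<close>. A minimisation of their sum over \<open>X\<close> thus decouples
  into scalar problems.\<close>

lemma trace_quad_two_bases:
  assumes D: "diagonalizes n A U e" and V: "V \<in> carrier_mat n n" "adj V * V = 1\<^sub>m n"
    and X: "X \<in> carrier_mat n n"
  shows "mat_trace (adj X * A * X) =
    complex_of_real (\<Sum>i<n. \<Sum>j<n. e i * (cmod ((adj U * X * V) $$ (i,j)))\<^sup>2)"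
proof -
  note U = diagonalizesD[OF D]
  note d = carrier_matD[OF U(1)] carrier_matD[OF V(1)] carrier_matD[OF X] carrier_matD[OF U(5)]
  have "mat_trace (adj (X * V) * A * (X * V)) = mat_trace (adj V * (adj X * A * X * V))"
    using d by (simp add: adj_mult_dim mult_assoc_dim)
  also have "\<dots> = mat_trace (adj X * A * X * V * adj V)"
    using d by (intro trace_comm[of _ n n] carrier_matI) simp_all
  also have "adj X * A * X * V * adj V = adj X * A * X"
    using d unitary_right[OF V] by (simp add: mult_assoc_dim)
  finally have "mat_trace (adj X * A * X) = mat_trace (adj (X * V) * A * (X * V))" by simp
  also have "\<dots> = complex_of_real (\<Sum>i<n. \<Sum>j<n. e i * (cmod ((adj U * (X * V)) $$ (i,j)))\<^sup>2)"
    by (rule trace_quad_diagonalizes[OF D mult_carrier_mat[OF X V(1)]])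
  also have "adj U * (X * V) = adj U * X * V"
    using d by (simp add: mult_assoc_dim)
  finally show ?thesis .
qed

lemma trace_quad_two_bases':
  assumes D: "diagonalizes n B V g" and U: "U \<in> carrier_mat n n" "adj U * U = 1\<^sub>m n"
    and X: "X \<in> carrier_mat n n"
  shows "mat_trace (X * B * adj X) =
    complex_of_real (\<Sum>i<n. \<Sum>j<n. g j * (cmod ((adj U * X * V) $$ (i,j)))\<^sup>2)"
proof -
  note V = diagonalizesD[OF D]
  note d = carrier_matD[OF U(1)] carrier_matD[OF V(1)] carrier_matD[OF X]
  have "adj V * adj X * U = adj (adj U * X * V)"
    using d by (simp add: adj_mult_dim mult_assoc_dim)
  then have "cmod ((adj V * adj X * U) $$ (j,i)) = cmod ((adj U * X * V) $$ (i,j))"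
    if "i < n" "j < n" for i j
    using that d by simp
  then show ?thesis
    using trace_quad_two_bases[OF D U adj_carrier[OF X]]
    by (subst sum.swap) simp
qed

lemma Re_trace_quad_diff:
  fixes A B X :: "complex mat"
  assumes A: "A \<in> carrier_mat n n" and B: "B \<in> carrier_mat n n" and X: "X \<in> carrier_mat n m"
  shows "Re (mat_trace (adj X * (complex_of_real c \<cdot>\<^sub>m A - B) * X)) =
    c * Re (mat_trace (adj X * A * X)) - Re (mat_trace (adj X * B * X))"
proof -
  note d = carrier_matD[OF A] carrier_matD[OF B] carrier_matD[OF X]
  have "adj X * (complex_of_real c \<cdot>\<^sub>m A - B) = adj X * (complex_of_real c \<cdot>\<^sub>m A) - adj X * B"
    using d by (intro mult_minus_distrib_mat[of _ m n _ n] carrier_matI) simp_all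
  also have "adj X * (complex_of_real c \<cdot>\<^sub>m A) = complex_of_real c \<cdot>\<^sub>m (adj X * A)"
    by (rule mult_smult_distrib[OF adj_carrier[OF X] A])
  also have "(complex_of_real c \<cdot>\<^sub>m (adj X * A) - adj X * B) * X =
      complex_of_real c \<cdot>\<^sub>m (adj X * A) * X - adj X * B * X"
    using d by (intro minus_mult_distrib_mat[of _ m n _ _ m] carrier_matI) simp_all
  also have "complex_of_real c \<cdot>\<^sub>m (adj X * A) * X = complex_of_real c \<cdot>\<^sub>m (adj X * A * X)"
    using d by (intro mult_smult_assoc_mat[of _ m n _ m] carrier_matI) simp_all
  also have "mat_trace (complex_of_real c \<cdot>\<^sub>m (adj X * A * X) - adj X * B * X) =
      mat_trace (complex_of_real c \<cdot>\<^sub>m (adj X * A * X)) - mat_trace (adj X * B * X)"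
    using d by (intro trace_minus[of _ m] carrier_matI) simp_all
  also have "mat_trace (complex_of_real c \<cdot>\<^sub>m (adj X * A * X)) = complex_of_real c * mat_trace (adj X * A * X)"
    using d by (intro trace_smult[of _ m] carrier_matI) simp_all
  finally show ?thesis by simp
qed

lemma sqrt_add_sqrt_square_le:
  fixes a b z :: real
  assumes "0 \<le> a" "0 \<le> b" "0 < z"
  shows "(sqrt a + sqrt b)\<^sup>2 \<le> (1 + 1 / z) * (a + z * b)"
proof -
  have "2 * sqrt a * sqrt b \<le> a / z + z * b"
  proof -
    have "0 \<le> (sqrt (a / z) - sqrt (z * b))\<^sup>2" by simp
    also have "\<dots> = a / z + z * b - 2 * (sqrt (a / z) * sqrt (z * b))"
      using assms by (simp add: power2_diff)
    also have "sqrt (a / z) * sqrt (z * b) = sqrt a * sqrt b"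
      using assms by (simp add: real_sqrt_divide real_sqrt_mult)
    finally show ?thesis by simp
  qed
  then show ?thesis using assms by (simp add: power2_sum algebra_simps)
qed

text \<open>Apply \<open>fidelity_split\<close> to a matrix \<open>X\<close> that depends on
  \<open>\<rho>\<close> and \<open>\<sigma>\<close> but not on \<open>\<tau>\<close>. The form in
  \<open>\<tau>\<close> is then at most \<open>l\<close> times the form in \<open>\<sigma>\<close>,
  and the sum of the two forms in \<open>\<rho>\<close> and \<open>\<sigma>\<close> is a weighted
  sum of scalar parallel sums.\<close>

lemma fidelity_le_powr_overlap:
  assumes \<rho>: "\<rho> \<in> density_ops n" and \<tau>: "\<tau> \<in> density_ops n"
    and D\<rho>: "diagonalizes n \<rho> U e" and D\<sigma>: "diagonalizes n \<sigma> V g"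
    and e: "\<And>i. i < n \<Longrightarrow> 0 \<le> e i" and g: "\<And>i. i < n \<Longrightarrow> 0 \<le> g i"
    and le: "loewner_le \<tau> (complex_of_real l \<cdot>\<^sub>m \<sigma>)" and l: "0 < l" and s: "0 < s" "s < 1"
  shows "(fidelity \<rho> \<tau>)\<^sup>2 \<le> l powr s * (\<Sum>i<n. \<Sum>j<n. overlap U V i j * (e i powr (1 - s) * g j powr s))"
proof -
  note U = diagonalizesD[OF D\<rho>] and V = diagonalizesD[OF D\<sigma>]
  \<comment> \<open>With this weight the factor \<open>1 + 1 / z\<close> from
    \<open>sqrt_add_sqrt_square_le\<close>, the factor \<open>z powr s\<close> and
    \<open>young_const s\<close> multiply to 1.\<close>
  define z where "z = (1 - s) / s"
  have z: "0 < z" using s by (simp add: z_def)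
  define t where "t = l * z"
  have t: "0 < t" using l z by (simp add: t_def)
  define u where "u = adj U * V"
  have u: "u \<in> carrier_mat n n" using U(1) V(1) by (auto simp: u_def intro!: carrier_matI)
  \<comment> \<open>Each entry minimises \<open>e i * |x|^2 + t * g j * |u - x|^2\<close>; the
    minimum is \<open>|u|^2\<close> times the parallel sum of \<open>e i\<close> and
    \<open>t * g j\<close>.\<close>
  define x where "x = Matrix.mat n n (\<lambda>(i,j). u $$ (i,j) * complex_of_real (t * g j / (e i + t * g j)))"
  have x: "x \<in> carrier_mat n n" by (simp add: x_def)
  define X where "X = U * x * adj V"
  define Q where "Q = 1\<^sub>m n - X"
  have X: "X \<in> carrier_mat n n" unfolding X_def using U(1) V(1) x by (auto intro!: carrier_matI)
  have Q: "Q \<in> carrier_mat n n" unfolding Q_def using X by (auto intro!: carrier_matI)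
  have \<tau>c: "\<tau> \<in> carrier_mat n n" using \<tau> by (simp add: density_ops_def)
  note d = carrier_matD[OF U(1)] carrier_matD[OF V(1)] carrier_matD[OF u] carrier_matD[OF x]
    carrier_matD[OF X] carrier_matD[OF Q] carrier_matD[OF U(5)] carrier_matD[OF V(5)] carrier_matD[OF \<tau>c]
  have UXV: "adj U * X * V = x"
    unfolding X_def using d V(2) by (simp add: mult_assoc_dim unitary_cancel[OF U(1,2)])
  have UQV: "adj U * Q * V = u - x"
  proof -
    have "adj U * Q = adj U * 1\<^sub>m n - adj U * X"
      unfolding Q_def by (rule mult_minus_distrib_mat[OF adj_carrier[OF U(1)] one_carrier_mat X])
    then have "adj U * Q * V = (adj U - adj U * X) * V" using d by simp
    also have "\<dots> = adj U * V - adj U * X * V"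
      using d by (intro minus_mult_distrib_mat[of _ n n _ _ n] carrier_matI) simp_all
    finally show ?thesis unfolding UXV u_def .
  qed
  define g1 where "g1 = Re (mat_trace (adj X * \<rho> * X))"
  define g2 where "g2 = Re (mat_trace (Q * \<tau> * adj Q))"
  define h2 where "h2 = Re (mat_trace (Q * \<sigma> * adj Q))"
  have g1: "g1 = (\<Sum>i<n. \<Sum>j<n. e i * (cmod (x $$ (i,j)))\<^sup>2)"
    unfolding g1_def trace_quad_two_bases[OF D\<rho> V(1,2) X] UXV by simp
  have h2: "h2 = (\<Sum>i<n. \<Sum>j<n. g j * (cmod ((u - x) $$ (i,j)))\<^sup>2)"
    unfolding h2_def trace_quad_two_bases'[OF D\<sigma> U(1,2) Q] UQV by simp
  have "g1 + t * h2 = (\<Sum>i<n. \<Sum>j<n. overlap U V i j * (e i * (t * g j) / (e i + t * g j)))"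
    unfolding g1 h2 sum_distrib_left sum.distrib[symmetric]
  proof (intro sum.cong refl)
    fix i j assume "i \<in> {..<n}" "j \<in> {..<n}"
    then have ij: "i < n" "j < n" by auto
    define a where "a = e i"
    define b where "b = t * g j"
    have ab: "0 \<le> a" "0 \<le> b" using e[OF ij(1)] g[OF ij(2)] t by (auto simp: a_def b_def)
    define w where "w = (cmod (u $$ (i,j)))\<^sup>2"
    have xi: "x $$ (i,j) = u $$ (i,j) * complex_of_real (b / (a + b))"
      using ij by (simp add: x_def a_def b_def)
    have c1: "(cmod (x $$ (i,j)))\<^sup>2 = w * (b / (a + b))\<^sup>2"
      unfolding xi w_def norm_mult norm_of_real power_mult_distrib power2_abs ..
    have "(u - x) $$ (i,j) = u $$ (i,j) - x $$ (i,j)" using ij d by simp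
    also have "\<dots> = u $$ (i,j) * complex_of_real (1 - b / (a + b))"
      unfolding xi of_real_diff by (simp add: algebra_simps)
    finally have c2: "(cmod ((u - x) $$ (i,j)))\<^sup>2 = w * (1 - b / (a + b))\<^sup>2"
      unfolding w_def by (simp only: norm_mult norm_of_real power_mult_distrib power2_abs)
    have "a * (b / (a + b))\<^sup>2 + b * (1 - b / (a + b))\<^sup>2 = a * b / (a + b)"
    proof (cases "a + b = 0")
      case True
      then have "a = 0" "b = 0" using ab by auto
      then show ?thesis by simp
    next
      case False
      then have "1 - b / (a + b) = a / (a + b)" by (simp add: field_simps)
      then have "a * (b / (a + b))\<^sup>2 + b * (1 - b / (a + b))\<^sup>2 = (a * b\<^sup>2 + b * a\<^sup>2) / (a + b)\<^sup>2"
        by (simp only: power_divide add_divide_distrib times_divide_eq_right)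
      also have "a * b\<^sup>2 + b * a\<^sup>2 = a * b * (a + b)"
        by (simp add: power2_eq_square algebra_simps)
      also have "a * b * (a + b) / (a + b)\<^sup>2 = a * b / (a + b)"
        using False by (simp add: power2_eq_square)
      finally show ?thesis .
    qed
    then have "w * (a * (b / (a + b))\<^sup>2 + b * (1 - b / (a + b))\<^sup>2) = w * (a * b / (a + b))" by simp
    then show "e i * (cmod (x $$ (i,j)))\<^sup>2 + t * (g j * (cmod ((u - x) $$ (i,j)))\<^sup>2) =
        overlap U V i j * (e i * (t * g j) / (e i + t * g j))"
      unfolding c1 c2 overlap_def u_def[symmetric] w_def[symmetric] a_def[symmetric] b_def[symmetric]
      by (simp add: algebra_simps b_def)
  qed
  also have "\<dots> \<le> (\<Sum>i<n. \<Sum>j<n. overlap U V i j * (young_const s * t powr s * (e i powr (1 - s) * g j powr s)))"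
    using e g t s by (intro sum_mono mult_left_mono parallel_sum_le_powr) auto
  also have "\<dots> = young_const s * t powr s * (\<Sum>i<n. \<Sum>j<n. overlap U V i j * (e i powr (1 - s) * g j powr s))"
    by (simp add: sum_distrib_left algebra_simps)
  finally have main: "g1 + t * h2 \<le> young_const s * t powr s *
      (\<Sum>i<n. \<Sum>j<n. overlap U V i j * (e i powr (1 - s) * g j powr s))" (is "_ \<le> _ * ?S") .
  have nn: "0 \<le> g1" "0 \<le> g2"
    using psd_trace_quad[OF _ U(5) X] psd_trace_quad[OF _ \<tau>c adj_carrier[OF Q]] \<rho> \<tau>
    by (auto simp: g1_def g2_def density_ops_def)
  \<comment> \<open>The operator inequality is used only in this quadratic form, so no operator
    monotone function is involved.\<close>
  have "g2 \<le> l * h2"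
  proof -
    let ?M = "complex_of_real l \<cdot>\<^sub>m \<sigma> - \<tau>"
    have M: "psd ?M" using le by (simp add: loewner_le_def)
    have Mc: "?M \<in> carrier_mat n n" using d by (intro carrier_matI) auto
    have "0 \<le> Re (mat_trace (Q * ?M * adj Q))"
      using psd_trace_quad[OF M Mc adj_carrier[OF Q]] by simp
    then show ?thesis
      using Re_trace_quad_diff[OF V(5) \<tau>c adj_carrier[OF Q], of l] by (simp add: g2_def h2_def)
  qed
  then have "z * g2 \<le> t * h2"
    using z mult_left_mono[of g2 "l * h2" z] by (simp add: t_def algebra_simps)
  have F0: "0 \<le> fidelity \<rho> \<tau>"
    using \<rho> \<tau> by (intro fidelity_nonneg[of _ n]) (auto simp: density_ops_def)
  have "fidelity \<rho> \<tau> \<le> sqrt g1 + sqrt g2"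
    using fidelity_split[OF \<rho> \<tau> X] by (simp add: g1_def g2_def Q_def)
  then have "(fidelity \<rho> \<tau>)\<^sup>2 \<le> (sqrt g1 + sqrt g2)\<^sup>2" using F0 by (rule power_mono)
  also have "\<dots> \<le> (1 + 1 / z) * (g1 + z * g2)" by (rule sqrt_add_sqrt_square_le[OF nn z])
  also have "\<dots> \<le> (1 + 1 / z) * (young_const s * t powr s * ?S)"
    using main \<open>z * g2 \<le> t * h2\<close> z by (intro mult_left_mono) auto
  also have "\<dots> = ((1 + 1 / z) * young_const s * z powr s) * (l powr s * ?S)"
    unfolding t_def using l z by (simp add: powr_mult algebra_simps)
  also have "(1 + 1 / z) * young_const s * z powr s = 1"
  proof -
    have "1 / z = s / (1 - s)" using s by (simp add: z_def)
    then have "(1 + 1 / z) * young_const s = (1 / z) powr s"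
      using young_const_attained[OF s] by (simp add: mult.commute)
    then show ?thesis using z by (simp add: powr_divide)
  qed
  finally show ?thesis by simp
qed

text \<open>Data processing for the two-outcome measurement \<open>{N, 1 - N}\<close>, in the only case needed.\<close>

lemma projection_prob_le_powr_overlap:
  assumes D\<rho>: "diagonalizes n \<rho> U e" and D\<sigma>: "diagonalizes n \<sigma> V g"
    and e: "\<And>i. i < n \<Longrightarrow> 0 \<le> e i" and g: "\<And>i. i < n \<Longrightarrow> 0 \<le> g i"
    and ac: "\<And>i j. i < n \<Longrightarrow> j < n \<Longrightarrow> g j = 0 \<Longrightarrow> overlap U V i j * e i = 0"
    and N: "N \<in> carrier_mat n n" "adj N = N" "N * N = N"
    and le: "l * Re (mat_trace (N * \<sigma>)) \<le> Re (mat_trace (N * \<rho>))" and l: "0 < l" and s: "0 < s" "s < 1"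
  shows "Re (mat_trace (N * \<rho>)) \<le> l powr (- s) * (\<Sum>i<n. \<Sum>j<n. overlap U V i j * (e i powr (1 + s) * g j powr (- s)))"
proof -
  note U = diagonalizesD[OF D\<rho>] and V = diagonalizesD[OF D\<sigma>]
  define a where "a = Re (mat_trace (N * \<rho>))"
  define b where "b = Re (mat_trace (N * \<sigma>))"
  define z where "z = s / (1 - s)"
  have z: "0 < z" using s by (simp add: z_def)
  define t where "t = l * z"
  have t: "0 < t" using l z by (simp add: t_def)
  \<comment> \<open>Maximiser of \<open>2 * x * a - x^2 * (1 + z) * a\<close>, whose maximal value
    is \<open>a * x\<close>.\<close>
  define x where "x = 1 / (1 + z)"
  define u where "u = adj U * V"
  define y where "y = adj U * N * V"
  have u: "u \<in> carrier_mat n n" and y: "y \<in> carrier_mat n n"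
    using U(1) V(1) N(1) by (auto simp: u_def y_def intro!: carrier_matI)
  note d = carrier_matD[OF U(1)] carrier_matD[OF V(1)] carrier_matD[OF u] carrier_matD[OF y]
    carrier_matD[OF N(1)] carrier_matD[OF U(5)] carrier_matD[OF V(5)]
  have a1: "a = (\<Sum>i<n. \<Sum>j<n. e i * (cmod (y $$ (i,j)))\<^sup>2)"
  proof -
    have "mat_trace (adj N * \<rho> * N) = mat_trace (N * (\<rho> * N))"
      using d N(2) by (simp add: mult_assoc_dim)
    also have "\<dots> = mat_trace (\<rho> * N * N)"
      using d by (intro trace_comm[of _ n n] carrier_matI) simp_all
    also have "\<rho> * N * N = \<rho> * N" using d N(3) by (simp add: mult_assoc_dim)
    also have "mat_trace (\<rho> * N) = mat_trace (N * \<rho>)"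
      using d by (intro trace_comm[of _ n n] carrier_matI) simp_all
    finally have "a = Re (mat_trace (adj N * \<rho> * N))" by (simp add: a_def)
    then show ?thesis
      unfolding trace_quad_two_bases[OF D\<rho> V(1,2) N(1)] y_def[symmetric] Re_complex_of_real .
  qed
  have b1: "b = (\<Sum>i<n. \<Sum>j<n. g j * (cmod (y $$ (i,j)))\<^sup>2)"
  proof -
    have "mat_trace (N * \<sigma> * adj N) = mat_trace (N * (N * \<sigma>))"
      unfolding N(2) by (rule trace_comm[OF mult_carrier_mat[OF N(1) V(5)] N(1)])
    also have "N * (N * \<sigma>) = N * N * \<sigma>"
      using d by (simp only: mult_assoc_dim)
    finally have "b = Re (mat_trace (N * \<sigma> * adj N))" by (simp only: b_def N(3))
    then show ?thesis
      unfolding trace_quad_two_bases'[OF D\<sigma> U(1,2) N(1)] y_def[symmetric] Re_complex_of_real .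
  qed
  \<comment> \<open>The same \<open>a\<close> is quadratic in \<open>y\<close> by \<open>a1\<close>
    and linear in \<open>y\<close> by \<open>a2\<close>, since \<open>N\<close> is a projection.
    Combining both forms and completing the square in every entry eliminates \<open>y\<close> and
    leaves the overlaps.\<close>
  have a2: "a = (\<Sum>i<n. \<Sum>j<n. e i * Re (y $$ (i,j) * cnj (u $$ (i,j))))"
  proof -
    let ?E = "rdiag n e"
    have "mat_trace (N * \<rho>) = mat_trace ((N * U) * (?E * adj U))"
      unfolding U(4) using d by (simp add: mult_assoc_dim)
    also have "\<dots> = mat_trace ((?E * adj U) * (N * U))"
      using d by (intro trace_comm[of _ n n] carrier_matI) simp_all
    also have "(?E * adj U) * (N * U) = (?E * y) * adj u"
      unfolding y_def u_def using d by (simp add: mult_assoc_dim adj_mult_dim unitary_cancel[OF V(1,2)])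
    also have "mat_trace \<dots> = (\<Sum>i<n. \<Sum>j<n. complex_of_real (e i) * y $$ (i,j) * cnj (u $$ (i,j)))"
      unfolding mat_diag_mult_left[OF y] using d u by (subst trace_mult_sum[of _ n n]) (auto intro!: sum.cong)
    finally show ?thesis by (simp add: a_def algebra_simps)
  qed
  have "a * x \<le> 2 * x * a - x\<^sup>2 * (a + t * b)"
  proof -
    have "t * b \<le> z * a" using le z mult_left_mono[of "l * b" a z] by (simp add: t_def a_def b_def algebra_simps)
    then have "x\<^sup>2 * (a + t * b) \<le> x\<^sup>2 * ((1 + z) * a)" by (intro mult_left_mono) (auto simp: algebra_simps)
    also have "\<dots> = x * a" using z by (simp add: x_def power2_eq_square)
    finally show ?thesis using mult.commute[of a x] by linarith
  qed
  also have "\<dots> = (\<Sum>i<n. \<Sum>j<n. 2 * x * (e i * Re (y $$ (i,j) * cnj (u $$ (i,j)))) -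
      x\<^sup>2 * (e i + t * g j) * (cmod (y $$ (i,j)))\<^sup>2)"
  proof -
    have "x\<^sup>2 * (a + t * b) = (\<Sum>i<n. \<Sum>j<n. x\<^sup>2 * (e i + t * g j) * (cmod (y $$ (i,j)))\<^sup>2)"
      unfolding a1 b1 by (simp add: sum_distrib_left sum.distrib algebra_simps)
    moreover have "2 * x * a = (\<Sum>i<n. \<Sum>j<n. 2 * x * (e i * Re (y $$ (i,j) * cnj (u $$ (i,j)))))"
      unfolding a2 sum_distrib_left ..
    ultimately show ?thesis by (simp only: sum_subtractf)
  qed
  also have "\<dots> \<le> (\<Sum>i<n. \<Sum>j<n. overlap U V i j * ((e i)\<^sup>2 / (e i + t * g j)))"
  proof (intro sum_mono)
    fix i j assume "i \<in> {..<n}" "j \<in> {..<n}"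
    then have eg: "0 \<le> e i" "0 \<le> t * g j" using e g t by auto
    define c where "c = cmod (y $$ (i,j))"
    define w where "w = cmod (u $$ (i,j))"
    have r: "Re (y $$ (i,j) * cnj (u $$ (i,j))) \<le> c * w"
      unfolding c_def w_def by (metis complex_Re_le_cmod complex_mod_cnj norm_mult)
    have "2 * x * (e i * Re (y $$ (i,j) * cnj (u $$ (i,j)))) \<le> 2 * x * (e i * (c * w))"
      using r eg z by (intro mult_left_mono) (auto simp: x_def)
    also have "\<dots> \<le> x\<^sup>2 * (e i + t * g j) * c\<^sup>2 + w\<^sup>2 * ((e i)\<^sup>2 / (e i + t * g j))"
    proof (cases "e i + t * g j = 0")
      case True
      then have "e i = 0" using eg by linarith
      then show ?thesis using eg by simp
    next
      case False
      define k where "k = e i + t * g j"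
      have k: "0 < k" using False eg by (simp add: k_def)
      have "0 \<le> (x * k * c - w * e i)\<^sup>2 / k" using k by simp
      also have "\<dots> = x\<^sup>2 * k * c\<^sup>2 + w\<^sup>2 * ((e i)\<^sup>2 / k) - 2 * x * (e i * (c * w))"
        using k by (simp add: power2_eq_square field_simps)
      finally show ?thesis by (simp add: k_def)
    qed
    finally show "2 * x * (e i * Re (y $$ (i,j) * cnj (u $$ (i,j)))) - x\<^sup>2 * (e i + t * g j) * (cmod (y $$ (i,j)))\<^sup>2
        \<le> overlap U V i j * ((e i)\<^sup>2 / (e i + t * g j))"
      by (simp add: overlap_def u_def w_def c_def algebra_simps)
  qed
  also have "\<dots> \<le> (\<Sum>i<n. \<Sum>j<n. overlap U V i j * (young_const s * t powr (- s) * (e i powr (1 + s) * g j powr (- s))))"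
  proof (intro sum_mono)
    fix i j assume "i \<in> {..<n}" "j \<in> {..<n}"
    then have ij: "i < n" "j < n" by auto
    show "overlap U V i j * ((e i)\<^sup>2 / (e i + t * g j)) \<le>
        overlap U V i j * (young_const s * t powr (- s) * (e i powr (1 + s) * g j powr (- s)))"
    \<comment> \<open>At \<open>g j = 0\<close> the convention \<open>0 powr (- s) = 0\<close> makes
      the right side vanish; the left side vanishes too, by \<open>ac\<close>.\<close>
    proof (cases "g j = 0")
      case True
      then show ?thesis using ac[OF ij] by auto
    next
      case False
      then show ?thesis
        using e[OF ij(1)] g[OF ij(2)] t s by (intro mult_left_mono square_over_sum_le_powr) auto
    qed
  qed
  also have "\<dots> = young_const s * t powr (- s) * (\<Sum>i<n. \<Sum>j<n. overlap U V i j * (e i powr (1 + s) * g j powr (- s)))"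
    (is "_ = _ * ?S")
    by (simp add: sum_distrib_left algebra_simps)
  finally have "a \<le> (1 + z) * (young_const s * t powr (- s) * ?S)"
    using z by (simp add: x_def field_simps)
  also have "\<dots> = ((1 + z) * young_const s * z powr (- s)) * (l powr (- s) * ?S)"
    unfolding t_def using l z by (simp add: powr_mult algebra_simps)
  also have "(1 + z) * young_const s * z powr (- s) = 1"
    using young_const_attained[OF s] z by (simp add: z_def[symmetric] mult.commute powr_minus)
  finally show ?thesis by (simp add: a_def)
qed

section \<open>Smoothing below a multiple of a state\<close>

lemma frob2_add_expand:
  fixes M D :: "complex mat"
  assumes M: "M \<in> carrier_mat n n" and D: "D \<in> carrier_mat n n"
  shows "frob2 (M + complex_of_real c \<cdot>\<^sub>m D) = frob2 M + 2 * c * Re (mat_trace (adj M * D)) + c\<^sup>2 * frob2 D"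
proof -
  have tr: "Re (mat_trace (adj M * D)) = (\<Sum>i<n. \<Sum>j<n. Re (cnj (M $$ (i,j)) * D $$ (i,j)))"
  proof -
    have "mat_trace (adj M * D) = (\<Sum>j<n. \<Sum>i<n. cnj (M $$ (i,j)) * D $$ (i,j))"
      using M D by (subst trace_mult_sum[of _ n n]) (auto intro!: sum.cong)
    also have "\<dots> = (\<Sum>i<n. \<Sum>j<n. cnj (M $$ (i,j)) * D $$ (i,j))" by (rule sum.swap)
    finally show ?thesis by (simp only: Re_sum)
  qed
  have pt: "(cmod (x + complex_of_real c * y))\<^sup>2 = (cmod x)\<^sup>2 + 2 * c * Re (cnj x * y) + c\<^sup>2 * (cmod y)\<^sup>2" for x y
    unfolding cmod_power2 by (simp add: power2_eq_square algebra_simps)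
  have MD: "M + complex_of_real c \<cdot>\<^sub>m D \<in> carrier_mat n n" using D by auto
  have "frob2 (M + complex_of_real c \<cdot>\<^sub>m D) =
      (\<Sum>i<n. \<Sum>j<n. (cmod (M $$ (i,j)))\<^sup>2 + 2 * c * Re (cnj (M $$ (i,j)) * D $$ (i,j)) + c\<^sup>2 * (cmod (D $$ (i,j)))\<^sup>2)"
    unfolding frob2_sum[OF MD] pt[symmetric]
    using carrier_matD[OF M] carrier_matD[OF D] by (intro sum.cong refl) auto
  then show ?thesis
    unfolding tr frob2_sum[OF M] frob2_sum[OF D] by (simp only: sum.distrib sum_distrib_left)
qed

lemma frob2_diff_le:
  fixes A B :: "complex mat"
  assumes A: "A \<in> carrier_mat n n" and B: "B \<in> carrier_mat n n"
  shows "frob2 (A - B) \<le> 2 * frob2 A + 2 * frob2 B"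
proof -
  have pt: "(cmod (x - y))\<^sup>2 \<le> 2 * (cmod x)\<^sup>2 + 2 * (cmod y)\<^sup>2" for x y
  proof -
    have "(cmod (x - y))\<^sup>2 \<le> (cmod x + cmod y)\<^sup>2"
      by (intro power_mono norm_triangle_ineq4) auto
    also have "\<dots> \<le> 2 * (cmod x)\<^sup>2 + 2 * (cmod y)\<^sup>2"
      using sum_squares_bound[of "cmod x" "cmod y"] by (simp add: power2_sum)
    finally show ?thesis .
  qed
  have AB: "A - B \<in> carrier_mat n n" using B by (rule minus_carrier_mat)
  have "frob2 (A - B) \<le> (\<Sum>i<n. \<Sum>j<n. 2 * (cmod (A $$ (i,j)))\<^sup>2 + 2 * (cmod (B $$ (i,j)))\<^sup>2)"
    unfolding frob2_sum[OF AB]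
    using carrier_matD[OF A] carrier_matD[OF B] pt by (intro sum_mono) auto
  then show ?thesis
    unfolding frob2_sum[OF A] frob2_sum[OF B] by (simp add: sum.distrib sum_distrib_left)
qed

lemma frob2_diagonalizes:
  assumes D: "diagonalizes n A U e"
  shows "frob2 A = (\<Sum>i<n. (e i)\<^sup>2)"
proof -
  note U = diagonalizesD[OF D]
  have "A * A = U * rdiag n (\<lambda>i. (e i)\<^sup>2) * adj U"
    by (subst (1 2) U(4), rule conj_diag_mult[OF U(1,2)]) (simp add: power2_eq_square)
  then have "diagonalizes n (A * A) U (\<lambda>i. (e i)\<^sup>2)"
    using U unfolding diagonalizes_def by simp
  then have "mat_trace (adj A * A) = complex_of_real (\<Sum>i<n. (e i)\<^sup>2)"
    unfolding U(6) by (rule trace_diagonalizes)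
  then show ?thesis using frob2_trace(1)[OF U(5)] by (metis of_real_eq_iff)
qed

lemma frob2_density_le_1:
  assumes "\<tau> \<in> density_ops n"
  shows "frob2 \<tau> \<le> 1"
proof -
  have \<tau>: "psd \<tau>" "\<tau> \<in> carrier_mat n n" "mat_trace \<tau> = 1" using assms by (auto simp: density_ops_def)
  obtain U e where D: "diagonalizes n \<tau> U e" and e: "\<And>i. i < n \<Longrightarrow> 0 \<le> e i"
    using psd_diagonalizable[OF \<tau>(1,2)] by blast
  have s: "(\<Sum>i<n. e i) = 1"
    using trace_diagonalizes[OF D] \<tau>(3) by (metis of_real_eq_1_iff)
  have "e i \<le> 1" if "i < n" for i
    using member_le_sum[of i "{..<n}" e] e that s by auto
  then have "(\<Sum>i<n. (e i)\<^sup>2) \<le> (\<Sum>i<n. e i)"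
    using e by (intro sum_mono) (auto simp: power2_eq_square mult_left_le)
  then show ?thesis using s frob2_diagonalizes[OF D] by simp
qed

lemma trace_conj_diag_mult_right:
  assumes U: "U \<in> carrier_mat n n" and A: "A \<in> carrier_mat n n"
  shows "mat_trace (U * rdiag n f * adj U * A) =
    (\<Sum>i<n. complex_of_real (f i) * (adj U * A * U) $$ (i,i))"
proof -
  let ?F = "rdiag n f"
  note d = carrier_matD[OF U] carrier_matD[OF A]
  have M: "adj U * A * U \<in> carrier_mat n n" using d by (intro carrier_matI) simp_all
  have "mat_trace (U * ?F * adj U * A) = mat_trace (U * (?F * (adj U * A)))"
    using d by (simp add: mult_assoc_dim)
  also have "\<dots> = mat_trace (?F * (adj U * A) * U)"
    using d by (intro trace_comm[of _ n n] carrier_matI) simp_all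
  also have "?F * (adj U * A) * U = ?F * (adj U * A * U)"
    using d by (simp add: mult_assoc_dim)
  also have "mat_trace \<dots> = (\<Sum>i<n. complex_of_real (f i) * (adj U * A * U) $$ (i,i))"
    unfolding mat_diag_mult_left[OF M] by (simp add: mat_trace_def)
  finally show ?thesis .
qed

definition pos_part :: "complex mat \<Rightarrow> complex mat" where
  "pos_part = herm_fun (max 0)"

text \<open>In an eigenbasis of \<open>A\<close> the diagonal entries of \<open>A + Y\<close> are at
  least the eigenvalues of \<open>A\<close>, and dropping the off-diagonal entries only lowers the
  norm. A known negative part used as \<open>Y\<close> thus controls the positive part of a
  perturbed matrix without tracking its eigenvalues.\<close>

lemma pos_part_frob2_le:
  assumes A: "A \<in> carrier_mat n n" "adj A = A" and Y: "psd Y" "Y \<in> carrier_mat n n"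
  shows "frob2 (pos_part A) \<le> frob2 (A + Y)"
proof -
  obtain U a where D: "diagonalizes n A U a" using hermitian_diagonalizable[OF A] .
  note U = diagonalizesD[OF D]
  note d = carrier_matD[OF U(1)] carrier_matD[OF A(1)] carrier_matD[OF Y(2)]
  define Z where "Z = adj U * (A + Y) * U"
  have Z: "Z \<in> carrier_mat n n" unfolding Z_def using d by (intro carrier_matI) simp_all
  have AY: "A + Y \<in> carrier_mat n n" using Y(2) by simp
  have "frob2 Z = frob2 (adj U * (A + Y))"
    unfolding Z_def by (rule frob2_mult_unitary[OF U(1,2) mult_carrier_mat[OF adj_carrier[OF U(1)] AY]])
  also have "\<dots> = frob2 (adj (adj U * (A + Y)))" by (simp only: frob2_adj)
  also have "adj (adj U * (A + Y)) = adj (A + Y) * U"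
    using d by (simp add: adj_mult_dim)
  also have "frob2 \<dots> = frob2 (adj (A + Y))"
    by (rule frob2_mult_unitary[OF U(1,2) adj_carrier[OF AY]])
  also have "\<dots> = frob2 (A + Y)" by (rule frob2_adj)
  finally have fZ: "frob2 Z = frob2 (A + Y)" .
  have Zi: "max 0 (a i) \<le> cmod (Z $$ (i,i))" if i: "i < n" for i
  proof -
    have "Z = adj U * A * U + adj U * Y * U"
    proof -
      have "adj U * (A + Y) = adj U * A + adj U * Y"
        by (rule mult_add_distrib_mat[OF adj_carrier[OF U(1)] A(1) Y(2)])
      moreover have "(adj U * A + adj U * Y) * U = adj U * A * U + adj U * Y * U"
        using d by (intro add_mult_distrib_mat[of _ n n _ _ n] carrier_matI) simp_all
      ultimately show ?thesis by (simp add: Z_def)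
    qed
    then have "Z $$ (i,i) = (adj U * A * U) $$ (i,i) + (adj U * Y * U) $$ (i,i)"
      using i d by simp
    also have "(adj U * A * U) $$ (i,i) = complex_of_real (a i)"
      using diagonalizes_conj[OF D] i by simp
    finally have z: "Re (Z $$ (i,i)) = a i + Re ((adj U * Y * U) $$ (i,i))" by simp
    have "0 \<le> Re ((Y *\<^sub>v col U i) \<bullet>c col U i)"
      using psdD(2)[OF Y, of "col U i"] U(1) i by auto
    then have "0 \<le> Re ((adj U * Y * U) $$ (i,i))"
      unfolding qf_col[OF Y(2) U(1) i] .
    then show ?thesis using z complex_Re_le_cmod[of "Z $$ (i,i)"] by auto
  qed
  have "frob2 (pos_part A) = (\<Sum>i<n. (max 0 (a i))\<^sup>2)"
    unfolding pos_part_def by (rule frob2_diagonalizes[OF diagonalizes_herm_fun[OF D]])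
  also have "\<dots> \<le> (\<Sum>i<n. (cmod (Z $$ (i,i)))\<^sup>2)"
    using Zi by (intro sum_mono power_mono) auto
  also have "\<dots> \<le> (\<Sum>i<n. \<Sum>j<n. (cmod (Z $$ (i,j)))\<^sup>2)"
    by (intro sum_mono member_le_sum) auto
  also have "\<dots> = frob2 Z" by (simp add: frob2_sum[OF Z])
  finally show ?thesis using fZ by simp
qed

section \<open>Convexity through concatenated purifications, truncation and descent\<close>

definition hcat :: "complex mat \<Rightarrow> complex mat \<Rightarrow> complex mat" where
  "hcat A B = Matrix.mat (dim_row A) (dim_col A + dim_col B)
     (\<lambda>(i,j). if j < dim_col A then A $$ (i,j) else B $$ (i, j - dim_col A))"

lemma hcat_carrier: "A \<in> carrier_mat n m1 \<Longrightarrow> B \<in> carrier_mat n m2 \<Longrightarrow> hcat A B \<in> carrier_mat n (m1 + m2)"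
  by (auto simp: hcat_def)

lemma sum_lessThan_add:
  fixes f :: "nat \<Rightarrow> 'a :: comm_monoid_add"
  shows "(\<Sum>l<m + k. f l) = (\<Sum>l<m. f l) + (\<Sum>l<k. f (m + l))"
  by (induction k) (auto simp: add.assoc)

lemma hcat_mult_adj:
  assumes A: "A1 \<in> carrier_mat n m1" "A2 \<in> carrier_mat n m2"
    and B: "B1 \<in> carrier_mat n m1" "B2 \<in> carrier_mat n m2"
  shows "hcat A1 A2 * adj (hcat B1 B2) = A1 * adj B1 + A2 * adj B2"
proof (rule eq_matI)
  note d = carrier_matD[OF A(1)] carrier_matD[OF A(2)] carrier_matD[OF B(1)] carrier_matD[OF B(2)]
  note hA = hcat_carrier[OF A] and hB = hcat_carrier[OF B]
  fix i j assume "i < dim_row (A1 * adj B1 + A2 * adj B2)"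
    "j < dim_col (A1 * adj B1 + A2 * adj B2)"
  then have ij: "i < n" "j < n" using d by auto
  have 1: "(A1 * adj B1) $$ (i,j) = (\<Sum>l<m1. A1 $$ (i,l) * cnj (B1 $$ (j,l)))"
    using mult_index_sum[OF A(1) adj_carrier[OF B(1)] ij] d ij by simp
  have 2: "(A2 * adj B2) $$ (i,j) = (\<Sum>l<m2. A2 $$ (i,l) * cnj (B2 $$ (j,l)))"
    using mult_index_sum[OF A(2) adj_carrier[OF B(2)] ij] d ij by simp
  have "(hcat A1 A2 * adj (hcat B1 B2)) $$ (i,j) =
      (\<Sum>l<m1+m2. hcat A1 A2 $$ (i,l) * adj (hcat B1 B2) $$ (l,j))"
    by (rule mult_index_sum[OF hA adj_carrier[OF hB] ij])
  also have "\<dots> = (\<Sum>l<m1+m2. hcat A1 A2 $$ (i,l) * cnj (hcat B1 B2 $$ (j,l)))"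
    using carrier_matD[OF hB] ij by (intro sum.cong refl) simp
  also have "\<dots> = (\<Sum>l<m1. A1 $$ (i,l) * cnj (B1 $$ (j,l))) + (\<Sum>l<m2. A2 $$ (i,l) * cnj (B2 $$ (j,l)))"
    unfolding sum_lessThan_add using d ij by (auto simp: hcat_def intro!: arg_cong2[of _ _ _ _ "(+)"] sum.cong)
  finally show "(hcat A1 A2 * adj (hcat B1 B2)) $$ (i,j) =
      (A1 * adj B1 + A2 * adj B2) $$ (i,j)"
    using ij d 1 2 by (simp del: index_mult_mat(1))
qed (use assms in \<open>auto simp: hcat_def\<close>)

text \<open>States that are supported on \<open>P\<close> and whose fidelity with \<open>\<rho>\<close> is certified, by a pair of purifications,
  to be at least \<open>f\<close>. Certificates can be concatenated, which makes this set visibly convex.\<close>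

definition certified_states :: "nat \<Rightarrow> complex mat \<Rightarrow> complex mat \<Rightarrow> real \<Rightarrow> complex mat set" where
  "certified_states n P \<rho> f = {\<tau> \<in> density_ops n. \<tau> * P = \<tau> \<and>
     (\<exists>m A B. A \<in> carrier_mat n m \<and> B \<in> carrier_mat n m \<and> A * adj A = \<rho> \<and>
       B * adj B = \<tau> \<and> f \<le> Re (mat_trace (adj A * B)))}"

lemma certified_states_convex:
  assumes P: "P \<in> carrier_mat n n" and r: "\<rho> \<in> carrier_mat n n"
    and \<tau>1: "\<tau>1 \<in> certified_states n P \<rho> f" and \<tau>2: "\<tau>2 \<in> certified_states n P \<rho> f"
    and uv: "0 \<le> u" "0 \<le> v" "u + v = 1"
  shows "complex_of_real u \<cdot>\<^sub>m \<tau>1 + complex_of_real v \<cdot>\<^sub>m \<tau>2 \<in> certified_states n P \<rho> f"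
proof -
  obtain m1 A1 B1 where 1: "A1 \<in> carrier_mat n m1" "B1 \<in> carrier_mat n m1" "A1 * adj A1 = \<rho>"
    "B1 * adj B1 = \<tau>1" "f \<le> Re (mat_trace (adj A1 * B1))"
    and t1: "\<tau>1 \<in> carrier_mat n n" "mat_trace \<tau>1 = 1" "\<tau>1 * P = \<tau>1"
    using \<tau>1 by (auto simp: certified_states_def density_ops_def)
  obtain m2 A2 B2 where 2: "A2 \<in> carrier_mat n m2" "B2 \<in> carrier_mat n m2" "A2 * adj A2 = \<rho>"
    "B2 * adj B2 = \<tau>2" "f \<le> Re (mat_trace (adj A2 * B2))"
    and t2: "\<tau>2 \<in> carrier_mat n n" "mat_trace \<tau>2 = 1" "\<tau>2 * P = \<tau>2"
    using \<tau>2 by (auto simp: certified_states_def density_ops_def)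
  let ?u = "complex_of_real (sqrt u)" and ?v = "complex_of_real (sqrt v)"
  have uu: "?u * ?u = complex_of_real u" "?v * ?v = complex_of_real v"
    using uv by (simp_all flip: of_real_mult)
  have sq: "(complex_of_real c \<cdot>\<^sub>m X) * adj (complex_of_real c \<cdot>\<^sub>m Y) =
      (complex_of_real c * complex_of_real c) \<cdot>\<^sub>m (X * adj Y)"
    if "X \<in> carrier_mat n m" "Y \<in> carrier_mat n m" for X Y c m
  proof -
    have "(complex_of_real c \<cdot>\<^sub>m X) * (complex_of_real c \<cdot>\<^sub>m adj Y) =
        complex_of_real c \<cdot>\<^sub>m (X * (complex_of_real c \<cdot>\<^sub>m adj Y))"
      using that by (intro mult_smult_assoc_mat[of _ n m _ n]) auto
    also have "X * (complex_of_real c \<cdot>\<^sub>m adj Y) = complex_of_real c \<cdot>\<^sub>m (X * adj Y)"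
      using that by (intro mult_smult_distrib[of _ n m _ n]) auto
    also have "complex_of_real c \<cdot>\<^sub>m (complex_of_real c \<cdot>\<^sub>m (X * adj Y)) =
        (complex_of_real c * complex_of_real c) \<cdot>\<^sub>m (X * adj Y)"
      by (rule eq_matI) auto
    finally show ?thesis by (simp add: adj_smult)
  qed
  \<comment> \<open>With weights \<open>sqrt u\<close> and \<open>sqrt v\<close> the Gram matrices
    and the overlaps average with weights \<open>u\<close> and \<open>v\<close>; as both
    certificates share \<open>\<rho>\<close>, its Gram matrix is unchanged.\<close>
  define A where "A = hcat (?u \<cdot>\<^sub>m A1) (?v \<cdot>\<^sub>m A2)"
  define B where "B = hcat (?u \<cdot>\<^sub>m B1) (?v \<cdot>\<^sub>m B2)"
  have c: "?u \<cdot>\<^sub>m A1 \<in> carrier_mat n m1" "?v \<cdot>\<^sub>m A2 \<in> carrier_mat n m2"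
    "?u \<cdot>\<^sub>m B1 \<in> carrier_mat n m1" "?v \<cdot>\<^sub>m B2 \<in> carrier_mat n m2" using 1 2 by auto
  have A: "A \<in> carrier_mat n (m1 + m2)" and B: "B \<in> carrier_mat n (m1 + m2)"
    unfolding A_def B_def using c by (auto intro!: hcat_carrier)
  have AA: "A * adj A = \<rho>"
  proof -
    have "A * adj A = complex_of_real u \<cdot>\<^sub>m \<rho> + complex_of_real v \<cdot>\<^sub>m \<rho>"
      unfolding A_def hcat_mult_adj[OF c(1,2) c(1,2)] using sq[OF 1(1) 1(1)] sq[OF 2(1) 2(1)] 1 2 uu by simp
    also have "\<dots> = \<rho>"
    proof (rule eq_matI)
      fix i j assume "i < dim_row \<rho>" "j < dim_col \<rho>"
      then show "(complex_of_real u \<cdot>\<^sub>m \<rho> + complex_of_real v \<cdot>\<^sub>m \<rho>) $$ (i,j) = \<rho> $$ (i,j)"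
        using uv(3) by (simp flip: distrib_right of_real_add)
    qed auto
    finally show ?thesis .
  qed
  let ?T = "complex_of_real u \<cdot>\<^sub>m \<tau>1 + complex_of_real v \<cdot>\<^sub>m \<tau>2"
  have BB: "B * adj B = ?T"
    unfolding B_def hcat_mult_adj[OF c(3,4) c(3,4)] using sq[OF 1(2) 1(2)] sq[OF 2(2) 2(2)] 1 2 uu by simp
  have tc: "?T \<in> carrier_mat n n" using t2 by auto
  have "psd ?T" using psd_gram[OF B] BB by simp
  moreover have "mat_trace ?T = 1"
    using t1 t2 uv(3) by (simp add: trace_add[of _ n] trace_smult[of _ n] flip: of_real_add)
  moreover have "?T * P = ?T"
    using t1 t2 P by (simp add: add_mult_distrib_mat[of _ n n _ _ n] mult_smult_assoc_mat[of _ n n _ n])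
  moreover have "f \<le> Re (mat_trace (adj A * B))"
  proof -
    have "mat_trace (adj A * B) = mat_trace (B * adj A)"
      by (rule trace_comm[OF adj_carrier[OF A] B])
    also have "B * adj A = complex_of_real u \<cdot>\<^sub>m (B1 * adj A1) + complex_of_real v \<cdot>\<^sub>m (B2 * adj A2)"
      unfolding A_def B_def hcat_mult_adj[OF c(3,4) c(1,2)] using sq[OF 1(2) 1(1)] sq[OF 2(2) 2(1)] uu by simp
    also have "mat_trace \<dots> = complex_of_real u * mat_trace (B1 * adj A1) + complex_of_real v * mat_trace (B2 * adj A2)"
    proof -
      have "B1 * adj A1 \<in> carrier_mat n n" "B2 * adj A2 \<in> carrier_mat n n" using 1 2 by auto
      then show ?thesis by (simp add: trace_add[of _ n] trace_smult[of _ n])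
    qed
    also have "mat_trace (B1 * adj A1) = mat_trace (adj A1 * B1)"
      by (rule trace_comm[OF 1(2) adj_carrier[OF 1(1)]])
    also have "mat_trace (B2 * adj A2) = mat_trace (adj A2 * B2)"
      by (rule trace_comm[OF 2(2) adj_carrier[OF 2(1)]])
    finally have "Re (mat_trace (adj A * B)) =
      u * Re (mat_trace (adj A1 * B1)) + v * Re (mat_trace (adj A2 * B2))" by simp
    moreover have "u * f + v * f \<le> u * Re (mat_trace (adj A1 * B1)) + v * Re (mat_trace (adj A2 * B2))"
      using 1 2 uv by (intro add_mono mult_left_mono) auto
    moreover have "u * f + v * f = f" using uv(3) by (simp flip: distrib_right)
    ultimately show ?thesis by simp
  qed
  ultimately show ?thesis
    unfolding certified_states_def density_ops_def using tc A B AA BB by blast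
qed

lemma certified_states_sine_distance:
  assumes \<tau>: "\<tau> \<in> certified_states n P \<rho> (sqrt (1 - \<epsilon>\<^sup>2))" and eps: "0 < \<epsilon>" "\<epsilon> < 1"
  shows "sine_distance \<rho> \<tau> \<le> \<epsilon>"
proof -
  obtain m A B where AB: "A \<in> carrier_mat n m" "B \<in> carrier_mat n m" "A * adj A = \<rho>"
    "B * adj B = \<tau>" "sqrt (1 - \<epsilon>\<^sup>2) \<le> Re (mat_trace (adj A * B))"
    using \<tau> by (auto simp: certified_states_def)
  have "sqrt (1 - \<epsilon>\<^sup>2) \<le> fidelity \<rho> \<tau>"
    using fidelity_ge_purifications[OF AB(1,2)] AB by simp
  moreover have "\<epsilon>\<^sup>2 \<le> 1" using eps by (simp add: power_le_one)
  ultimately have "1 - \<epsilon>\<^sup>2 \<le> (fidelity \<rho> \<tau>)\<^sup>2"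
    by (metis diff_ge_0_iff_ge power_mono real_sqrt_ge_zero real_sqrt_pow2)
  then have "sqrt (1 - (fidelity \<rho> \<tau>)\<^sup>2) \<le> sqrt (\<epsilon>\<^sup>2)"
    by (intro real_sqrt_le_mono) simp
  then show ?thesis using eps by (simp add: sine_distance_def)
qed

lemma certified_states_self:
  assumes \<rho>: "\<rho> \<in> density_ops n" and P: "\<rho> * P = \<rho>" and f: "f \<le> 1"
  shows "\<rho> \<in> certified_states n P \<rho> f"
proof -
  have r: "psd \<rho>" "\<rho> \<in> carrier_mat n n" "mat_trace \<rho> = 1" using \<rho> by (auto simp: density_ops_def)
  note q = mat_sqrt_psd[OF r(1,2)]
  have "f \<le> Re (mat_trace (adj (mat_sqrt \<rho>) * mat_sqrt \<rho>))"
    unfolding q(2,3) using r(3) f by simp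
  moreover have "mat_sqrt \<rho> * adj (mat_sqrt \<rho>) = \<rho>" unfolding q(2,3) ..
  ultimately show ?thesis
    unfolding certified_states_def using \<rho> P q(1) by blast
qed

lemma trace_one_minus_mult:
  assumes "N \<in> carrier_mat n n" "A \<in> carrier_mat n n"
  shows "mat_trace ((1\<^sub>m n - N) * A) = mat_trace A - mat_trace (N * A)"
proof -
  have "(1\<^sub>m n - N) * A = 1\<^sub>m n * A - N * A"
    by (rule minus_mult_distrib_mat[OF one_carrier_mat assms])
  then show ?thesis using assms by (simp add: trace_minus[of _ n])
qed

lemma psd_diag_entry_nonneg:
  assumes "psd A" "A \<in> carrier_mat n n" "U \<in> carrier_mat n m" "i < m"
  shows "0 \<le> Re ((adj U * A * U) $$ (i,i))"
proof -
  have "0 \<le> Re ((A *\<^sub>v col U i) \<bullet>c col U i)"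
    using assms by (intro psdD(2)[OF assms(1,2)]) auto
  then show ?thesis unfolding qf_col[OF assms(2,3,4)] .
qed

text \<open>The truncated state \<open>G \<rho> G / Tr (G \<rho>)\<close>, where \<open>1 - G\<close> projects onto those eigenvectors of \<open>A\<close> with
  positive eigenvalue on which the measured \<open>\<rho>\<close> exceeds \<open>l\<close> times the measured \<open>\<sigma>\<close>.\<close>

lemma truncated_state:
  assumes \<rho>: "\<rho> \<in> density_ops n" and \<sigma>: "psd \<sigma>" "\<sigma> \<in> carrier_mat n n"
    and A: "A \<in> carrier_mat n n" "adj A = A"
    and P: "P \<in> carrier_mat n n" "adj P = P" "A * P = A" "\<rho> * P = \<rho>"
    and eps: "0 < \<epsilon>" "\<epsilon> < 1" and l: "0 < l"
    and proj: "\<And>N. \<lbrakk>N \<in> carrier_mat n n; adj N = N; N * N = N;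
      l * Re (mat_trace (N * \<sigma>)) \<le> Re (mat_trace (N * \<rho>))\<rbrakk> \<Longrightarrow> Re (mat_trace (N * \<rho>)) \<le> \<epsilon>\<^sup>2"
  obtains \<tau> where "\<tau> \<in> certified_states n P \<rho> (sqrt (1 - \<epsilon>\<^sup>2))"
    "Re (mat_trace (pos_part A * \<tau>)) \<le> l / (1 - \<epsilon>\<^sup>2) * Re (mat_trace (pos_part A * \<sigma>))"
proof -
  have r: "psd \<rho>" "\<rho> \<in> carrier_mat n n" "mat_trace \<rho> = 1" using \<rho> by (auto simp: density_ops_def)
  obtain U a where D: "diagonalizes n A U a" using hermitian_diagonalizable[OF A] .
  note U = diagonalizesD[OF D]
  define p where "p i = Re ((adj U * \<rho> * U) $$ (i,i))" for i
  define q where "q i = Re ((adj U * \<sigma> * U) $$ (i,i))" for i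
  have p0: "0 \<le> p i" and q0: "0 \<le> q i" if "i < n" for i
    using psd_diag_entry_nonneg[OF r(1,2) U(1) that] psd_diag_entry_nonneg[OF \<sigma> U(1) that]
    by (auto simp: p_def q_def)
  define ch where "ch i = (if 0 < a i \<and> l * q i < p i then 1 else 0 :: real)" for i
  define N where "N = U * rdiag n ch * adj U"
  define G where "G = 1\<^sub>m n - N"
  have N: "N \<in> carrier_mat n n" unfolding N_def using U(1) by (auto intro!: carrier_matI)
  have Gc: "G \<in> carrier_mat n n" unfolding G_def by (rule minus_carrier_mat[OF N])
  note d = carrier_matD[OF U(1)] carrier_matD[OF N] carrier_matD[OF Gc] carrier_matD[OF A(1)]
    carrier_matD[OF P(1)] carrier_matD[OF r(2)] carrier_matD[OF \<sigma>(2)]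
  note conj = conj_diag_mult[OF U(1,2)]
  have NN: "N * N = N" unfolding N_def by (rule conj) (auto simp: ch_def)
  have adjN: "adj N = N" unfolding N_def using d by (simp add: adj_mult_dim mult_assoc_dim)
  have GU: "G = U * rdiag n (\<lambda>i. 1 - ch i) * adj U"
  proof (rule eq_matI)
    fix i j assume "i < dim_row (U * rdiag n (\<lambda>i. 1 - ch i) * adj U)"
      "j < dim_col (U * rdiag n (\<lambda>i. 1 - ch i) * adj U)"
    then have ij: "i < n" "j < n" using d by auto
    have "(1\<^sub>m n :: complex mat) $$ (i,j) = (U * adj U) $$ (i,j)" using U(3) by simp
    also have "\<dots> = (\<Sum>k<n. U $$ (i,k) * cnj (U $$ (j,k)))"
      using mult_index_sum[OF U(1) adj_carrier[OF U(1)] ij] d ij by simp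
    finally have "G $$ (i,j) = (\<Sum>k<n. U $$ (i,k) * cnj (U $$ (j,k))) - (\<Sum>k<n. U $$ (i,k) * ch k * cnj (U $$ (j,k)))"
      unfolding G_def using ij d conj_diag_index[OF U(1) ij] by (simp add: N_def)
    then show "G $$ (i,j) = (U * rdiag n (\<lambda>i. 1 - ch i) * adj U) $$ (i,j)"
      unfolding conj_diag_index[OF U(1) ij] by (simp add: algebra_simps sum_subtractf)
  qed (use d in auto)
  have GG: "G * G = G" unfolding GU by (rule conj) (auto simp: ch_def)
  have adjG: "adj G = G" unfolding GU using d by (simp add: adj_mult_dim mult_assoc_dim del: of_real_diff)
  \<comment> \<open>\<open>N\<close> selects eigenvectors with positive eigenvalue, so it equals a
    function of \<open>A\<close> times \<open>A\<close>, with \<open>1 / a i\<close> on the selected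
    part, and inherits \<open>A * P = A\<close>. This keeps the truncated state supported on
    \<open>P\<close>.\<close>
  have NP: "N * P = N"
  proof -
    have "N = U * rdiag n (\<lambda>i. ch i / a i) * adj U * A"
      unfolding N_def by (subst U(4), rule conj[symmetric]) (auto simp: ch_def)
    moreover have "\<dots> * P = U * rdiag n (\<lambda>i. ch i / a i) * adj U * (A * P)"
      using d by (simp add: mult_assoc_dim)
    ultimately show ?thesis using P(3) by metis
  qed
  have trN: "Re (mat_trace (N * \<rho>)) = (\<Sum>i<n. ch i * p i)" "Re (mat_trace (N * \<sigma>)) = (\<Sum>i<n. ch i * q i)"
    unfolding N_def trace_conj_diag_mult_right[OF U(1) r(2)] trace_conj_diag_mult_right[OF U(1) \<sigma>(2)]
    by (simp_all add: p_def q_def)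
  have "l * Re (mat_trace (N * \<sigma>)) \<le> Re (mat_trace (N * \<rho>))"
    unfolding trN sum_distrib_left by (intro sum_mono) (auto simp: ch_def)
  from proj[OF N adjN NN this] have a: "Re (mat_trace (N * \<rho>)) \<le> \<epsilon>\<^sup>2" .
  define pg where "pg = Re (mat_trace (G * \<rho>))"
  have e1: "\<epsilon>\<^sup>2 < 1" using eps by (simp add: power_less_one_iff)
  have pg: "1 - \<epsilon>\<^sup>2 \<le> pg" "0 < pg"
    using a e1 trace_one_minus_mult[OF N r(2)] r(3) by (auto simp: pg_def G_def)
  have trG: "mat_trace (G * \<rho>) = complex_of_real pg"
  proof -
    have "mat_trace (G * \<rho>) = mat_trace (adj (G * \<rho>))"
      using d adjG psdD(1)[OF r(1,2)] trace_comm[OF Gc r(2)] by (simp add: adj_mult_dim)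
    also have "\<dots> = cnj (mat_trace (G * \<rho>))" by (rule trace_adj[OF mult_carrier_mat[OF Gc r(2)]])
    finally show ?thesis by (simp add: pg_def complex_eq_iff)
  qed
  define A0 where "A0 = mat_sqrt \<rho>"
  note A0 = mat_sqrt_psd[OF r(1,2), folded A0_def]
  \<comment> \<open>Normalisation of the purification \<open>G * A0\<close>. Its overlap with
    \<open>A0\<close> is \<open>k * Tr (G \<rho>) = sqrt pg\<close>, which gives the fidelity
    certificate.\<close>
  define k where "k = complex_of_real (1 / sqrt pg)"
  have kk: "k * k = complex_of_real (1 / pg)" "cnj k = k" "complex_of_real pg * k = complex_of_real (sqrt pg)"
    using pg by (simp_all add: k_def real_div_sqrt flip: of_real_mult of_real_divide)
  define B0 where "B0 = k \<cdot>\<^sub>m (G * A0)"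
  have GA: "G * A0 \<in> carrier_mat n n" by (rule mult_carrier_mat[OF Gc A0(1)])
  have B0: "B0 \<in> carrier_mat n n" unfolding B0_def using GA by simp
  define \<tau> where "\<tau> = B0 * adj B0"
  have \<tau>: "\<tau> = complex_of_real (1 / pg) \<cdot>\<^sub>m (G * \<rho> * G)"
  proof -
    have "\<tau> = k \<cdot>\<^sub>m (k \<cdot>\<^sub>m (G * A0 * adj (G * A0)))"
      unfolding \<tau>_def B0_def adj_smult kk(2)
      using GA adj_carrier[OF GA] by (simp add: mult_smult_assoc_mat[of _ n n _ n] mult_smult_distrib[of _ n n _ n])
    also have "G * A0 * adj (G * A0) = G * (A0 * A0) * G"
      using d carrier_matD[OF A0(1)] A0(2) adjG by (simp add: adj_mult_dim mult_assoc_dim)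
    also have "k \<cdot>\<^sub>m (k \<cdot>\<^sub>m (G * (A0 * A0) * G)) = (k * k) \<cdot>\<^sub>m (G * (A0 * A0) * G)"
      by (rule eq_matI) auto
    finally show ?thesis using kk(1) A0(3) by simp
  qed
  have GrG: "G * \<rho> * G \<in> carrier_mat n n" using d by (intro carrier_matI) simp_all
  have \<tau>c: "\<tau> \<in> carrier_mat n n" unfolding \<tau> using GrG by simp
  have tr_cyc: "mat_trace (X * (G * \<rho> * G)) = mat_trace (G * X * G * \<rho>)" if X: "X \<in> carrier_mat n n" for X
  proof -
    note dX = carrier_matD[OF X]
    have "mat_trace (X * (G * \<rho> * G)) = mat_trace ((X * G * \<rho>) * G)" using d dX by (simp add: mult_assoc_dim)
    also have "\<dots> = mat_trace (G * (X * G * \<rho>))"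
      using d dX by (intro trace_comm[of _ n n] carrier_matI) simp_all
    finally show ?thesis using d dX by (simp add: mult_assoc_dim)
  qed
  have "mat_trace (G * \<rho> * G) = mat_trace (G * \<rho>)"
    using tr_cyc[OF one_carrier_mat] d GG by simp
  then have "mat_trace \<tau> = 1"
    unfolding \<tau> using trG pg(2) trace_smult[OF GrG] by simp
  moreover have "psd \<tau>" unfolding \<tau>_def by (rule psd_gram[OF B0])
  moreover have "\<tau> * P = \<tau>"
  proof -
    have "G * P = P - N"
      unfolding G_def using minus_mult_distrib_mat[OF one_carrier_mat N P(1)] d NP by simp
    moreover have "\<rho> * (P - N) = \<rho> * P - \<rho> * N" by (rule mult_minus_distrib_mat[OF r(2) P(1) N])
    moreover have "\<rho> * G = \<rho> * 1\<^sub>m n - \<rho> * N" unfolding G_def by (rule mult_minus_distrib_mat[OF r(2) one_carrier_mat N])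
    ultimately have rGP: "\<rho> * (G * P) = \<rho> * G" using P(4) d by simp
    have "\<tau> * P = complex_of_real (1 / pg) \<cdot>\<^sub>m (G * \<rho> * G * P)"
      unfolding \<tau> by (rule mult_smult_assoc_mat[OF GrG P(1)])
    also have "G * \<rho> * G * P = G * (\<rho> * (G * P))" using d by (simp add: mult_assoc_dim)
    also have "\<dots> = G * \<rho> * G" unfolding rGP using d by (simp add: mult_assoc_dim)
    finally show ?thesis by (simp only: \<tau>)
  qed
  moreover have "sqrt (1 - \<epsilon>\<^sup>2) \<le> Re (mat_trace (adj A0 * B0))"
  proof -
    have "adj A0 * B0 = k \<cdot>\<^sub>m (A0 * (G * A0))"
      unfolding B0_def A0(2) by (rule mult_smult_distrib[OF A0(1) GA])
    then have "mat_trace (adj A0 * B0) = k * mat_trace (A0 * (G * A0))"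
      using trace_smult[OF mult_carrier_mat[OF A0(1) GA]] by simp
    also have "mat_trace (A0 * (G * A0)) = mat_trace (G * A0 * A0)"
      by (rule trace_comm[OF A0(1) GA])
    also have "G * A0 * A0 = G * \<rho>" using d carrier_matD[OF A0(1)] A0(3) by (simp add: mult_assoc_dim)
    finally have "mat_trace (adj A0 * B0) = complex_of_real (sqrt pg)"
      using trG kk(3) by (simp add: mult.commute)
    then show ?thesis using pg(1) by simp
  qed
  moreover have "A0 * adj A0 = \<rho>" unfolding A0(2,3) ..
  ultimately have mem: "\<tau> \<in> certified_states n P \<rho> (sqrt (1 - \<epsilon>\<^sup>2))"
    unfolding certified_states_def density_ops_def using \<tau>c A0(1) B0 \<tau>_def by blast
  have M: "pos_part A = U * rdiag n (\<lambda>i. max 0 (a i)) * adj U"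
    unfolding pos_part_def by (rule herm_fun_diagonalizes[OF D])
  have Mc: "pos_part A \<in> carrier_mat n n" unfolding M using d by (intro carrier_matI) simp_all
  \<comment> \<open>\<open>G\<close> commutes with \<open>pos_part A\<close>, so only eigenvectors
    outside \<open>N\<close> remain in the trace; on those with positive eigenvalue
    \<open>p i <= l * q i\<close> holds.\<close>
  have GMG: "G * pos_part A * G = U * rdiag n (\<lambda>i. (1 - ch i) * max 0 (a i)) * adj U"
  proof -
    have "G * pos_part A = U * rdiag n (\<lambda>i. (1 - ch i) * max 0 (a i)) * adj U"
      unfolding GU M by (rule conj) simp
    moreover have "\<dots> * G = U * rdiag n (\<lambda>i. (1 - ch i) * max 0 (a i)) * adj U"
      unfolding GU by (rule conj) (auto simp: ch_def)
    ultimately show ?thesis by simp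
  qed
  have trMs: "Re (mat_trace (pos_part A * \<sigma>)) = (\<Sum>i<n. max 0 (a i) * q i)"
    unfolding M trace_conj_diag_mult_right[OF U(1) \<sigma>(2)] by (simp add: q_def)
  have trMs0: "0 \<le> l * Re (mat_trace (pos_part A * \<sigma>))"
    unfolding trMs using q0 l by (intro mult_nonneg_nonneg sum_nonneg) auto
  have "mat_trace (pos_part A * \<tau>) = complex_of_real (1 / pg) * mat_trace (pos_part A * (G * \<rho> * G))"
    unfolding \<tau> using mult_smult_distrib[OF Mc GrG] trace_smult[OF mult_carrier_mat[OF Mc GrG]] by simp
  then have "Re (mat_trace (pos_part A * \<tau>)) = 1 / pg * Re (mat_trace (pos_part A * (G * \<rho> * G)))" by simp
  also have "mat_trace (pos_part A * (G * \<rho> * G)) = mat_trace (G * pos_part A * G * \<rho>)"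
    by (rule tr_cyc[OF Mc])
  also have "Re \<dots> = (\<Sum>i<n. (1 - ch i) * max 0 (a i) * p i)"
    unfolding GMG trace_conj_diag_mult_right[OF U(1) r(2)] by (simp add: p_def)
  also have "\<dots> \<le> (\<Sum>i<n. max 0 (a i) * (l * q i))"
  proof (intro sum_mono)
    fix i assume "i \<in> {..<n}"
    then show "(1 - ch i) * max 0 (a i) * p i \<le> max 0 (a i) * (l * q i)"
      using q0[of i] l by (auto simp: ch_def not_less intro: mult_left_mono)
  qed
  also have "\<dots> = l * Re (mat_trace (pos_part A * \<sigma>))"
    unfolding trMs sum_distrib_left by (simp add: algebra_simps)
  finally have "Re (mat_trace (pos_part A * \<tau>)) \<le> 1 / pg * (l * Re (mat_trace (pos_part A * \<sigma>)))"
    using pg(2) by (simp add: divide_right_mono)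
  also have "\<dots> \<le> 1 / (1 - \<epsilon>\<^sup>2) * (l * Re (mat_trace (pos_part A * \<sigma>)))"
    using pg(1) e1 trMs0 by (intro mult_right_mono divide_left_mono) auto
  finally show thesis using that mem by simp
qed

text \<open>One Frank--Wolfe step for the convex function \<open>\<tau> \<mapsto> \<parallel>(\<tau> - K \<sigma>)\<^sub>+\<parallel>\<^sup>2\<close>. Iterating it replaces the minimax
  theorem.\<close>

lemma frank_wolfe_step:
  assumes \<tau>: "\<tau> \<in> density_ops n" and \<tau>': "\<tau>' \<in> density_ops n" and \<sigma>: "\<sigma> \<in> carrier_mat n n" "adj \<sigma> = \<sigma>"
    and A_def: "A = \<tau> - complex_of_real K \<cdot>\<^sub>m \<sigma>"
    and le: "Re (mat_trace (pos_part A * \<tau>')) \<le> K * Re (mat_trace (pos_part A * \<sigma>))"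
    and \<eta>: "0 \<le> \<eta>"
  shows "frob2 (pos_part (complex_of_real (1 - \<eta>) \<cdot>\<^sub>m \<tau> + complex_of_real \<eta> \<cdot>\<^sub>m \<tau>' - complex_of_real K \<cdot>\<^sub>m \<sigma>))
    \<le> (1 - 2 * \<eta>) * frob2 (pos_part A) + 4 * \<eta>\<^sup>2"
proof -
  have t: "psd \<tau>" "\<tau> \<in> carrier_mat n n" and t': "psd \<tau>'" "\<tau>' \<in> carrier_mat n n"
    using \<tau> \<tau>' by (auto simp: density_ops_def)
  note h = psdD(1)[OF t] psdD(1)[OF t']
  note d = carrier_matD[OF t(2)] carrier_matD[OF t'(2)] carrier_matD[OF \<sigma>(1)]
  have A: "A \<in> carrier_mat n n" unfolding A_def using d by (intro carrier_matI) auto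
  have adjA: "adj A = A"
    unfolding A_def by (subst adj_minus[of _ n n]) (auto simp: t adj_smult h \<sigma>)
  obtain U a where D: "diagonalizes n A U a" using hermitian_diagonalizable[OF A adjA] .
  note U = diagonalizesD[OF D]
  define M where "M = pos_part A"
  have DM: "diagonalizes n M U (\<lambda>i. max 0 (a i))"
    unfolding M_def pos_part_def by (rule diagonalizes_herm_fun[OF D])
  note M = diagonalizesD[OF DM]
  have "M * M = U * rdiag n (\<lambda>i. (max 0 (a i))\<^sup>2) * adj U"
    unfolding M(4) by (rule conj_diag_mult[OF U(1,2)]) (simp add: power2_eq_square)
  moreover have "M * A = U * rdiag n (\<lambda>i. (max 0 (a i))\<^sup>2) * adj U"
    unfolding M(4) by (subst U(4), rule conj_diag_mult[OF U(1,2)]) (simp add: power2_eq_square max_def)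
  ultimately have MA: "M * A = M * M" by simp
  \<comment> \<open>The negative part of the current iterate. Adding it to the next iterate
    \<open>A'\<close> gives \<open>M + \<eta> (\<tau>' - \<tau>)\<close>, so the new positive part
    is bounded by an explicit quadratic in \<open>\<eta>\<close>.\<close>
  define Y where "Y = M - A"
  have Yc: "Y \<in> carrier_mat n n" unfolding Y_def by (rule minus_carrier_mat[OF A])
  have Y: "psd Y"
  proof -
    have "Y = U * rdiag n (\<lambda>i. max 0 (a i) - a i) * adj U"
    proof (rule eq_matI)
      fix i j assume "i < dim_row (U * rdiag n (\<lambda>i. max 0 (a i) - a i) * adj U)"
        "j < dim_col (U * rdiag n (\<lambda>i. max 0 (a i) - a i) * adj U)"
      then have ij: "i < n" "j < n" using U(1) by auto
      have "Y $$ (i,j) = M $$ (i,j) - A $$ (i,j)" unfolding Y_def using ij carrier_matD[OF A] by simp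
      also have "\<dots> = (\<Sum>k<n. U $$ (i,k) * complex_of_real (max 0 (a k)) * cnj (U $$ (j,k))) -
          (\<Sum>k<n. U $$ (i,k) * complex_of_real (a k) * cnj (U $$ (j,k)))"
        unfolding conj_diag_index[OF U(1) ij, symmetric] by (simp only: M(4)[symmetric] U(4)[symmetric])
      finally show "Y $$ (i,j) = (U * rdiag n (\<lambda>i. max 0 (a i) - a i) * adj U) $$ (i,j)"
        unfolding conj_diag_index[OF U(1) ij] by (simp add: algebra_simps sum_subtractf)
    qed (use carrier_matD[OF Yc] carrier_matD[OF U(1)] in auto)
    then show ?thesis using psd_conj_diag[OF U(1), of "\<lambda>i. max 0 (a i) - a i"] by simp
  qed
  define A' where "A' = complex_of_real (1 - \<eta>) \<cdot>\<^sub>m \<tau> + complex_of_real \<eta> \<cdot>\<^sub>m \<tau>' - complex_of_real K \<cdot>\<^sub>m \<sigma>"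
  have A': "A' \<in> carrier_mat n n" unfolding A'_def using d by (intro carrier_matI) auto
  have adjA': "adj A' = A'"
  proof -
    have "adj (complex_of_real (1 - \<eta>) \<cdot>\<^sub>m \<tau> + complex_of_real \<eta> \<cdot>\<^sub>m \<tau>') = complex_of_real (1 - \<eta>) \<cdot>\<^sub>m \<tau> + complex_of_real \<eta> \<cdot>\<^sub>m \<tau>'"
      by (subst adj_add[of _ n n]) (use t t' in \<open>simp_all add: adj_smult h\<close>)
    then show ?thesis
      unfolding A'_def by (subst adj_minus[of _ n n]) (use t t' \<sigma> in \<open>simp_all add: adj_smult\<close>)
  qed
  have td: "\<tau>' - \<tau> \<in> carrier_mat n n" by (rule minus_carrier_mat[OF t(2)])
  have "A' + Y = M + complex_of_real \<eta> \<cdot>\<^sub>m (\<tau>' - \<tau>)"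
  proof (rule eq_matI)
    fix i j assume "i < dim_row (M + complex_of_real \<eta> \<cdot>\<^sub>m (\<tau>' - \<tau>))" "j < dim_col (M + complex_of_real \<eta> \<cdot>\<^sub>m (\<tau>' - \<tau>))"
    then have ij: "i < n" "j < n" using d by auto
    show "(A' + Y) $$ (i,j) = (M + complex_of_real \<eta> \<cdot>\<^sub>m (\<tau>' - \<tau>)) $$ (i,j)"
      using ij d carrier_matD[OF A] carrier_matD[OF M(5)] carrier_matD[OF A'] unfolding A'_def Y_def A_def
      by (simp add: algebra_simps)
  qed (use d carrier_matD[OF Yc] carrier_matD[OF A'] in auto)
  then have "frob2 (pos_part A') \<le> frob2 (M + complex_of_real \<eta> \<cdot>\<^sub>m (\<tau>' - \<tau>))"
    using pos_part_frob2_le[OF A' adjA' Y Yc] by simp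
  also have "\<dots> = frob2 M + 2 * \<eta> * Re (mat_trace (M * (\<tau>' - \<tau>))) + \<eta>\<^sup>2 * frob2 (\<tau>' - \<tau>)"
    using frob2_add_expand[OF M(5) td] M(6) by simp
  also have "\<dots> \<le> frob2 M + 2 * \<eta> * (- frob2 M) + \<eta>\<^sup>2 * 4"
  proof (intro add_mono mult_left_mono order_refl)
    have "frob2 (\<tau>' - \<tau>) \<le> 2 * frob2 \<tau>' + 2 * frob2 \<tau>" by (rule frob2_diff_le[OF t'(2) t(2)])
    also have "\<dots> \<le> 4" using frob2_density_le_1[OF \<tau>] frob2_density_le_1[OF \<tau>'] by simp
    finally show "frob2 (\<tau>' - \<tau>) \<le> 4" .
    \<comment> \<open>As \<open>M * A = M * M\<close>, the trace of \<open>M * \<tau>\<close>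
      exceeds \<open>K * Tr (M \<sigma>)\<close> by exactly \<open>frob2 M\<close>, while that of
      \<open>M * \<tau>'\<close> does not exceed it. Hence the direction
      \<open>\<tau>' - \<tau>\<close> has slope at most \<open>- frob2 M\<close>.\<close>
    have "M * A = M * \<tau> - M * (complex_of_real K \<cdot>\<^sub>m \<sigma>)"
      unfolding A_def by (rule mult_minus_distrib_mat[OF M(5) t(2)]) (use \<sigma> in simp)
    also have "M * (complex_of_real K \<cdot>\<^sub>m \<sigma>) = complex_of_real K \<cdot>\<^sub>m (M * \<sigma>)"
      by (rule mult_smult_distrib[OF M(5) \<sigma>(1)])
    finally have "mat_trace (M * M) = mat_trace (M * \<tau>) - complex_of_real K * mat_trace (M * \<sigma>)"
      unfolding MA using M(5) t \<sigma> by (simp add: trace_minus[of _ n] trace_smult[of _ n])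
    moreover have "mat_trace (M * M) = complex_of_real (frob2 M)"
      using frob2_trace(1)[OF M(5)] M(6) by simp
    ultimately have "Re (mat_trace (M * \<tau>)) = frob2 M + K * Re (mat_trace (M * \<sigma>))"
      by (simp add: complex_eq_iff)
    moreover have "M * (\<tau>' - \<tau>) = M * \<tau>' - M * \<tau>" by (rule mult_minus_distrib_mat[OF M(5) t'(2) t(2)])
    ultimately show "Re (mat_trace (M * (\<tau>' - \<tau>))) \<le> - frob2 M"
      using le M(5) t t' by (simp add: trace_minus[of _ n] M_def)
  qed (use \<eta> in auto)
  also have "\<dots> = (1 - 2 * \<eta>) * frob2 M + 4 * \<eta>\<^sup>2" by (simp add: algebra_simps)
  finally show ?thesis by (simp add: A'_def M_def)
qed

text \<open>Let \<open>\<phi>\<close> approach its infimum \<open>r\<close> in the inequality of a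
  single descent step. This gives \<open>r <= (1 - 2 \<eta>) r + 4 \<eta>^2\<close>, so
  \<open>r <= 2 \<eta>\<close> for all small \<open>\<eta>\<close>, and states with arbitrarily
  small positive part exist. The argument takes place at the infimum, without a minimiser or a
  sequence of iterates.\<close>

lemma certified_state_approx:
  assumes \<rho>: "\<rho> \<in> density_ops n" and \<sigma>: "psd \<sigma>" "\<sigma> \<in> carrier_mat n n"
    and P: "P \<in> carrier_mat n n" "adj P = P" "\<sigma> * P = \<sigma>" "\<rho> * P = \<rho>"
    and eps: "0 < \<epsilon>" "\<epsilon> < 1" and l: "0 < l"
    and proj: "\<And>N. \<lbrakk>N \<in> carrier_mat n n; adj N = N; N * N = N;
      l * Re (mat_trace (N * \<sigma>)) \<le> Re (mat_trace (N * \<rho>))\<rbrakk> \<Longrightarrow> Re (mat_trace (N * \<rho>)) \<le> \<epsilon>\<^sup>2"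
    and \<delta>: "0 < \<delta>"
  obtains \<tau> where "\<tau> \<in> certified_states n P \<rho> (sqrt (1 - \<epsilon>\<^sup>2))"
    "frob2 (pos_part (\<tau> - complex_of_real (l / (1 - \<epsilon>\<^sup>2)) \<cdot>\<^sub>m \<sigma>)) < \<delta>"
proof -
  define K where "K = l / (1 - \<epsilon>\<^sup>2)"
  define C where "C = certified_states n P \<rho> (sqrt (1 - \<epsilon>\<^sup>2))"
  define \<phi> where "\<phi> \<tau> = frob2 (pos_part (\<tau> - complex_of_real K \<cdot>\<^sub>m \<sigma>))" for \<tau>
  define r where "r = Inf (\<phi> ` C)"
  have rc: "\<rho> \<in> carrier_mat n n" using \<rho> by (simp add: density_ops_def)
  have "\<rho> \<in> C" unfolding C_def using certified_states_self[OF \<rho> P(4)] by (simp add: real_sqrt_le_1_iff)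
  then have ne: "\<phi> ` C \<noteq> {}" by blast
  have bdd: "bdd_below (\<phi> ` C)" by (rule bdd_belowI[of _ 0]) (auto simp: \<phi>_def)
  have step: "r \<le> (1 - 2 * \<eta>) * \<phi> \<tau> + 4 * \<eta>\<^sup>2" if \<tau>: "\<tau> \<in> C" and \<eta>: "0 \<le> \<eta>" "\<eta> \<le> 1" for \<tau> \<eta>
  proof -
    have td: "\<tau> \<in> density_ops n" "\<tau> * P = \<tau>" using \<tau> by (auto simp: C_def certified_states_def)
    then have tc: "psd \<tau>" "\<tau> \<in> carrier_mat n n" by (auto simp: density_ops_def)
    define A where "A = \<tau> - complex_of_real K \<cdot>\<^sub>m \<sigma>"
    have s\<sigma>: "complex_of_real K \<cdot>\<^sub>m \<sigma> \<in> carrier_mat n n" using \<sigma> by simp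
    have A: "A \<in> carrier_mat n n" unfolding A_def by (rule minus_carrier_mat[OF s\<sigma>])
    have adjA: "adj A = A"
      unfolding A_def by (subst adj_minus[of _ n n]) (use tc \<sigma> psdD(1)[OF tc] psdD(1)[OF \<sigma>] in \<open>auto simp: adj_smult\<close>)
    have AP: "A * P = A"
      unfolding A_def using minus_mult_distrib_mat[OF tc(2) s\<sigma> P(1)] mult_smult_assoc_mat[OF \<sigma>(2) P(1)] P(3) td(2) by simp
    obtain \<tau>' where \<tau>': "\<tau>' \<in> C" "Re (mat_trace (pos_part A * \<tau>')) \<le> K * Re (mat_trace (pos_part A * \<sigma>))"
      using truncated_state[OF \<rho> \<sigma> A adjA P(1,2) AP P(4) eps l proj] unfolding C_def K_def by blast
    then have \<tau>'d: "\<tau>' \<in> density_ops n" by (auto simp: C_def certified_states_def)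
    let ?T = "complex_of_real (1 - \<eta>) \<cdot>\<^sub>m \<tau> + complex_of_real \<eta> \<cdot>\<^sub>m \<tau>'"
    have "?T \<in> C"
      unfolding C_def using \<tau> \<tau>'(1) \<eta> by (intro certified_states_convex[OF P(1) rc]) (auto simp: C_def)
    then have "r \<le> \<phi> ?T" unfolding r_def using bdd by (intro cInf_lower) auto
    also have "\<phi> ?T \<le> (1 - 2 * \<eta>) * \<phi> \<tau> + 4 * \<eta>\<^sup>2"
      unfolding \<phi>_def using frank_wolfe_step[OF td(1) \<tau>'d \<sigma>(2) psdD(1)[OF \<sigma>] A_def \<tau>'(2) \<eta>(1)] by (simp add: A_def)
    finally show ?thesis .
  qed
  have "r \<le> 2 * \<eta>" if \<eta>: "0 < \<eta>" "\<eta> \<le> 1 / 2" for \<eta>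
  proof -
    have "r \<le> (1 - 2 * \<eta>) * r + 4 * \<eta>\<^sup>2"
    proof (rule field_le_epsilon)
      fix e :: real assume e: "0 < e"
      obtain \<tau> where \<tau>: "\<tau> \<in> C" "\<phi> \<tau> < r + e"
        using cInf_lessD[OF ne, of "r + e"] e unfolding r_def by auto
      have "r \<le> (1 - 2 * \<eta>) * \<phi> \<tau> + 4 * \<eta>\<^sup>2" using \<eta> by (intro step[OF \<tau>(1)]) auto
      also have "\<dots> \<le> (1 - 2 * \<eta>) * (r + e) + 4 * \<eta>\<^sup>2"
        using \<tau>(2) \<eta> by (intro add_mono mult_left_mono) auto
      also have "\<dots> \<le> (1 - 2 * \<eta>) * r + 4 * \<eta>\<^sup>2 + e"
        using \<eta> e by (simp add: algebra_simps)
      finally show "r \<le> (1 - 2 * \<eta>) * r + 4 * \<eta>\<^sup>2 + e" .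
    qed
    then have "\<eta> * (2 * r) \<le> \<eta> * (4 * \<eta>)" by (simp add: algebra_simps power2_eq_square)
    then show ?thesis using \<eta> by simp
  qed
  \<comment> \<open>For \<open>\<delta> <= 2\<close> the choice \<open>\<eta> = \<delta> / 4\<close>
    is admissible and gives \<open>r <= \<delta> / 2\<close>; for larger \<open>\<delta>\<close> the
    choice \<open>\<eta> = 1 / 2\<close> gives \<open>r <= 1\<close>.\<close>
  from this[of "1 / 2"] this[of "\<delta> / 4"] have "r < \<delta>"
    using \<delta> by (cases "\<delta> \<le> 2") auto
  then obtain \<tau> where "\<tau> \<in> C" "\<phi> \<tau> < \<delta>"
    using cInf_lessD[OF ne, of \<delta>] unfolding r_def by auto
  then show thesis using that by (simp add: C_def \<phi>_def K_def)
qed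

section \<open>From a small positive part to an operator inequality\<close>

lemma support_projection:
  assumes D: "diagonalizes n \<sigma> V g"
  shows "mat_powr \<sigma> 0 \<in> carrier_mat n n" "adj (mat_powr \<sigma> 0) = mat_powr \<sigma> 0"
    "\<sigma> * mat_powr \<sigma> 0 = \<sigma>" "mat_powr \<sigma> 0 * mat_powr \<sigma> 0 = mat_powr \<sigma> 0"
    "mat_powr \<sigma> 0 = V * rdiag n (\<lambda>i. if g i = 0 then 0 else 1) * adj V"
proof -
  note V = diagonalizesD[OF D]
  have D0: "diagonalizes n (mat_powr \<sigma> 0) V (\<lambda>i. g i powr 0)"
    unfolding mat_powr_def by (rule diagonalizes_herm_fun[OF D])
  note P = diagonalizesD[OF D0]
  show "mat_powr \<sigma> 0 \<in> carrier_mat n n" "adj (mat_powr \<sigma> 0) = mat_powr \<sigma> 0" using P by auto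
  show "\<sigma> * mat_powr \<sigma> 0 = \<sigma>"
    unfolding P(4) by (subst (1 2) V(4), rule conj_diag_mult[OF V(1,2)]) simp
  show "mat_powr \<sigma> 0 * mat_powr \<sigma> 0 = mat_powr \<sigma> 0"
    unfolding P(4) by (rule conj_diag_mult[OF V(1,2)]) simp
  have "(\<lambda>i. complex_of_real (g i powr 0)) = (\<lambda>i. complex_of_real (if g i = 0 then 0 else 1))" by auto
  then show "mat_powr \<sigma> 0 = V * rdiag n (\<lambda>i. if g i = 0 then 0 else 1) * adj V"
    unfolding P(4) by simp
qed

lemma psdI_quad:
  assumes A: "A \<in> carrier_mat n n" "adj A = A"
    and quad: "\<And>X. X \<in> carrier_mat n 1 \<Longrightarrow> 0 \<le> Re (mat_trace (adj X * A * X))"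
  shows "psd A"
proof (rule psdI[OF A])
  fix v :: "complex vec" assume v: "v \<in> carrier_vec n"
  define X where "X = Matrix.mat n 1 (\<lambda>(i,j). v $ i)"
  have X: "X \<in> carrier_mat n 1" by (simp add: X_def)
  have c: "col X 0 = v" using v by (auto simp: X_def)
  have "mat_trace (adj X * A * X) = (\<Sum>i<1. (adj X * A * X) $$ (i,i))"
    using X A by (intro trace_sum[of _ 1 1]) auto
  also have "\<dots> = (A *\<^sub>v v) \<bullet>c v" using qf_col[OF A(1) X, of 0] c by simp
  finally show "0 \<le> Re ((A *\<^sub>v v) \<bullet>c v)" using quad[OF X] by simp
qed

text \<open>Every eigenvalue of \<open>A = \<tau> - K \<sigma>\<close> is at most \<open>q\<close>,
  and \<open>A\<close> lives on the support of \<open>\<sigma>\<close>. Hence \<open>A\<close> is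
  bounded by \<open>q\<close> times the support projection, which is at most
  \<open>\<sigma> / \<mu>\<close>. The error thus becomes a slightly larger multiple of
  \<open>\<sigma>\<close>.\<close>

lemma loewner_le_if_pos_part_small:
  assumes \<tau>: "\<tau> \<in> density_ops n" "\<tau> * mat_powr \<sigma> 0 = \<tau>"
    and D: "diagonalizes n \<sigma> V g"
    and \<mu>: "0 < \<mu>" "\<And>i. i < n \<Longrightarrow> g i \<noteq> 0 \<Longrightarrow> \<mu> \<le> g i"
    and small: "frob2 (pos_part (\<tau> - complex_of_real K \<cdot>\<^sub>m \<sigma>)) \<le> q\<^sup>2" and q: "0 \<le> q"
  shows "loewner_le \<tau> (complex_of_real (K + q / \<mu>) \<cdot>\<^sub>m \<sigma>)"
proof -
  have t: "psd \<tau>" "\<tau> \<in> carrier_mat n n" using \<tau> by (auto simp: density_ops_def)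
  note V = diagonalizesD[OF D]
  define P where "P = mat_powr \<sigma> 0"
  note P = support_projection[OF D, folded P_def]
  define A where "A = \<tau> - complex_of_real K \<cdot>\<^sub>m \<sigma>"
  have s\<sigma>: "complex_of_real c \<cdot>\<^sub>m \<sigma> \<in> carrier_mat n n" for c using V by simp
  have A: "A \<in> carrier_mat n n" unfolding A_def by (rule minus_carrier_mat[OF s\<sigma>])
  have adjA: "adj A = A"
    unfolding A_def by (subst adj_minus[of _ n n]) (use t V psdD(1)[OF t] in \<open>auto simp: adj_smult\<close>)
  have AP: "A * P = A"
    unfolding A_def using minus_mult_distrib_mat[OF t(2) s\<sigma> P(1)] mult_smult_assoc_mat[OF V(5) P(1)] P(3) \<tau>(2)
    by (simp add: P_def)
  obtain U a where DA: "diagonalizes n A U a" using hermitian_diagonalizable[OF A adjA] .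
  note U = diagonalizesD[OF DA]
  have aq: "a i \<le> q" if i: "i < n" for i
  proof -
    have "(max 0 (a i))\<^sup>2 \<le> (\<Sum>i<n. (max 0 (a i))\<^sup>2)" using i by (intro member_le_sum) auto
    also have "\<dots> = frob2 (pos_part A)"
      unfolding pos_part_def using frob2_diagonalizes[OF diagonalizes_herm_fun[OF DA]] by simp
    also have "\<dots> \<le> q\<^sup>2" using small by (simp add: A_def)
    finally have "max 0 (a i) \<le> q" using q by (simp add: power2_le_iff_abs_le)
    then show ?thesis by simp
  qed
  show ?thesis unfolding loewner_le_def
  proof (rule psdI_quad)
    show "complex_of_real (K + q / \<mu>) \<cdot>\<^sub>m \<sigma> - \<tau> \<in> carrier_mat n n" by (rule minus_carrier_mat[OF t(2)])
    show "adj (complex_of_real (K + q / \<mu>) \<cdot>\<^sub>m \<sigma> - \<tau>) = complex_of_real (K + q / \<mu>) \<cdot>\<^sub>m \<sigma> - \<tau>"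
      using t V psdD(1)[OF t] s\<sigma>[of "K + q / \<mu>"] by (subst adj_minus[of _ n n]) (auto simp: adj_smult simp del: of_real_add of_real_divide)
    fix X :: "complex mat" assume X: "X \<in> carrier_mat n 1"
    note d = carrier_matD[OF X] carrier_matD[OF P(1)] carrier_matD[OF A] carrier_matD[OF V(1)] carrier_matD[OF U(1)]
    define S where "S = Re (mat_trace (adj X * \<sigma> * X))"
    define T where "T = Re (mat_trace (adj X * \<tau> * X))"
    have PX: "P * X \<in> carrier_mat n 1" by (rule mult_carrier_mat[OF P(1) X])
    have "adj X * A * X = adj (P * X) * A * (P * X)"
    proof -
      have "A = adj (A * P)" using AP adjA by simp
      then have "A = P * A" using d adjA P(2) by (simp add: adj_mult_dim)
      then have "A = P * (A * P)" using AP by simp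
      then have "adj X * A * X = adj X * (P * (A * P)) * X" by simp
      then show ?thesis using d P(2) by (simp add: adj_mult_dim mult_assoc_dim)
    qed
    then have "Re (mat_trace (adj X * A * X)) =
        (\<Sum>i<n. \<Sum>j<1. a i * (cmod ((adj U * (P * X)) $$ (i,j)))\<^sup>2)"
      by (simp only: trace_quad_diagonalizes[OF DA PX] Re_complex_of_real)
    also have "\<dots> \<le> (\<Sum>i<n. \<Sum>j<1. q * (cmod ((adj U * (P * X)) $$ (i,j)))\<^sup>2)"
      using aq by (intro sum_mono mult_right_mono) auto
    also have "\<dots> = q * frob2 (adj U * (P * X))"
      unfolding frob2_sum[OF mult_carrier_mat[OF adj_carrier[OF U(1)] PX]] sum_distrib_left ..
    also have "frob2 (adj U * (P * X)) = frob2 (P * X)"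
    proof -
      have "adj (adj U * (P * X)) * (adj U * (P * X)) = adj (P * X) * (P * X)"
        using d by (simp add: adj_mult_dim mult_assoc_dim unitary_cancel[OF U(1,2)])
      then show ?thesis
        using frob2_trace(1)[OF PX] frob2_trace(1)[OF mult_carrier_mat[OF adj_carrier[OF U(1)] PX]] by simp
    qed
    also have "frob2 (P * X) = (\<Sum>i<n. \<Sum>j<1. (if g i = 0 then 0 else 1) * (cmod ((adj V * X) $$ (i,j)))\<^sup>2)"
    proof -
      have "adj (P * X) * (P * X) = adj X * (P * P) * X"
        using d P(2) by (simp add: adj_mult_dim mult_assoc_dim)
      then have f: "complex_of_real (frob2 (P * X)) = mat_trace (adj X * P * X)"
        using frob2_trace(1)[OF PX] P(4) by simp
      have DP: "diagonalizes n P V (\<lambda>i. if g i = 0 then 0 else 1)"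
        unfolding diagonalizes_def using P(5) V by blast
      show ?thesis
        using f unfolding trace_quad_diagonalizes[OF DP X] of_real_eq_iff .
    qed
    also have "q * \<dots> \<le> q * (\<Sum>i<n. \<Sum>j<1. g i / \<mu> * (cmod ((adj V * X) $$ (i,j)))\<^sup>2)"
    proof (intro mult_left_mono sum_mono mult_right_mono q)
      fix i assume "i \<in> {..<n}"
      then show "(if g i = 0 then 0 else 1) \<le> g i / \<mu>" using \<mu>(1) \<mu>(2)[of i] by auto
    qed auto
    also have "\<dots> = q / \<mu> * S"
      unfolding S_def trace_quad_diagonalizes[OF D X] Re_complex_of_real sum_distrib_left by (simp add: algebra_simps)
    finally have 1: "Re (mat_trace (adj X * A * X)) \<le> q / \<mu> * S" .
    have "Re (mat_trace (adj X * A * X)) = T - K * S"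
    proof -
      have "A = complex_of_real 1 \<cdot>\<^sub>m \<tau> - complex_of_real K \<cdot>\<^sub>m \<sigma>" 
      proof -
        have "complex_of_real 1 \<cdot>\<^sub>m \<tau> = \<tau>" by (rule eq_matI) auto
        then show ?thesis by (simp only: A_def)
      qed
      then have "Re (mat_trace (adj X * A * X)) = T - Re (mat_trace (adj X * (complex_of_real K \<cdot>\<^sub>m \<sigma>) * X))"
        using Re_trace_quad_diff[OF t(2) s\<sigma> X, of 1 K] by (simp add: T_def)
      moreover have "mat_trace (adj X * (complex_of_real K \<cdot>\<^sub>m \<sigma>) * X) = complex_of_real K * mat_trace (adj X * \<sigma> * X)"
      proof -
        have "adj X * (complex_of_real K \<cdot>\<^sub>m \<sigma>) * X = complex_of_real K \<cdot>\<^sub>m (adj X * \<sigma> * X)"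
          unfolding mult_smult_distrib[OF adj_carrier[OF X] V(5)]
          by (rule mult_smult_assoc_mat[OF mult_carrier_mat[OF adj_carrier[OF X] V(5)] X])
        moreover have "adj X * \<sigma> * X \<in> carrier_mat 1 1" using V(5) X by auto
        ultimately show ?thesis by (simp add: trace_smult[of _ 1])
      qed
      ultimately show ?thesis by (simp add: S_def)
    qed
    then show "0 \<le> Re (mat_trace (adj X * (complex_of_real (K + q / \<mu>) \<cdot>\<^sub>m \<sigma> - \<tau>) * X))"
      unfolding Re_trace_quad_diff[OF V(5) t(2) X] using 1 by (simp add: S_def[symmetric] T_def[symmetric] algebra_simps)
  qed
qed

text \<open>Compare traces. This keeps the set in \<open>D_max\<close> bounded below and its infimum
  positive, so that \<open>log 2\<close> can be applied monotonically.\<close>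

lemma loewner_scalar_ge_1:
  assumes \<tau>: "\<tau> \<in> density_ops n" and \<sigma>: "\<sigma> \<in> density_ops n"
    and le: "loewner_le \<tau> (complex_of_real l \<cdot>\<^sub>m \<sigma>)"
  shows "1 \<le> l"
proof -
  have t: "\<tau> \<in> carrier_mat n n" "mat_trace \<tau> = 1" and s: "\<sigma> \<in> carrier_mat n n" "mat_trace \<sigma> = 1"
    using \<tau> \<sigma> by (auto simp: density_ops_def)
  have M: "complex_of_real l \<cdot>\<^sub>m \<sigma> - \<tau> \<in> carrier_mat n n" by (rule minus_carrier_mat[OF t(1)])
  have "0 \<le> Re (mat_trace (adj (1\<^sub>m n) * (complex_of_real l \<cdot>\<^sub>m \<sigma> - \<tau>) * 1\<^sub>m n))"
    using psd_trace_quad[OF _ M one_carrier_mat] le by (simp add: loewner_le_def)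
  then show ?thesis
    unfolding Re_trace_quad_diff[OF s(1) t(1) one_carrier_mat] using t s by simp
qed

section \<open>One-shot bounds for the smoothed max-divergence\<close>

lemma D_max_ge:
  assumes bound: "\<And>l. loewner_le \<tau> (complex_of_real l \<cdot>\<^sub>m \<sigma>) \<Longrightarrow> 2 powr b \<le> l"
  shows "ereal b \<le> D_max \<tau> \<sigma>"
proof -
  define S where "S = {l::real. loewner_le \<tau> (complex_of_real l \<cdot>\<^sub>m \<sigma>)}"
  show ?thesis
  proof (cases "S = {}")
    case True
    then show ?thesis by (simp add: D_max_def S_def)
  next
    case False
    then have "2 powr b \<le> Inf S" by (intro cInf_greatest) (auto simp: S_def bound)
    then have "b \<le> log 2 (Inf S)"
      by (metis le_log_iff less_eq_real_def not_less one_less_numeral_iff order_less_le_trans powr_gt_zero semiring_norm(76) zero_neq_numeral)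
    then show ?thesis using False by (simp add: D_max_def S_def[symmetric] Let_def)
  qed
qed

lemma D_max_le:
  assumes \<tau>: "\<tau> \<in> density_ops n" and \<sigma>: "\<sigma> \<in> density_ops n"
    and le: "loewner_le \<tau> (complex_of_real l \<cdot>\<^sub>m \<sigma>)"
  shows "D_max \<tau> \<sigma> \<le> ereal (log 2 l)"
proof -
  define S where "S = {l::real. loewner_le \<tau> (complex_of_real l \<cdot>\<^sub>m \<sigma>)}"
  have l: "l \<in> S" using le by (simp add: S_def)
  have ge1: "1 \<le> m" if "m \<in> S" for m using loewner_scalar_ge_1[OF \<tau> \<sigma>] that by (simp add: S_def)
  then have "Inf S \<le> l" "1 \<le> Inf S"
    using l by (auto intro!: cInf_lower cInf_greatest bdd_belowI[of _ 1])
  then have "log 2 (Inf S) \<le> log 2 l" by simp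
  then show ?thesis using l by (auto simp: D_max_def S_def[symmetric] Let_def)
qed

text \<open>The support projection deletes column \<open>j\<close> of
  \<open>adj U * \<rho> * V\<close>, whose entries are \<open>e i\<close> times those of
  \<open>adj U * V\<close>; yet it leaves \<open>\<rho>\<close> unchanged.\<close>

lemma absolutely_continuous_overlap:
  assumes D\<rho>: "diagonalizes n \<rho> U e" and D\<sigma>: "diagonalizes n \<sigma> V g"
    and P: "\<rho> * mat_powr \<sigma> 0 = \<rho>" and ij: "i < n" "j < n" "g j = 0"
  shows "overlap U V i j * e i = 0"
proof -
  note U = diagonalizesD[OF D\<rho>] and V = diagonalizesD[OF D\<sigma>]
  note S = support_projection[OF D\<sigma>]
  let ?E = "rdiag n e"
  let ?I = "rdiag n (\<lambda>i. if g i = 0 then 0 else 1)"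
  define u where "u = adj U * V"
  have u: "u \<in> carrier_mat n n" using U(1) V(1) by (auto simp: u_def intro!: carrier_matI)
  note d = carrier_matD[OF U(1)] carrier_matD[OF V(1)] carrier_matD[OF u]
  have "adj U * (\<rho> * mat_powr \<sigma> 0) * V = ?E * u * ?I"
    unfolding S(5) U(4) u_def using d V(2)
    by (simp add: mult_assoc_dim unitary_cancel[OF U(1,2)] unitary_cancel[OF V(1,2)])
  moreover have "adj U * \<rho> * V = ?E * u"
    unfolding U(4) u_def using d by (simp add: mult_assoc_dim unitary_cancel[OF U(1,2)])
  ultimately have "(?E * u) $$ (i,j) = (?E * u * ?I) $$ (i,j)" using P by simp
  moreover have "(?E * u) $$ (i,j) = complex_of_real (e i) * u $$ (i,j)"
    using mat_diag_mult_left[OF u] ij by simp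
  moreover have "(?E * u * ?I) $$ (i,j) = 0"
    using ij d by (subst mat_diag_mult_right[of _ n]) auto
  ultimately show ?thesis by (auto simp: overlap_def u_def)
qed

lemma renyi_trace_overlap:
  assumes "diagonalizes n \<rho> U e" "diagonalizes n \<sigma> V g"
  shows "Re (mat_trace (mat_powr \<rho> a * mat_powr \<sigma> b)) = (\<Sum>i<n. \<Sum>j<n. overlap U V i j * (e i powr a * g j powr b))"
  unfolding mat_powr_def trace_herm_fun_mult[OF assms] by simp

text \<open>Smoothing gives \<open>1 - \<epsilon>^2 <= F^2\<close> and domination by
  \<open>l * \<sigma>\<close> gives \<open>F^2 <= l powr s * Q\<close>. Solving for
  \<open>log 2 l\<close> yields the bound, with \<open>- log 2 Q / s\<close> as the divergence of
  order \<open>1 - s\<close>.\<close>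

theorem D_max_smooth_ge_petz_renyi:
  assumes \<rho>: "\<rho> \<in> density_ops n" and \<sigma>: "\<sigma> \<in> density_ops n"
    and s: "0 < s" "s < 1" and eps: "0 < \<epsilon>" "\<epsilon> < 1"
  shows "ereal (petz_renyi (1 - s) \<rho> \<sigma> - 1 / s * log 2 (1 / (1 - \<epsilon>\<^sup>2))) \<le> D_max_smooth \<epsilon> \<rho> \<sigma>"
  unfolding D_max_smooth_def
proof (rule INF_greatest)
  have r: "psd \<rho>" "\<rho> \<in> carrier_mat n n" and s\<sigma>: "psd \<sigma>" "\<sigma> \<in> carrier_mat n n"
    using \<rho> \<sigma> by (auto simp: density_ops_def)
  fix \<tau> assume "\<tau> \<in> {\<tau> \<in> density_ops (dim_row \<rho>). sine_distance \<rho> \<tau> \<le> \<epsilon>}"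
  then have \<tau>: "\<tau> \<in> density_ops n" and sd: "sine_distance \<rho> \<tau> \<le> \<epsilon>" using r by auto
  obtain U e where D\<rho>: "diagonalizes n \<rho> U e" and e: "\<And>i. i < n \<Longrightarrow> 0 \<le> e i"
    using psd_diagonalizable[OF r] by blast
  obtain V g where D\<sigma>: "diagonalizes n \<sigma> V g" and g: "\<And>i. i < n \<Longrightarrow> 0 \<le> g i"
    using psd_diagonalizable[OF s\<sigma>] by blast
  define Q where "Q = Re (mat_trace (mat_powr \<rho> (1 - s) * mat_powr \<sigma> s))"
  have Q: "Q = (\<Sum>i<n. \<Sum>j<n. overlap U V i j * (e i powr (1 - s) * g j powr s))"
    unfolding Q_def by (rule renyi_trace_overlap[OF D\<rho> D\<sigma>])
  have Q0: "0 \<le> Q" unfolding Q by (intro sum_nonneg) auto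
  define E where "E = 1 - \<epsilon>\<^sup>2"
  have E: "0 < E" using eps by (simp add: E_def power_less_one_iff)
  have F: "E \<le> (fidelity \<rho> \<tau>)\<^sup>2"
  proof -
    have "sqrt (1 - (fidelity \<rho> \<tau>)\<^sup>2) \<le> sqrt (\<epsilon>\<^sup>2)" using sd eps by (simp add: sine_distance_def)
    then have "1 - (fidelity \<rho> \<tau>)\<^sup>2 \<le> \<epsilon>\<^sup>2" by (simp only: real_sqrt_le_iff)
    then show ?thesis by (simp add: E_def)
  qed
  show "ereal (petz_renyi (1 - s) \<rho> \<sigma> - 1 / s * log 2 (1 / (1 - \<epsilon>\<^sup>2))) \<le> D_max \<tau> \<sigma>"
  proof (rule D_max_ge)
    fix l assume le: "loewner_le \<tau> (complex_of_real l \<cdot>\<^sub>m \<sigma>)"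
    have l: "1 \<le> l" by (rule loewner_scalar_ge_1[OF \<tau> \<sigma> le])
    then have l0: "0 < l" by simp
    have "(fidelity \<rho> \<tau>)\<^sup>2 \<le> l powr s * Q"
      unfolding Q by (rule fidelity_le_powr_overlap[OF \<rho> \<tau> D\<rho> D\<sigma> _ _ le l0 s]) (use e g in auto)
    then have le': "E \<le> l powr s * Q" using F by linarith
    then have "Q \<noteq> 0" using E by auto
    then have Qp: "0 < Q" using Q0 by simp
    have "log 2 E \<le> log 2 (l powr s * Q)" using le' E by simp
    also have "\<dots> = s * log 2 l + log 2 Q" using l0 Qp by (simp add: log_mult log_powr)
    finally have "1 / s * (log 2 E - log 2 Q) \<le> 1 / s * (s * log 2 l)"
      using s by (intro mult_left_mono) auto
    then have "1 / s * (log 2 E - log 2 Q) \<le> log 2 l" using s by simp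
    moreover have "petz_renyi (1 - s) \<rho> \<sigma> - 1 / s * log 2 (1 / E) = 1 / s * (log 2 E - log 2 Q)"
      using s E by (simp add: petz_renyi_def Q_def[symmetric] log_divide algebra_simps diff_divide_distrib)
    ultimately have "petz_renyi (1 - s) \<rho> \<sigma> - 1 / s * log 2 (1 / (1 - \<epsilon>\<^sup>2)) \<le> log 2 l" by (simp add: E_def)
    then show "2 powr (petz_renyi (1 - s) \<rho> \<sigma> - 1 / s * log 2 (1 / (1 - \<epsilon>\<^sup>2))) \<le> l"
      using l0 by (simp add: le_log_iff)
  qed
qed

text \<open>The projection bound fixes the threshold \<open>l\<close>, and truncation with
  normalisation costs the factor \<open>1 / (1 - \<epsilon>^2)\<close>. The descent reaches
  \<open>l / (1 - \<epsilon>^2)\<close> only up to an arbitrarily small excess, which disappears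
  because \<open>D_max_smooth\<close> is an infimum.\<close>

theorem D_max_smooth_le_petz_renyi:
  assumes \<rho>: "\<rho> \<in> density_ops n" and \<sigma>: "\<sigma> \<in> density_ops n" and ac: "\<rho> * mat_powr \<sigma> 0 = \<rho>"
    and s: "0 < s" "s < 1" and eps: "0 < \<epsilon>" "\<epsilon> < 1"
    and Qp: "0 < Re (mat_trace (mat_powr \<rho> (1 + s) * mat_powr \<sigma> (- s)))"
  shows "D_max_smooth \<epsilon> \<rho> \<sigma> \<le> ereal (petz_renyi (1 + s) \<rho> \<sigma> + 2 / s * log 2 (1 / \<epsilon>) + log 2 (1 / (1 - \<epsilon>\<^sup>2)))"
proof -
  have r: "psd \<rho>" "\<rho> \<in> carrier_mat n n" and s\<sigma>: "psd \<sigma>" "\<sigma> \<in> carrier_mat n n"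
    using \<rho> \<sigma> by (auto simp: density_ops_def)
  obtain U e where D\<rho>: "diagonalizes n \<rho> U e" and e: "\<And>i. i < n \<Longrightarrow> 0 \<le> e i"
    using psd_diagonalizable[OF r] by blast
  obtain V g where D\<sigma>: "diagonalizes n \<sigma> V g" and g: "\<And>i. i < n \<Longrightarrow> 0 \<le> g i"
    using psd_diagonalizable[OF s\<sigma>] by blast
  note P = support_projection[OF D\<sigma>]
  define Q where "Q = Re (mat_trace (mat_powr \<rho> (1 + s) * mat_powr \<sigma> (- s)))"
  have Q: "Q = (\<Sum>i<n. \<Sum>j<n. overlap U V i j * (e i powr (1 + s) * g j powr (- s)))"
    unfolding Q_def by (rule renyi_trace_overlap[OF D\<rho> D\<sigma>])
  have Q0: "0 < Q" using Qp by (simp add: Q_def)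
  define l where "l = (Q / \<epsilon>\<^sup>2) powr (1 / s)"
  have l: "0 < l" using Q0 eps by (simp add: l_def)
  have lQ: "l powr (- s) * Q = \<epsilon>\<^sup>2"
  proof -
    have "l powr (- s) = (Q / \<epsilon>\<^sup>2) powr (-1)" using s by (simp add: l_def powr_powr)
    then show ?thesis using Q0 eps by (simp add: powr_minus)
  qed
  define E where "E = 1 - \<epsilon>\<^sup>2"
  have E: "0 < E" using eps by (simp add: E_def power_less_one_iff)
  have proj: "Re (mat_trace (N * \<rho>)) \<le> \<epsilon>\<^sup>2" if "N \<in> carrier_mat n n" "adj N = N" "N * N = N"
    "l * Re (mat_trace (N * \<sigma>)) \<le> Re (mat_trace (N * \<rho>))" for N
    using projection_prob_le_powr_overlap[OF D\<rho> D\<sigma> _ _ _ that l s]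
      absolutely_continuous_overlap[OF D\<rho> D\<sigma> ac] e g lQ unfolding Q by auto
  \<comment> \<open>A positive lower bound for the nonzero eigenvalues; inserting 1 guarantees a
    nonempty set for \<open>Min\<close>.\<close>
  define \<mu> where "\<mu> = Min (insert 1 (g ` {i. i < n \<and> g i \<noteq> 0}))"
  have fin: "finite (insert 1 (g ` {i. i < n \<and> g i \<noteq> 0}))" by simp
  have gp: "0 < g i" if "i < n" "g i \<noteq> 0" for i using g[OF that(1)] that(2) by simp
  have \<mu>: "0 < \<mu>" "\<And>i. i < n \<Longrightarrow> g i \<noteq> 0 \<Longrightarrow> \<mu> \<le> g i"
    unfolding \<mu>_def using Min_gr_iff[OF fin] gp by (auto intro!: Min_le[OF fin])
  have near: "D_max_smooth \<epsilon> \<rho> \<sigma> \<le> ereal (log 2 (l / E + q / \<mu>))" if q: "0 < q" for q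
  proof -
    have q2: "0 < q\<^sup>2" using q by simp
    obtain \<tau> where \<tau>: "\<tau> \<in> certified_states n (mat_powr \<sigma> 0) \<rho> (sqrt (1 - \<epsilon>\<^sup>2))"
      "frob2 (pos_part (\<tau> - complex_of_real (l / (1 - \<epsilon>\<^sup>2)) \<cdot>\<^sub>m \<sigma>)) < q\<^sup>2"
      by (rule certified_state_approx[OF \<rho> s\<sigma> P(1,2,3) ac eps l proj q2])
    have \<tau>d: "\<tau> \<in> density_ops n" "\<tau> * mat_powr \<sigma> 0 = \<tau>" using \<tau>(1) by (auto simp: certified_states_def)
    have "loewner_le \<tau> (complex_of_real (l / E + q / \<mu>) \<cdot>\<^sub>m \<sigma>)"
      using \<tau>(2) q \<mu> unfolding E_def by (intro loewner_le_if_pos_part_small[OF \<tau>d D\<sigma>]) auto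
    then have "D_max \<tau> \<sigma> \<le> ereal (log 2 (l / E + q / \<mu>))" by (rule D_max_le[OF \<tau>d(1) \<sigma>])
    moreover have "\<tau> \<in> {\<tau> \<in> density_ops (dim_row \<rho>). sine_distance \<rho> \<tau> \<le> \<epsilon>}"
      using \<tau>d(1) certified_states_sine_distance[OF \<tau>(1) eps] r(2) by auto
    ultimately show ?thesis unfolding D_max_smooth_def by (rule INF_lower2[rotated])
  qed
  have "D_max_smooth \<epsilon> \<rho> \<sigma> \<le> ereal (log 2 (l / E))"
  proof (rule ereal_le_epsilon2)
    fix d :: real assume d: "0 < d"
    \<comment> \<open>Chosen so that \<open>l / E + q / \<mu> = (l / E) * 2 powr d\<close>, an
      excess of exactly \<open>d\<close> in the logarithm.\<close>
    define q where "q = \<mu> * (l / E) * (2 powr d - 1)"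
    have "1 < (2::real) powr d" using d by simp
    then have q: "0 < q" using \<mu>(1) l E by (simp add: q_def)
    have "q / \<mu> = l / E * (2 powr d - 1)" using \<mu>(1) by (simp add: q_def)
    then have "l / E + q / \<mu> = (l / E) * 2 powr d" by (simp only: right_diff_distrib mult_1_right)
    moreover have "log 2 (l / E * 2 powr d) = log 2 (l / E) + log 2 (2 powr d)"
      using l E by (intro log_mult_pos) auto
    ultimately have "log 2 (l / E + q / \<mu>) = log 2 (l / E) + d" by simp
    then show "D_max_smooth \<epsilon> \<rho> \<sigma> \<le> ereal (log 2 (l / E)) + ereal d" using near[OF q] by simp
  qed
  also have "log 2 (l / E) = petz_renyi (1 + s) \<rho> \<sigma> + 2 / s * log 2 (1 / \<epsilon>) + log 2 (1 / (1 - \<epsilon>\<^sup>2))"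
  proof -
    have "log 2 (l / E) = log 2 l - log 2 E" using l E by (simp add: log_divide)
    also have "log 2 l = 1 / s * (log 2 Q - 2 * log 2 \<epsilon>)"
      using Q0 eps by (simp add: l_def log_powr log_divide log_nat_power)
    finally show ?thesis
      using s E eps by (simp add: petz_renyi_def Q_def[symmetric] E_def[symmetric] log_divide diff_divide_distrib algebra_simps)
  qed
  finally show ?thesis .
qed

section \<open>Tensor powers\<close>

lemma tensor_carrier[simp, intro]:
  "A \<in> carrier_mat n m \<Longrightarrow> B \<in> carrier_mat k l \<Longrightarrow> tensor_mat A B \<in> carrier_mat (n * k) (m * l)"
  by (auto simp: tensor_mat_def)

lemma tensor_index:
  assumes "A \<in> carrier_mat n m" "B \<in> carrier_mat k l" "i < n * k" "j < m * l"
  shows "tensor_mat A B $$ (i,j) = A $$ (i div k, j div l) * B $$ (i mod k, j mod l)"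
  using assms by (simp add: tensor_mat_def)

lemma div_mod_less:
  fixes i :: nat
  assumes "i < n * k"
  shows "i div k < n" "i mod k < k"
proof -
  have "0 < k" using assms by (cases k) auto
  then show "i div k < n" "i mod k < k" using assms by (auto simp: less_mult_imp_div_less)
qed

lemma sum_div_mod:
  fixes F :: "nat \<Rightarrow> nat \<Rightarrow> 'a :: comm_monoid_add"
  shows "(\<Sum>l<m * q. F (l div q) (l mod q)) = (\<Sum>a<m. \<Sum>b<q. F a b)"
proof (induction m)
  case (Suc m)
  have "(\<Sum>l<Suc m * q. F (l div q) (l mod q)) = (\<Sum>l<m * q + q. F (l div q) (l mod q))"
    by (simp add: add.commute)
  also have "\<dots> = (\<Sum>a<m. \<Sum>b<q. F a b) + (\<Sum>b<q. F m b)"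
    unfolding sum_lessThan_add Suc.IH by (intro arg_cong2[of _ _ _ _ "(+)"] refl sum.cong) auto
  finally show ?case by simp
qed simp

lemma tensor_mult:
  fixes A B C D :: "complex mat"
  assumes A: "A \<in> carrier_mat n m" and B: "B \<in> carrier_mat p q"
    and C: "C \<in> carrier_mat m k" and D: "D \<in> carrier_mat q r"
  shows "tensor_mat A B * tensor_mat C D = tensor_mat (A * C) (B * D)"
proof (rule eq_matI)
  fix i j assume "i < dim_row (tensor_mat (A * C) (B * D))" "j < dim_col (tensor_mat (A * C) (B * D))"
  then have i: "i < n * p" and j: "j < k * r" using assms by (auto simp: tensor_mat_def)
  note di = div_mod_less[OF i] and dj = div_mod_less[OF j]
  have "(tensor_mat A B * tensor_mat C D) $$ (i,j) =
      (\<Sum>l<m * q. tensor_mat A B $$ (i,l) * tensor_mat C D $$ (l,j))"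
    by (rule mult_index_sum[OF tensor_carrier[OF A B] tensor_carrier[OF C D] i j])
  also have "\<dots> = (\<Sum>l<m * q. (A $$ (i div p, l div q) * B $$ (i mod p, l mod q)) * (C $$ (l div q, j div r) * D $$ (l mod q, j mod r)))"
    by (intro sum.cong refl) (simp add: tensor_index[OF A B i] tensor_index[OF C D _ j])
  also have "\<dots> = (\<Sum>a<m. \<Sum>b<q. (A $$ (i div p, a) * B $$ (i mod p, b)) * (C $$ (a, j div r) * D $$ (b, j mod r)))"
    by (rule sum_div_mod)
  also have "\<dots> = (\<Sum>a<m. A $$ (i div p, a) * C $$ (a, j div r)) * (\<Sum>b<q. B $$ (i mod p, b) * D $$ (b, j mod r))"
    by (simp add: sum_product algebra_simps)
  also have "\<dots> = (A * C) $$ (i div p, j div r) * (B * D) $$ (i mod p, j mod r)"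
    using mult_index_sum[OF A C di(1) dj(1)] mult_index_sum[OF B D di(2) dj(2)] by simp
  also have "\<dots> = tensor_mat (A * C) (B * D) $$ (i,j)"
    using tensor_index[OF mult_carrier_mat[OF A C] mult_carrier_mat[OF B D] i j] by simp
  finally show "(tensor_mat A B * tensor_mat C D) $$ (i,j) = tensor_mat (A * C) (B * D) $$ (i,j)" .
qed (use assms in \<open>auto simp: tensor_mat_def\<close>)

lemma tensor_adj: "adj (tensor_mat A B) = tensor_mat (adj A) (adj B)"
proof (rule eq_matI)
  fix i j assume "i < dim_row (tensor_mat (adj A) (adj B))"
    "j < dim_col (tensor_mat (adj A) (adj B))"
  then have ij: "i < dim_col A * dim_col B" "j < dim_row A * dim_row B" by (auto simp: tensor_mat_def)
  then show "adj (tensor_mat A B) $$ (i,j) = tensor_mat (adj A) (adj B) $$ (i,j)"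
    using div_mod_less[OF ij(1)] div_mod_less[OF ij(2)] by (simp add: tensor_mat_def)
qed (auto simp: tensor_mat_def)

lemma tensor_trace:
  assumes A: "A \<in> carrier_mat n n" and B: "B \<in> carrier_mat m m"
  shows "mat_trace (tensor_mat A B) = mat_trace A * mat_trace B"
proof -
  have "mat_trace (tensor_mat A B) = (\<Sum>i<n * m. A $$ (i div m, i div m) * B $$ (i mod m, i mod m))"
    unfolding trace_sum[OF tensor_carrier[OF A B]]
    by (intro sum.cong refl) (simp add: tensor_index[OF A B])
  also have "\<dots> = (\<Sum>a<n. \<Sum>b<m. A $$ (a,a) * B $$ (b,b))" by (rule sum_div_mod)
  finally show ?thesis by (simp add: trace_sum[OF A] trace_sum[OF B] sum_product)
qed

lemma tensor_diag:
  "tensor_mat (mat_diag n f) (mat_diag m g) = mat_diag (n * m) (\<lambda>i. f (i div m) * g (i mod m))"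
proof (rule eq_matI)
  fix i j assume "i < dim_row (mat_diag (n * m) (\<lambda>i. f (i div m) * g (i mod m)))"
    "j < dim_col (mat_diag (n * m) (\<lambda>i. f (i div m) * g (i mod m)))"
  then have ij: "i < n * m" "j < n * m" by auto
  have "i = j" if "i div m = j div m" "i mod m = j mod m"
    using that by (metis div_mult_mod_eq)
  then show "tensor_mat (mat_diag n f) (mat_diag m g) $$ (i,j) =
      mat_diag (n * m) (\<lambda>i. f (i div m) * g (i mod m)) $$ (i,j)"
    using ij div_mod_less[OF ij(1)] div_mod_less[OF ij(2)]
    by (auto simp: tensor_index[OF mat_diag_dim mat_diag_dim ij])
qed (auto simp: tensor_mat_def)

lemma tensor_diagonalizes:
  assumes DA: "diagonalizes n A U e" and DB: "diagonalizes m B V g"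
  shows "diagonalizes (n * m) (tensor_mat A B) (tensor_mat U V) (\<lambda>i. e (i div m) * g (i mod m))"
proof -
  note U = diagonalizesD[OF DA] and V = diagonalizesD[OF DB]
  have "adj (tensor_mat U V) * tensor_mat U V = tensor_mat (1\<^sub>m n) (1\<^sub>m m)"
    unfolding tensor_adj using tensor_mult[OF adj_carrier[OF U(1)] adj_carrier[OF V(1)] U(1) V(1)] U(2) V(2) by simp
  also have "\<dots> = 1\<^sub>m (n * m)"
    using tensor_diag[of n "\<lambda>_. 1" m "\<lambda>_. 1"] by simp
  finally have "adj (tensor_mat U V) * tensor_mat U V = 1\<^sub>m (n * m)" .
  moreover have "tensor_mat A B = tensor_mat U V * rdiag (n * m) (\<lambda>i. e (i div m) * g (i mod m)) * adj (tensor_mat U V)"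
  proof -
    have "rdiag (n * m) (\<lambda>i. e (i div m) * g (i mod m)) =
        tensor_mat (rdiag n e) (rdiag m g)"
      unfolding tensor_diag by simp
    then show ?thesis
      unfolding tensor_adj U(4) V(4)
      using tensor_mult[OF U(1) V(1) mat_diag_dim mat_diag_dim]
        tensor_mult[OF mult_carrier_mat[OF U(1) mat_diag_dim] mult_carrier_mat[OF V(1) mat_diag_dim] adj_carrier[OF U(1)] adj_carrier[OF V(1)]]
      by simp
  qed
  ultimately show ?thesis
    unfolding diagonalizes_def using U(1) V(1) by auto
qed

lemma mat_powr_tensor:
  assumes A: "psd A" "A \<in> carrier_mat n n" and B: "psd B" "B \<in> carrier_mat m m"
  shows "mat_powr (tensor_mat A B) a = tensor_mat (mat_powr A a) (mat_powr B a)"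
    and "psd (tensor_mat A B)"
proof -
  obtain U e where DA: "diagonalizes n A U e" and e: "\<And>i. i < n \<Longrightarrow> 0 \<le> e i"
    using psd_diagonalizable[OF A] by blast
  obtain V g where DB: "diagonalizes m B V g" and g: "\<And>i. i < m \<Longrightarrow> 0 \<le> g i"
    using psd_diagonalizable[OF B] by blast
  note T = tensor_diagonalizes[OF DA DB]
  note T' = tensor_diagonalizes[OF diagonalizes_herm_fun[OF DA, of "\<lambda>x. x powr a"] diagonalizes_herm_fun[OF DB, of "\<lambda>x. x powr a"]]
  have "rdiag (n * m) (\<lambda>i. (e (i div m) * g (i mod m)) powr a) =
      rdiag (n * m) (\<lambda>i. e (i div m) powr a * g (i mod m) powr a)"
  proof (rule eq_matI)
    fix i j assume "i < dim_row (rdiag (n * m) (\<lambda>i. e (i div m) powr a * g (i mod m) powr a))"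
      "j < dim_col (rdiag (n * m) (\<lambda>i. e (i div m) powr a * g (i mod m) powr a))"
    then have ij: "i < n * m" "j < n * m" by auto
    then show "rdiag (n * m) (\<lambda>i. (e (i div m) * g (i mod m)) powr a) $$ (i,j) =
        rdiag (n * m) (\<lambda>i. e (i div m) powr a * g (i mod m) powr a) $$ (i,j)"
      using e[OF div_mod_less(1)[OF ij(2)]] g[OF div_mod_less(2)[OF ij(2)]] by (simp add: powr_mult)
  qed auto
  then show "mat_powr (tensor_mat A B) a = tensor_mat (mat_powr A a) (mat_powr B a)"
    unfolding mat_powr_def herm_fun_diagonalizes[OF T] diagonalizesD(4)[OF T'] by simp
  show "psd (tensor_mat A B)"
    unfolding diagonalizesD(4)[OF T]
  proof (rule psd_conj_diag[OF diagonalizesD(1)[OF T]])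
    fix i assume "i < n * m"
    then show "0 \<le> e (i div m) * g (i mod m)" using e g div_mod_less[of i n m] by simp
  qed
qed

lemma density_ops_one: "1\<^sub>m 1 \<in> density_ops 1" and mat_powr_one: "mat_powr (1\<^sub>m 1) a = 1\<^sub>m 1"
proof -
  have D: "diagonalizes 1 (1\<^sub>m 1) (1\<^sub>m 1) (\<lambda>_. 1)"
    unfolding diagonalizes_def by simp
  show "mat_powr (1\<^sub>m 1) a = 1\<^sub>m 1"
    unfolding mat_powr_def herm_fun_diagonalizes[OF D] by simp
  have "psd (1\<^sub>m 1 * adj (1\<^sub>m 1))" by (rule psd_gram[of _ 1 1]) simp
  then show "1\<^sub>m 1 \<in> density_ops 1" by (simp add: density_ops_def mat_trace_def)
qed

lemma tensor_pow_density:
  assumes "\<rho> \<in> density_ops d"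
  shows "tensor_pow \<rho> n \<in> density_ops (d ^ n)"
proof (induction n)
  case 0
  then show ?case using density_ops_one by simp
next
  case (Suc n)
  have r: "psd \<rho>" "\<rho> \<in> carrier_mat d d" "mat_trace \<rho> = 1" using assms by (auto simp: density_ops_def)
  have t: "psd (tensor_pow \<rho> n)" "tensor_pow \<rho> n \<in> carrier_mat (d ^ n) (d ^ n)" "mat_trace (tensor_pow \<rho> n) = 1"
    using Suc by (auto simp: density_ops_def)
  show ?case
    using mat_powr_tensor(2)[OF r(1,2) t(1,2)] tensor_carrier[OF r(2) t(2)] tensor_trace[OF r(2) t(2)] r(3) t(3)
    by (simp add: density_ops_def)
qed

lemma mat_powr_carrier:
  assumes "psd A" "A \<in> carrier_mat n n"
  shows "mat_powr A a \<in> carrier_mat n n"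
proof -
  obtain U e where D: "diagonalizes n A U e" using psd_diagonalizable[OF assms] by blast
  show ?thesis unfolding mat_powr_def by (rule diagonalizesD(5)[OF diagonalizes_herm_fun[OF D]])
qed

lemma tensor_pow_support:
  assumes \<rho>: "\<rho> \<in> density_ops d" and \<sigma>: "\<sigma> \<in> density_ops d" and ac: "\<rho> * mat_powr \<sigma> 0 = \<rho>"
  shows "tensor_pow \<rho> n * mat_powr (tensor_pow \<sigma> n) 0 = tensor_pow \<rho> n"
proof (induction n)
  case 0
  then show ?case by (simp add: mat_powr_one[simplified])
next
  case (Suc n)
  have r: "\<rho> \<in> carrier_mat d d" "tensor_pow \<rho> n \<in> carrier_mat (d ^ n) (d ^ n)"
    using \<rho> tensor_pow_density[OF \<rho>, of n] by (auto simp: density_ops_def)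
  have s: "psd \<sigma>" "\<sigma> \<in> carrier_mat d d" and t: "psd (tensor_pow \<sigma> n)" "tensor_pow \<sigma> n \<in> carrier_mat (d ^ n) (d ^ n)"
    using \<sigma> tensor_pow_density[OF \<sigma>, of n] by (auto simp: density_ops_def)
  show ?case
    using tensor_mult[OF r mat_powr_carrier[OF s] mat_powr_carrier[OF t]] ac Suc
    by (simp add: mat_powr_tensor(1)[OF s t])
qed

lemma tensor_pow_trace_powr:
  assumes \<rho>: "\<rho> \<in> density_ops d" and \<sigma>: "\<sigma> \<in> density_ops d"
  shows "mat_trace (mat_powr (tensor_pow \<rho> n) a * mat_powr (tensor_pow \<sigma> n) b) = mat_trace (mat_powr \<rho> a * mat_powr \<sigma> b) ^ n"
proof (induction n)
  case 0
  then show ?case by (simp add: mat_powr_one[simplified] mat_trace_def)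
next
  case (Suc n)
  have r: "psd \<rho>" "\<rho> \<in> carrier_mat d d" and u: "psd (tensor_pow \<rho> n)" "tensor_pow \<rho> n \<in> carrier_mat (d ^ n) (d ^ n)"
    using \<rho> tensor_pow_density[OF \<rho>, of n] by (auto simp: density_ops_def)
  have s: "psd \<sigma>" "\<sigma> \<in> carrier_mat d d" and t: "psd (tensor_pow \<sigma> n)" "tensor_pow \<sigma> n \<in> carrier_mat (d ^ n) (d ^ n)"
    using \<sigma> tensor_pow_density[OF \<sigma>, of n] by (auto simp: density_ops_def)
  note c = mat_powr_carrier[OF r] mat_powr_carrier[OF u] mat_powr_carrier[OF s] mat_powr_carrier[OF t]
  show ?case
    using Suc by (simp add: mat_powr_tensor(1)[OF s t] mat_powr_tensor(1)[OF r u] tensor_mult[OF c]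
        tensor_trace[OF mult_carrier_mat[OF c(1,3)] mult_carrier_mat[OF c(2,4)]])
qed

text \<open>For \<open>w\<close> in the kernel of \<open>\<sigma>\<close>, the vector
  \<open>\<rho> (\<rho> w)\<close> lies in the support of \<open>\<rho>\<close>, hence in that of
  \<open>\<sigma>\<close>, and is orthogonal to \<open>w\<close>. So \<open>\<rho> w\<close> has
  norm zero, and \<open>\<rho>\<close> annihilates every eigenvector removed by the support
  projection.\<close>

lemma supp_subset_imp_mult_support:
  assumes \<rho>: "\<rho> \<in> density_ops d" and \<sigma>: "\<sigma> \<in> density_ops d" and sub: "supp \<rho> \<subseteq> supp \<sigma>"
  shows "\<rho> * mat_powr \<sigma> 0 = \<rho>"
proof -
  have r: "psd \<rho>" "\<rho> \<in> carrier_mat d d" and s: "psd \<sigma>" "\<sigma> \<in> carrier_mat d d"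
    using \<rho> \<sigma> by (auto simp: density_ops_def)
  note hr = psdD(1)[OF r]
  have sym: "(\<rho> *\<^sub>v x) \<bullet>c w = x \<bullet>c (\<rho> *\<^sub>v w)" if x: "x \<in> carrier_vec d" and w: "w \<in> carrier_vec d" for x w
  proof -
    have h: "cnj (\<rho> $$ (i,j)) = \<rho> $$ (j,i)" if "i < d" "j < d" for i j
      using hr r(2) that by (metis adj_index carrier_matD)
    have "(\<rho> *\<^sub>v x) \<bullet>c w = (\<Sum>i<d. \<Sum>j<d. \<rho> $$ (i,j) * x $ j * cnj (w $ i))"
      using r(2) x w by (simp add: scalar_prod_def atLeast0LessThan sum_distrib_right)
    also have "\<dots> = (\<Sum>j<d. \<Sum>i<d. \<rho> $$ (i,j) * x $ j * cnj (w $ i))" by (rule sum.swap)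
    also have "\<dots> = x \<bullet>c (\<rho> *\<^sub>v w)"
      using r(2) x w by (simp add: scalar_prod_def atLeast0LessThan sum_distrib_left h algebra_simps)
    finally show ?thesis .
  qed
  have ker: "\<rho> *\<^sub>v w = 0\<^sub>v d" if w: "w \<in> carrier_vec d" and \<sigma>w: "\<sigma> *\<^sub>v w = 0\<^sub>v d" for w
  proof -
    have wk: "w \<in> mat_kernel \<sigma>" using w \<sigma>w s(2) by (auto simp: mat_kernel_def)
    define v where "v = \<rho> *\<^sub>v w"
    have v: "v \<in> carrier_vec d" unfolding v_def using r(2) w by simp
    have "\<rho> *\<^sub>v v \<in> supp \<rho>"
      unfolding supp_def
    proof (intro CollectI conjI ballI)
      show "\<rho> *\<^sub>v v \<in> carrier_vec (dim_col \<rho>)" using r(2) v by simp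
      fix u assume "u \<in> mat_kernel \<rho>"
      then have u: "u \<in> carrier_vec d" "\<rho> *\<^sub>v u = 0\<^sub>v d" using r(2) by (auto simp: mat_kernel_def)
      have "(\<rho> *\<^sub>v v) \<bullet>c u = v \<bullet>c (\<rho> *\<^sub>v u)" by (rule sym[OF v u(1)])
      then show "(\<rho> *\<^sub>v v) \<bullet>c u = 0" using u v by simp
    qed
    then have "\<rho> *\<^sub>v v \<in> supp \<sigma>" using sub by blast
    then have "(\<rho> *\<^sub>v v) \<bullet>c w = 0" using wk by (auto simp: supp_def)
    then have "v \<bullet>c v = 0" unfolding sym[OF v w] v_def[symmetric] .
    then show ?thesis using conjugate_square_eq_0_vec[OF v] by (simp add: v_def)
  qed
  obtain V g where D: "diagonalizes d \<sigma> V g" and g: "\<And>i. i < d \<Longrightarrow> 0 \<le> g i"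
    using psd_diagonalizable[OF s] by blast
  note V = diagonalizesD[OF D]
  note P = support_projection[OF D]
  let ?I = "rdiag d (\<lambda>i. if g i = 0 then 0 else 1)"
  note dd = carrier_matD[OF V(1)] carrier_matD[OF r(2)] carrier_matD[OF s(2)]
  have \<sigma>V: "\<sigma> * V = V * rdiag d (\<lambda>i. g i)"
    by (subst V(4)) (use dd V(2) in \<open>simp add: mult_assoc_dim\<close>)
  have rV: "\<rho> * V \<in> carrier_mat d d" by (rule mult_carrier_mat[OF r(2) V(1)])
  have "\<rho> * V * ?I = \<rho> * V"
  proof (rule eq_matI)
    fix i j assume "i < dim_row (\<rho> * V)" "j < dim_col (\<rho> * V)"
    then have ij: "i < d" "j < d" using dd by auto
    have eq: "(\<rho> * V * ?I) $$ (i,j) = (\<rho> * V) $$ (i,j) * complex_of_real (if g j = 0 then 0 else 1)"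
      unfolding mat_diag_mult_right[OF rV] using ij by simp
    show "(\<rho> * V * ?I) $$ (i,j) = (\<rho> * V) $$ (i,j)"
    proof (cases "g j = 0")
      case True
      have "\<sigma> *\<^sub>v col V j = col (\<sigma> * V) j" by (rule col_mult2[OF s(2) V(1) ij(2), symmetric])
      also have "\<dots> = 0\<^sub>v d"
        unfolding \<sigma>V mat_diag_mult_right[OF V(1)] using ij True by (intro eq_vecI) auto
      finally have "\<rho> *\<^sub>v col V j = 0\<^sub>v d" using V(1) ij by (intro ker) auto
      then have "col (\<rho> * V) j = 0\<^sub>v d" using col_mult2[OF r(2) V(1) ij(2)] by simp
      then have "(\<rho> * V) $$ (i,j) = 0"
        using rV ij by (metis carrier_matD index_col index_zero_vec(1))
      then show ?thesis unfolding eq by simp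
    next
      case False
      then show ?thesis unfolding eq by simp
    qed
  qed (use dd in auto)
  then have "\<rho> * V * ?I * adj V = \<rho> * V * adj V" by simp
  then show ?thesis
    unfolding P(5) using dd V(3) by (simp add: mult_assoc_dim)
qed

section \<open>Continuity of the R\'enyi divergence at order one\<close>

lemma sinh_le_mult_cosh:
  fixes y :: real
  assumes "0 \<le> y"
  shows "sinh y \<le> y * cosh y"
proof -
  have "(\<lambda>y. y * cosh y - sinh y) 0 \<le> (\<lambda>y. y * cosh y - sinh y) y"
  proof (rule DERIV_nonneg_imp_nondecreasing[OF assms])
    fix x :: real assume "0 \<le> x"
    then show "\<exists>d. ((\<lambda>y. y * cosh y - sinh y) has_real_derivative d) (at x) \<and> 0 \<le> d"
      by (intro exI[of _ "x * sinh x"] conjI) (auto intro!: derivative_eq_intros)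
  qed
  then show ?thesis by simp
qed

lemma cosh_le_exp_square:
  fixes y :: real
  assumes "0 \<le> y"
  shows "cosh y \<le> exp (y\<^sup>2 / 2)"
proof -
  have "(\<lambda>y. y\<^sup>2 / 2 - ln (cosh y)) 0 \<le> (\<lambda>y. y\<^sup>2 / 2 - ln (cosh y)) y"
  proof (rule DERIV_nonneg_imp_nondecreasing[OF assms])
    fix x :: real assume x: "0 \<le> x"
    have "0 \<le> x - sinh x / cosh x"
      using sinh_le_mult_cosh[OF x] by (simp add: divide_le_eq)
    moreover have "((\<lambda>y. y\<^sup>2 / 2 - ln (cosh y)) has_real_derivative x - sinh x / cosh x) (at x)"
      by (auto intro!: derivative_eq_intros)
    ultimately show "\<exists>d. ((\<lambda>y. y\<^sup>2 / 2 - ln (cosh y)) has_real_derivative d) (at x) \<and> 0 \<le> d" by blast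
  qed
  then have "ln (cosh y) \<le> y\<^sup>2 / 2" by simp
  then show ?thesis by (metis cosh_real_pos exp_le_cancel_iff exp_ln)
qed

text \<open>Meant for orders above one, where a pure exponential leaves exactly \<open>y^2\<close>
  after taking logarithms. It follows from \<open>2 t <= 1 + t^2\<close> at
  \<open>t = exp (y^2 / 2)\<close>.\<close>

lemma two_cosh_le_exp_square:
  fixes y :: real
  assumes "0 \<le> y"
  shows "2 * cosh y \<le> 1 + exp (y\<^sup>2)"
proof -
  have "exp (y\<^sup>2) = (exp (y\<^sup>2 / 2))\<^sup>2" by (simp flip: exp_double)
  moreover have "0 \<le> (exp (y\<^sup>2 / 2) - 1)\<^sup>2" by simp
  ultimately show ?thesis using cosh_le_exp_square[OF assms] by (simp add: power2_diff)
qed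

text \<open>Meant for orders below one. By half angles the left side is
  \<open>4 * (sinh (y / 2))^2\<close>, and the square of \<open>cosh (y / 2)\<close> is the mean of
  1 and \<open>cosh y\<close>.\<close>

lemma two_cosh_le_square_mult:
  fixes y :: real
  assumes "0 \<le> y"
  shows "2 * cosh y - 2 \<le> y\<^sup>2 * cosh y"
proof -
  define z where "z = y / 2"
  have z: "0 \<le> z" "y = 2 * z" using assms by (auto simp: z_def)
  have c: "cosh y = 1 + 2 * (sinh z)\<^sup>2" "cosh y = 2 * (cosh z)\<^sup>2 - 1"
    unfolding z(2) cosh_double by (simp_all add: cosh_square_eq)
  have "(sinh z)\<^sup>2 \<le> (z * cosh z)\<^sup>2"
    using sinh_le_mult_cosh[OF z(1)] z(1) by (intro power_mono) auto
  then have "2 * cosh y - 2 \<le> y\<^sup>2 * (cosh z)\<^sup>2"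
    using c(1) z(2) by (simp add: power_mult_distrib)
  also have "\<dots> \<le> y\<^sup>2 * cosh y"
    using c(2) cosh_real_ge_1[of y] by (intro mult_left_mono) auto
  finally show ?thesis .
qed

text \<open>The logarithm of \<open>(1 + u) / (1 - u)\<close> is convex on this interval, vanishes
  at 0 and equals \<open>ln 3\<close> at \<open>1/2\<close>, so it lies below the chord of slope
  \<open>ln 9\<close>.\<close>

lemma one_plus_le_nine_powr:
  fixes u :: real
  assumes u: "0 \<le> u" "u \<le> 1 / 2"
  shows "1 + u \<le> (1 - u) * 9 powr u"
proof -
  define f where "f u = ln (1 + u) - ln (1 - u)" for u :: real
  have "convex_on {0..1/2} f"
  proof (rule f''_ge0_imp_convex)
    fix x :: real assume x: "x \<in> {0..1/2}"
    show "(f has_real_derivative 1 / (1 + x) + 1 / (1 - x)) (at x)"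
      unfolding f_def using x by (auto intro!: derivative_eq_intros)
    show "((\<lambda>x. 1 / (1 + x) + 1 / (1 - x)) has_real_derivative 1 / (1 - x)\<^sup>2 - 1 / (1 + x)\<^sup>2) (at x)"
      using x by (auto intro!: derivative_eq_intros simp: power2_eq_square)
    have "(1 - x)\<^sup>2 \<le> (1 + x)\<^sup>2" using x by (intro power_mono) auto
    then show "0 \<le> 1 / (1 - x)\<^sup>2 - 1 / (1 + x)\<^sup>2"
      using x by (simp add: frac_le)
  qed simp
  then have "f ((1 - 2 * u) *\<^sub>R 0 + (2 * u) *\<^sub>R (1 / 2)) \<le> (1 - 2 * u) * f 0 + (2 * u) * f (1 / 2)"
    using u by (intro convex_onD) auto
  then have "f u \<le> 2 * u * f (1 / 2)" by (simp add: f_def)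
  also have "f (1 / 2) = ln 3"
    using ln_div[of "3/2" "1/2 :: real"] by (simp add: f_def)
  also have "2 * u * ln 3 = u * ln (9 :: real)"
    using ln_realpow[of "3 :: real" 2] by simp
  finally have "ln (1 + u) \<le> ln (1 - u) + u * ln 9" by (simp add: f_def)
  also have "\<dots> = ln ((1 - u) * 9 powr u)" using u by (simp add: ln_mult ln_powr)
  finally show ?thesis using u by simp
qed

text \<open>The second derivative has the sign of \<open>(1 - u) * z powr (2 * u) - (1 + u)\<close>.
  At \<open>u = 1/2\<close> this changes sign at \<open>z = 3\<close>, and
  \<open>one_plus_le_nine_powr\<close> says that 3 suffices for smaller \<open>u\<close> as
  well.\<close>

lemma convex_on_neg_two_powr:
  fixes u :: real
  assumes u: "0 < u" "u \<le> 1 / 2"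
  shows "convex_on {3..} (\<lambda>z. - (z powr u + z powr (- u)))"
proof (rule f''_ge0_imp_convex)
  fix x :: real assume "x \<in> {3..}"
  then have x: "3 \<le> x" by simp
  show "((\<lambda>z. - (z powr u + z powr (- u))) has_real_derivative - (u * x powr (u - 1)) + u * x powr (- u - 1)) (at x)"
    using x by (auto intro!: derivative_eq_intros)
  show "((\<lambda>x. - (u * x powr (u - 1)) + u * x powr (- u - 1)) has_real_derivative
      u * (1 - u) * x powr (u - 2) - u * (1 + u) * x powr (- u - 2)) (at x)"
    using x by (auto intro!: derivative_eq_intros simp: algebra_simps)
  have "(1 + u) \<le> (1 - u) * 9 powr u" using one_plus_le_nine_powr u by simp
  also have "(9 :: real) powr u = 3 powr (2 * u)"
    using powr_powr[of 3 2 u] by simp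
  also have "(1 - u) * 3 powr (2 * u) \<le> (1 - u) * x powr (2 * u)"
    using x u by (intro mult_left_mono powr_mono2) auto
  finally have "u * x powr (- u - 2) * (1 + u) \<le> u * x powr (- u - 2) * ((1 - u) * x powr (2 * u))"
    using u by (intro mult_left_mono) auto
  also have "\<dots> = u * (1 - u) * (x powr (- u - 2) * x powr (2 * u))" by (simp add: algebra_simps)
  also have "x powr (- u - 2) * x powr (2 * u) = x powr (u - 2)"
    by (simp flip: powr_add)
  finally show "0 \<le> u * (1 - u) * x powr (u - 2) - u * (1 + u) * x powr (- u - 2)" by (simp add: algebra_simps)
qed simp

lemma two_powr_mono:
  fixes u z z' :: real
  assumes u: "0 < u" and z: "1 \<le> z" "z \<le> z'"
  shows "z powr u + z powr (- u) \<le> z' powr u + z' powr (- u)"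
proof -
  define a where "a = z powr u"
  define b where "b = z' powr u"
  have a: "1 \<le> a" unfolding a_def using u z by (simp add: ge_one_powr_ge_zero)
  have ab: "a \<le> b" unfolding a_def b_def using u z by (intro powr_mono2) auto
  have "1 \<le> a * b" using a ab mult_mono[of 1 a 1 b] by simp
  then have "0 \<le> (b - a) * (1 - 1 / (a * b))" using ab by (intro mult_nonneg_nonneg) auto
  also have "\<dots> = b + 1 / b - (a + 1 / a)" using a ab by (simp add: field_simps)
  finally show ?thesis by (simp add: a_def b_def powr_minus_divide)
qed

text \<open>Replacing \<open>X\<close> by \<open>1 / X\<close> changes neither side, so
  \<open>X >= 1\<close> may be assumed and monotonicity applies. The shift brings the argument into
  the range where \<open>convex_on_neg_two_powr\<close> holds.\<close>

lemma two_powr_le_shift: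
  fixes u X :: real
  assumes u: "0 < u" and X: "0 < X"
  shows "X powr u + X powr (- u) \<le> (X + 1 / X + 1) powr u + (X + 1 / X + 1) powr (- u)"
proof (cases "1 \<le> X")
  case True
  then show ?thesis using u X by (intro two_powr_mono) auto
next
  case False
  then have "(1 / X) powr u + (1 / X) powr (- u) \<le> (X + 1 / X + 1) powr u + (X + 1 / X + 1) powr (- u)"
    using u X by (intro two_powr_mono) auto
  moreover have "(1 / X) powr u = X powr (- u)" "(1 / X) powr (- u) = X powr u"
    using X by (simp_all add: powr_divide powr_minus_divide)
  ultimately show ?thesis by simp
qed

lemma two_powr_eq_cosh: "0 < W \<Longrightarrow> W powr u + W powr (- u) = 2 * cosh (u * ln W)" for W :: real
  by (simp add: cosh_def powr_def)

lemma three_le_shift: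
  fixes X :: real
  assumes "0 < X"
  shows "3 \<le> X + 1 / X + 1"
proof -
  have "0 \<le> (X - 1)\<^sup>2 / X" using assms by simp
  also have "\<dots> = X + 1 / X - 2" using assms by (simp add: power2_eq_square field_simps)
  finally show ?thesis by simp
qed

text \<open>Here \<open>x\<close> is a likelihood ratio under the distribution \<open>p\<close>; the sum over \<open>p / x\<close> is the mass that the
  second distribution puts on the support of \<open>p\<close>.\<close>

locale likelihood_ratio =
  fixes S :: "'k set" and p x :: "'k \<Rightarrow> real" and \<gamma> :: real
  assumes fin: "finite S" and p: "\<And>k. k \<in> S \<Longrightarrow> 0 < p k" and p1: "sum p S = 1"
    and x: "\<And>k. k \<in> S \<Longrightarrow> 0 < x k" and q1: "(\<Sum>k\<in>S. p k / x k) \<le> 1" and \<gamma>: "0 < \<gamma>"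
begin

definition mgf :: "real \<Rightarrow> real" where
  "mgf s = (\<Sum>k\<in>S. p k * x k powr s)"

text \<open>For the ratio of two states this is the argument of the logarithm in
  \<open>c_gamma\<close>.\<close>

definition W :: real where
  "W = mgf \<gamma> + mgf (- \<gamma>) + 1"

definition dvg :: real where
  "dvg = (\<Sum>k\<in>S. p k * ln (x k))"

lemma S_nonempty: "S \<noteq> {}"
  using p1 by auto

lemma x_nonzero: "k \<in> S \<Longrightarrow> x k \<noteq> 0"
  using x by force

lemma mgf_pos: "0 < mgf s"
  unfolding mgf_def using fin S_nonempty p x_nonzero by (intro sum_pos mult_pos_pos) auto

lemma W_eq: "W = (\<Sum>k\<in>S. p k * (x k powr \<gamma> + 1 / x k powr \<gamma> + 1))"
proof -
  have "(\<Sum>k\<in>S. p k * (x k powr \<gamma> + 1 / x k powr \<gamma> + 1)) =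
      (\<Sum>k\<in>S. p k * x k powr \<gamma> + p k * x k powr (- \<gamma>) + p k)"
    by (intro sum.cong refl) (simp add: algebra_simps powr_minus_divide)
  then show ?thesis by (simp add: W_def mgf_def sum.distrib p1)
qed

lemma W_ge_3: "3 \<le> W"
proof -
  have "(\<Sum>k\<in>S. p k * 3) \<le> W"
    unfolding W_eq using p x_nonzero by (intro sum_mono mult_left_mono three_le_shift) (auto intro: less_imp_le)
  then show ?thesis by (simp add: p1 flip: sum_distrib_right)
qed

text \<open>Gibbs' inequality: \<open>ln x >= 1 - 1 / x\<close>, averaged over \<open>p\<close>; the
  second distribution has mass at most 1 on \<open>S\<close>.\<close>

lemma dvg_nonneg: "0 \<le> dvg"
proof -
  have "p k - p k / x k \<le> p k * ln (x k)" if "k \<in> S" for k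
  proof -
    have "ln (1 / x k) \<le> 1 / x k - 1" using x[OF that] by (intro ln_le_minus_one) auto
    then have "1 - 1 / x k \<le> ln (x k)" using x[OF that] by (simp add: ln_div)
    then have "p k * (1 - 1 / x k) \<le> p k * ln (x k)" using p[OF that] by (intro mult_left_mono) auto
    then show ?thesis by (simp add: algebra_simps)
  qed
  then have "(\<Sum>k\<in>S. p k - p k / x k) \<le> dvg" unfolding dvg_def by (rule sum_mono)
  then show ?thesis using q1 p1 by (simp add: sum_subtractf)
qed

text \<open>Jensen's inequality for the concave function \<open>z powr u + z powr (- u)\<close> at
  the shifted ratios \<open>Y k\<close>, whose mean under \<open>p\<close> is
  \<open>W\<close>.\<close>

lemma sum_two_powr_le:
  assumes u: "0 < u" "u \<le> 1 / 2"
  shows "(\<Sum>k\<in>S. p k * (x k powr (u * \<gamma>) + x k powr (- (u * \<gamma>)))) \<le> 2 * cosh (u * ln W)"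
proof -
  define Y where "Y k = x k powr \<gamma> + 1 / x k powr \<gamma> + 1" for k
  have Y3: "3 \<le> Y k" if "k \<in> S" for k unfolding Y_def using x[OF that] by (intro three_le_shift) auto
  have "(\<Sum>k\<in>S. p k * (x k powr (u * \<gamma>) + x k powr (- (u * \<gamma>)))) \<le> (\<Sum>k\<in>S. p k * (Y k powr u + Y k powr (- u)))"
  proof (intro sum_mono mult_left_mono)
    fix k assume k: "k \<in> S"
    show "x k powr (u * \<gamma>) + x k powr (- (u * \<gamma>)) \<le> Y k powr u + Y k powr (- u)"
      using two_powr_le_shift[OF u(1), of "x k powr \<gamma>"] x[OF k] by (simp add: Y_def powr_powr mult.commute)
    show "0 \<le> p k" using p[OF k] by simp
  qed
  also have "\<dots> \<le> W powr u + W powr (- u)"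
  proof -
    have "- ((\<Sum>k\<in>S. p k *\<^sub>R Y k) powr u + (\<Sum>k\<in>S. p k *\<^sub>R Y k) powr (- u)) \<le>
        (\<Sum>k\<in>S. p k * (- (Y k powr u + Y k powr (- u))))"
      using Y3 p by (intro convex_on_sum[OF fin S_nonempty convex_on_neg_two_powr[OF u] p1]) (auto intro: less_imp_le)
    moreover have "(\<Sum>k\<in>S. p k *\<^sub>R Y k) = W" by (simp add: W_eq Y_def)
    ultimately show ?thesis by (simp only: mult_minus_right sum_negf neg_le_iff_le)
  qed
  also have "\<dots> = 2 * cosh (u * ln W)" using W_ge_3 by (intro two_powr_eq_cosh) simp
  finally show ?thesis .
qed

text \<open>Adding the nonnegative quantity \<open>x powr (- s) - 1 + s * ln x\<close> to
  \<open>x powr s\<close> isolates the linear term \<open>s * ln x\<close> and leaves a function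
  symmetric in \<open>s\<close>. One Jensen estimate therefore serves both signs of
  \<open>s\<close>.\<close>

lemma mgf_le:
  assumes s: "\<bar>s\<bar> = u * \<gamma>" and u: "0 < u" "u \<le> 1 / 2"
  shows "mgf s \<le> s * dvg + (2 * cosh (u * ln W) - 1)"
proof -
  have "mgf s \<le> (\<Sum>k\<in>S. p k * (s * ln (x k)) + p k * (x k powr (u * \<gamma>) + x k powr (- (u * \<gamma>))) - p k)"
    unfolding mgf_def
  proof (rule sum_mono)
    fix k assume k: "k \<in> S"
    have e: "x k powr r = exp (r * ln (x k))" for r using x[OF k] by (simp add: powr_def)
    have "x k powr (u * \<gamma>) + x k powr (- (u * \<gamma>)) = x k powr s + x k powr (- s)"
    proof -
      have "s = u * \<gamma> \<or> s = - (u * \<gamma>)" using s by linarith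
      then show ?thesis by auto
    qed
    moreover have "1 - s * ln (x k) \<le> x k powr (- s)"
      unfolding e using exp_ge_add_one_self[of "- s * ln (x k)"] by simp
    ultimately have "x k powr s \<le> s * ln (x k) + (x k powr (u * \<gamma>) + x k powr (- (u * \<gamma>))) - 1" by simp
    then have "p k * x k powr s \<le> p k * (s * ln (x k) + (x k powr (u * \<gamma>) + x k powr (- (u * \<gamma>))) - 1)"
      using p[OF k] by (intro mult_left_mono) auto
    then show "p k * x k powr s \<le> p k * (s * ln (x k)) + p k * (x k powr (u * \<gamma>) + x k powr (- (u * \<gamma>))) - p k"
      by (simp add: algebra_simps)
  qed
  also have "\<dots> = s * dvg + (\<Sum>k\<in>S. p k * (x k powr (u * \<gamma>) + x k powr (- (u * \<gamma>)))) - 1"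
    by (simp add: sum.distrib sum_subtractf p1 dvg_def sum_distrib_left algebra_simps)
  also have "\<dots> \<le> s * dvg + (2 * cosh (u * ln W) - 1)"
    using sum_two_powr_le[OF u] by simp
  finally show ?thesis .
qed

definition c :: real where
  "c = 1 / \<gamma> * log 2 W"

lemma gamma_c: "\<gamma> * c = log 2 W"
  using \<gamma> by (simp add: c_def)

lemma log_3_le: "log 2 3 \<le> \<gamma> * c"
  unfolding gamma_c using W_ge_3 by simp

lemma c_pos: "0 < c"
proof -
  have "0 < log 2 (3 :: real)" by simp
  then have "0 < \<gamma> * c" using log_3_le by linarith
  then show ?thesis using \<gamma> by (simp add: zero_less_mult_iff)
qed

lemma exponent_eq:
  assumes "s = u * \<gamma>"
  shows "u * ln W = s * c * ln 2"
proof -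
  have "s * c = u * log 2 W" using assms gamma_c by (simp add: mult.assoc)
  then show ?thesis by (simp add: log_def)
qed

text \<open>Since \<open>s * dvg >= 0\<close>, the sum \<open>s * dvg + exp (y^2)\<close> is at most
  \<open>exp (s * dvg + y^2)\<close>; the logarithm then adds only \<open>y^2\<close> to the linear
  term.\<close>

lemma log_mgf_le:
  assumes s: "0 < s" "s \<le> \<gamma> / 2"
  shows "1 / s * log 2 (mgf s) \<le> dvg / ln 2 + s * c\<^sup>2 * ln 2"
proof -
  define u where "u = s / \<gamma>"
  have u: "0 < u" "u \<le> 1 / 2" "s = u * \<gamma>" using s \<gamma> by (auto simp: u_def field_simps)
  define y where "y = u * ln W"
  have y: "y = s * c * ln 2" unfolding y_def by (rule exponent_eq[OF u(3)])
  have y0: "0 \<le> y" using y s c_pos by simp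
  have sd: "0 \<le> s * dvg" using s dvg_nonneg by simp
  have "mgf s \<le> s * dvg + (2 * cosh y - 1)"
    unfolding y_def using u \<gamma> by (intro mgf_le) (auto simp: abs_mult)
  also have "\<dots> \<le> s * dvg + exp (y\<^sup>2)" using two_cosh_le_exp_square[OF y0] by simp
  also have "\<dots> \<le> exp (s * dvg) * exp (y\<^sup>2)"
  proof -
    have "1 * (s * dvg) \<le> exp (y\<^sup>2) * (s * dvg)" using sd by (intro mult_right_mono) auto
    moreover have "exp (y\<^sup>2) * (1 + s * dvg) \<le> exp (y\<^sup>2) * exp (s * dvg)"
      by (intro mult_left_mono exp_ge_add_one_self) auto
    ultimately show ?thesis by (simp add: algebra_simps)
  qed
  finally have "ln (mgf s) \<le> ln (exp (s * dvg + y\<^sup>2))"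
    using mgf_pos[of s] by (simp add: exp_add)
  then have "ln (mgf s) \<le> s * dvg + y\<^sup>2" by simp
  then have "1 / (s * ln 2) * ln (mgf s) \<le> 1 / (s * ln 2) * (s * dvg + y\<^sup>2)"
    using s by (intro mult_left_mono) auto
  also have "\<dots> = dvg / ln 2 + s * c\<^sup>2 * ln 2"
    unfolding y using s by (simp add: power2_eq_square field_simps)
  finally show ?thesis by (simp add: log_def)
qed

text \<open>The linear term is now \<open>- s * dvg\<close>, which cannot be absorbed as in
  \<open>log_mgf_le\<close>. The inequality \<open>1 + z <= exp z\<close> is used on the whole
  expression instead, and the bound on \<open>cosh y\<close> leaves a factor
  \<open>cosh\<close>.\<close>

lemma log_mgf_minus_ge:
  assumes s: "0 < s" "s \<le> \<gamma> / 2"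
  shows "dvg / ln 2 - s * c\<^sup>2 * ln 2 * cosh (s * c * ln 2) \<le> - 1 / s * log 2 (mgf (- s))"
proof -
  define u where "u = s / \<gamma>"
  have u: "0 < u" "u \<le> 1 / 2" "s = u * \<gamma>" using s \<gamma> by (auto simp: u_def field_simps)
  define y where "y = u * ln W"
  have y: "y = s * c * ln 2" unfolding y_def by (rule exponent_eq[OF u(3)])
  have y0: "0 \<le> y" using y s c_pos by simp
  have "mgf (- s) \<le> (- s) * dvg + (2 * cosh y - 1)"
    unfolding y_def using u s \<gamma> by (intro mgf_le) (auto simp: abs_mult)
  also have "\<dots> \<le> 1 + (- s * dvg + y\<^sup>2 * cosh y)" using two_cosh_le_square_mult[OF y0] by simp
  also have "\<dots> \<le> exp (- s * dvg + y\<^sup>2 * cosh y)" by (rule exp_ge_add_one_self)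
  finally have "exp (ln (mgf (- s))) \<le> exp (- s * dvg + y\<^sup>2 * cosh y)"
    using mgf_pos[of "- s"] by simp
  then have "ln (mgf (- s)) \<le> - s * dvg + y\<^sup>2 * cosh y" by (simp only: exp_le_cancel_iff)
  then have "1 / (s * ln 2) * ln (mgf (- s)) \<le> 1 / (s * ln 2) * (- s * dvg + y\<^sup>2 * cosh y)"
    using s by (intro mult_left_mono) auto
  also have "\<dots> = - (dvg / ln 2 - s * c\<^sup>2 * ln 2 * cosh y)"
  proof -
    have "1 / (s * ln 2) * (y\<^sup>2 * cosh y) = s * c\<^sup>2 * ln 2 * cosh y"
      unfolding y using s by (simp add: power2_eq_square field_simps)
    then show ?thesis using s by (simp add: distrib_left diff_divide_distrib)
  qed
  finally show ?thesis by (simp add: log_def y[symmetric])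
qed

end

section \<open>The asymptotic equipartition bounds\<close>

text \<open>\<open>p\<close> is the first Nussbaum-Szkola distribution, restricted to its support,
  and \<open>x\<close> is its ratio to the second. The second may have mass outside this support,
  whence the inequality in the locale.\<close>

lemma likelihood_ratio_of_states:
  assumes \<rho>: "\<rho> \<in> density_ops n" and \<sigma>: "\<sigma> \<in> density_ops n" and ac: "\<rho> * mat_powr \<sigma> 0 = \<rho>" and \<gamma>: "0 < \<gamma>"
  obtains S :: "(nat \<times> nat) set" and p x where "likelihood_ratio S p x \<gamma>"
    "\<And>s. mat_trace (mat_powr \<rho> (1 + s) * mat_powr \<sigma> (- s)) = complex_of_real (\<Sum>k\<in>S. p k * x k powr s)"
    "rel_entropy \<rho> \<sigma> = (\<Sum>k\<in>S. p k * ln (x k)) / ln 2"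
proof -
  have r: "psd \<rho>" "\<rho> \<in> carrier_mat n n" "mat_trace \<rho> = 1" and s: "psd \<sigma>" "\<sigma> \<in> carrier_mat n n" "mat_trace \<sigma> = 1"
    using \<rho> \<sigma> by (auto simp: density_ops_def)
  obtain U e where D\<rho>: "diagonalizes n \<rho> U e" and e: "\<And>i. i < n \<Longrightarrow> 0 \<le> e i"
    using psd_diagonalizable[OF r(1,2)] by blast
  obtain V g where D\<sigma>: "diagonalizes n \<sigma> V g" and g: "\<And>i. i < n \<Longrightarrow> 0 \<le> g i"
    using psd_diagonalizable[OF s(1,2)] by blast
  note U = diagonalizesD[OF D\<rho>] and V = diagonalizesD[OF D\<sigma>]
  define w where "w = overlap U V"
  \<comment> \<open>Pairs without mass are dropped, so that absolute continuity makes
    \<open>g j\<close> positive on \<open>S\<close> and \<open>ln\<close> and \<open>powr\<close>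
    act on positive numbers.\<close>
  define S where "S = {(i,j). i < n \<and> j < n \<and> w i j * e i \<noteq> 0}"
  define p where "p k = w (fst k) (snd k) * e (fst k)" for k
  define x where "x k = e (fst k) / g (snd k)" for k
  have w0: "0 \<le> w i j" for i j by (simp add: w_def)
  have S: "S \<subseteq> {..<n} \<times> {..<n}" by (auto simp: S_def)
  then have fin: "finite S" by (rule finite_subset) simp
  have pos: "0 < w i j" "0 < e i" "0 < g j" if "(i,j) \<in> S" for i j
  proof -
    have ij: "i < n" "j < n" "w i j * e i \<noteq> 0" using that by (auto simp: S_def)
    then show "0 < w i j" "0 < e i" using w0[of i j] e[OF ij(1)] by (auto simp: less_le)
    have "g j \<noteq> 0" using absolutely_continuous_overlap[OF D\<rho> D\<sigma> ac ij(1,2)] ij(3) by (auto simp: w_def)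
    then show "0 < g j" using g[OF ij(2)] by simp
  qed
  have sum_S: "(\<Sum>i<n. \<Sum>j<n. w i j * (e i * f i j)) = (\<Sum>k\<in>S. p k * f (fst k) (snd k))" for f
  proof -
    have "(\<Sum>i<n. \<Sum>j<n. w i j * (e i * f i j)) = (\<Sum>k\<in>{..<n}\<times>{..<n}. p k * f (fst k) (snd k))"
      by (simp add: sum.cartesian_product case_prod_unfold p_def mult.assoc)
    also have "\<dots> = (\<Sum>k\<in>S. p k * f (fst k) (snd k))"
      by (rule sum.mono_neutral_right) (auto simp: S p_def S_def)
    finally show ?thesis .
  qed
  have p1: "sum p S = 1"
  proof -
    have "(\<Sum>i<n. \<Sum>j<n. w i j * (e i * 1)) = (\<Sum>i<n. e i * (\<Sum>j<n. w i j))"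
      by (simp add: sum_distrib_left mult.commute)
    also have "\<dots> = (\<Sum>i<n. e i)"
      unfolding w_def using overlap_row_sum[OF U(1,2) V(1,2)] by simp
    also have "\<dots> = 1" using trace_diagonalizes[OF D\<rho>] r(3) by (metis of_real_eq_1_iff)
    finally show ?thesis using sum_S[of "\<lambda>_ _. 1"] by simp
  qed
  have q1: "(\<Sum>k\<in>S. p k / x k) \<le> 1"
  proof -
    have "(\<Sum>k\<in>S. p k / x k) = (\<Sum>k\<in>S. w (fst k) (snd k) * g (snd k))"
    proof (rule sum.cong[OF refl])
      fix k assume k: "k \<in> S"
      obtain i j where "k = (i,j)" by (cases k)
      then show "p k / x k = w (fst k) (snd k) * g (snd k)"
        using pos[of i j] k by (simp add: p_def x_def)
    qed
    also have "\<dots> \<le> (\<Sum>k\<in>{..<n}\<times>{..<n}. w (fst k) (snd k) * g (snd k))"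
      using S w0 g by (intro sum_mono2) auto
    also have "\<dots> = (\<Sum>j<n. \<Sum>i<n. w i j * g j)"
      by (subst sum.swap) (simp add: sum.cartesian_product case_prod_unfold)
    also have "\<dots> = (\<Sum>j<n. g j)"
      unfolding w_def using overlap_col_sum[OF U(1,2) V(1,2)] by (simp flip: sum_distrib_right)
    also have "\<dots> = 1" using trace_diagonalizes[OF D\<sigma>] s(3) by (metis of_real_eq_1_iff)
    finally show ?thesis by simp
  qed
  have "likelihood_ratio S p x \<gamma>"
    using fin p1 q1 \<gamma> pos by unfold_locales (auto simp: p_def x_def)
  moreover have "mat_trace (mat_powr \<rho> (1 + t) * mat_powr \<sigma> (- t)) = complex_of_real (\<Sum>k\<in>S. p k * x k powr t)" for t
  proof -
    have "mat_trace (mat_powr \<rho> (1 + t) * mat_powr \<sigma> (- t)) =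
        complex_of_real (\<Sum>i<n. \<Sum>j<n. w i j * (e i powr (1 + t) * g j powr (- t)))"
      unfolding mat_powr_def w_def by (rule trace_herm_fun_mult[OF D\<rho> D\<sigma>])
    also have "(\<Sum>i<n. \<Sum>j<n. w i j * (e i powr (1 + t) * g j powr (- t))) =
        (\<Sum>i<n. \<Sum>j<n. w i j * (e i * (e i powr t * g j powr (- t))))"
    proof (intro sum.cong refl)
      fix i j assume "i \<in> {..<n}"
      then have "e i powr (1 + t) = e i * e i powr t" using e[of i] by (cases "e i = 0") (auto simp: powr_add)
      then show "w i j * (e i powr (1 + t) * g j powr (- t)) = w i j * (e i * (e i powr t * g j powr (- t)))" by simp
    qed
    also have "\<dots> = (\<Sum>k\<in>S. p k * (e (fst k) powr t * g (snd k) powr (- t)))" by (rule sum_S)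
    also have "\<dots> = (\<Sum>k\<in>S. p k * x k powr t)"
    proof (rule sum.cong[OF refl])
      fix k assume k: "k \<in> S"
      obtain i j where "k = (i,j)" by (cases k)
      then show "p k * (e (fst k) powr t * g (snd k) powr (- t)) = p k * x k powr t"
        using pos[of i j] k by (simp add: x_def powr_divide powr_minus_divide)
    qed
    finally show ?thesis .
  qed
  moreover have "rel_entropy \<rho> \<sigma> = (\<Sum>k\<in>S. p k * ln (x k)) / ln 2"
  proof -
    define L where "L y = (if y = 0 then 0 else log 2 y)" for y :: real
    have Lr: "mat_log \<rho> \<in> carrier_mat n n" and Ls: "mat_log \<sigma> \<in> carrier_mat n n"
      unfolding mat_log_def
      using diagonalizesD(5)[OF diagonalizes_herm_fun[OF D\<rho>]] diagonalizesD(5)[OF diagonalizes_herm_fun[OF D\<sigma>]] by auto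
    have id: "herm_fun (\<lambda>x. x) \<rho> = \<rho>" by (rule herm_fun_id[OF D\<rho>])
    have "mat_trace (\<rho> * mat_log \<rho>) = complex_of_real (\<Sum>i<n. \<Sum>j<n. overlap U U i j * (e i * L (e j)))"
      unfolding mat_log_def L_def using trace_herm_fun_mult[OF D\<rho> D\<rho>, of "\<lambda>x. x"] id by simp
    also have "(\<Sum>i<n. \<Sum>j<n. overlap U U i j * (e i * L (e j))) = (\<Sum>i<n. \<Sum>j<n. if j = i then e i * L (e j) else 0)"
      by (intro sum.cong refl) (auto simp: overlap_def U(2))
    also have "\<dots> = (\<Sum>i<n. e i * L (e i))" by simp
    \<comment> \<open>The term with \<open>\<rho>\<close> alone involves only the first index; the
      row sums of \<open>w\<close>, equal to 1, put it on the same index set as the mixed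
      term.\<close>
    also have "\<dots> = (\<Sum>i<n. (\<Sum>j<n. w i j) * (e i * L (e i)))"
      unfolding w_def using overlap_row_sum[OF U(1,2) V(1,2)] by simp
    also have "\<dots> = (\<Sum>i<n. \<Sum>j<n. w i j * (e i * L (e i)))" by (simp add: sum_distrib_right)
    finally have 1: "Re (mat_trace (\<rho> * mat_log \<rho>)) = (\<Sum>i<n. \<Sum>j<n. w i j * (e i * L (e i)))" by simp
    have 2: "Re (mat_trace (\<rho> * mat_log \<sigma>)) = (\<Sum>i<n. \<Sum>j<n. w i j * (e i * L (g j)))"
      unfolding mat_log_def L_def w_def using trace_herm_fun_mult[OF D\<rho> D\<sigma>, of "\<lambda>x. x"] id by simp
    have "rel_entropy \<rho> \<sigma> = Re (mat_trace (\<rho> * mat_log \<rho>)) - Re (mat_trace (\<rho> * mat_log \<sigma>))"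
      unfolding rel_entropy_def mult_minus_distrib_mat[OF r(2) Lr Ls]
      using r(2) Lr Ls by (simp add: trace_minus[of _ n])
    also have "\<dots> = (\<Sum>i<n. \<Sum>j<n. w i j * (e i * (L (e i) - L (g j))))"
      unfolding 1 2 by (simp add: algebra_simps sum_subtractf)
    also have "\<dots> = (\<Sum>k\<in>S. p k * (L (e (fst k)) - L (g (snd k))))" by (rule sum_S)
    also have "\<dots> = (\<Sum>k\<in>S. p k * ln (x k) / ln 2)"
    proof (rule sum.cong[OF refl])
      fix k assume k: "k \<in> S"
      obtain i j where "k = (i,j)" by (cases k)
      then show "p k * (L (e (fst k)) - L (g (snd k))) = p k * ln (x k) / ln 2"
        using pos[of i j] k by (simp add: x_def L_def log_def ln_div diff_divide_distrib right_diff_distrib)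
    qed
    finally show ?thesis by (simp add: sum_divide_distrib)
  qed
  ultimately show thesis using that by blast
qed

lemma ereal_scale_le:
  assumes "0 < n" "A \<le> ereal B" "B \<le> real n * C"
  shows "ereal (1 / real n) * A \<le> ereal C"
proof -
  have "ereal (1 / real n) * A \<le> ereal (1 / real n) * ereal B"
    using assms(2) by (intro ereal_mult_left_mono) auto
  also have "\<dots> \<le> ereal C" using assms by (simp add: field_simps)
  finally show ?thesis .
qed

lemma ereal_scale_ge:
  assumes "0 < n" "ereal B \<le> A" "real n * C \<le> B"
  shows "ereal C \<le> ereal (1 / real n) * A"
proof -
  have "ereal C \<le> ereal (1 / real n) * ereal B" using assms by (simp add: field_simps)
  also have "\<dots> \<le> ereal (1 / real n) * A"
    using assms(2) by (intro ereal_mult_left_mono) auto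
  finally show ?thesis .
qed

text \<open>The stated bounds arise from two choices of \<open>s\<close>: \<open>log 3 / (2 c \<surd>n)\<close> and the minimiser of the right-hand side.\<close>

lemma D_max_smooth_tensor_pow_bounds:
  assumes \<rho>: "\<rho> \<in> density_ops d" and \<sigma>: "\<sigma> \<in> density_ops d" and sub: "supp \<rho> \<subseteq> supp \<sigma>"
    and \<gamma>: "0 < \<gamma>" "\<gamma> \<le> 1"
  defines "c \<equiv> c_gamma \<gamma> \<rho> \<sigma>" and "D \<equiv> rel_entropy \<rho> \<sigma>"
  shows "log 2 3 \<le> \<gamma> * c"
    and "\<And>\<epsilon> n s. \<lbrakk>0 < \<epsilon>; \<epsilon> < 1; 0 < n; 0 < s; s \<le> \<gamma> / 2\<rbrakk> \<Longrightarrow>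
      ereal (1 / real n) * D_max_smooth \<epsilon> (tensor_pow \<rho> n) (tensor_pow \<sigma> n) \<le>
        ereal (D + (s * (c\<^sup>2 * ln 2) + 2 * log 2 (1 / \<epsilon>) / real n / s) + 1 / real n * log 2 (1 / (1 - \<epsilon>\<^sup>2)))"
    and "\<And>\<epsilon> n s. \<lbrakk>0 < \<epsilon>; \<epsilon> < 1; 0 < n; 0 < s; s \<le> \<gamma> / 2\<rbrakk> \<Longrightarrow>
      ereal (D - (s * (c\<^sup>2 * ln 2 * cosh (s * c * ln 2)) + 2 * log 2 (1 / (1 - \<epsilon>)) / real n / s)) \<le>
      ereal (1 / real n) * D_max_smooth \<epsilon> (tensor_pow \<rho> n) (tensor_pow \<sigma> n)"
proof -
  have ac: "\<rho> * mat_powr \<sigma> 0 = \<rho>" by (rule supp_subset_imp_mult_support[OF \<rho> \<sigma> sub])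
  obtain S :: "(nat \<times> nat) set" and p x where LR: "likelihood_ratio S p x \<gamma>"
    and tr: "\<And>s. mat_trace (mat_powr \<rho> (1 + s) * mat_powr \<sigma> (- s)) = complex_of_real (\<Sum>k\<in>S. p k * x k powr s)"
    and rel: "rel_entropy \<rho> \<sigma> = (\<Sum>k\<in>S. p k * ln (x k)) / ln 2"
    by (rule likelihood_ratio_of_states[OF \<rho> \<sigma> ac \<gamma>(1)]) blast
  interpret LR: likelihood_ratio S p x \<gamma> by (rule LR)
  have tr': "mat_trace (mat_powr \<rho> (1 + s) * mat_powr \<sigma> (- s)) = complex_of_real (LR.mgf s)" for s
    unfolding tr LR.mgf_def ..
  have D: "D = LR.dvg / ln 2" unfolding D_def rel LR.dvg_def ..
  have petz: "petz_renyi (1 + s) \<rho> \<sigma> = 1 / s * log 2 (LR.mgf s)" for s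
    unfolding petz_renyi_def using tr'[of s] by simp
  have c: "c = LR.c"
  proof -
    have "2 powr (\<gamma> * petz_renyi (1 + \<gamma>) \<rho> \<sigma>) = LR.mgf \<gamma>"
      unfolding petz using \<gamma> LR.mgf_pos[of \<gamma>] by simp
    moreover have "2 powr (- \<gamma> * petz_renyi (1 - \<gamma>) \<rho> \<sigma>) = LR.mgf (- \<gamma>)"
      using petz[of "- \<gamma>"] \<gamma> LR.mgf_pos[of "- \<gamma>"] by simp
    ultimately show ?thesis
      unfolding c_def c_gamma_def LR.c_def LR.W_def by simp
  qed
  show "log 2 3 \<le> \<gamma> * c" unfolding c by (rule LR.log_3_le)
  have tp: "mat_trace (mat_powr (tensor_pow \<rho> n) (1 + s) * mat_powr (tensor_pow \<sigma> n) (- s)) = complex_of_real (LR.mgf s ^ n)" for n s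
    unfolding tensor_pow_trace_powr[OF \<rho> \<sigma>] tr' by simp
  have petz_n: "petz_renyi (1 + s) (tensor_pow \<rho> n) (tensor_pow \<sigma> n) = real n * (1 / s * log 2 (LR.mgf s))" for n s
    unfolding petz_renyi_def using tp[of n s] LR.mgf_pos[of s] by (simp add: log_nat_power)
  fix \<epsilon> :: real and n :: nat and s :: real
  assume eps: "0 < \<epsilon>" "\<epsilon> < 1" and n: "0 < n" and s: "0 < s" "s \<le> \<gamma> / 2"
  then have s1: "s < 1" using \<gamma> by simp
  note dn = tensor_pow_density[OF \<rho>, of n] tensor_pow_density[OF \<sigma>, of n]
  show "ereal (1 / real n) * D_max_smooth \<epsilon> (tensor_pow \<rho> n) (tensor_pow \<sigma> n) \<le>
        ereal (D + (s * (c\<^sup>2 * ln 2) + 2 * log 2 (1 / \<epsilon>) / real n / s) + 1 / real n * log 2 (1 / (1 - \<epsilon>\<^sup>2)))"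
  proof (rule ereal_scale_le[OF n])
    have pos: "0 < Re (mat_trace (mat_powr (tensor_pow \<rho> n) (1 + s) * mat_powr (tensor_pow \<sigma> n) (- s)))"
      unfolding tp using LR.mgf_pos[of s] by (simp del: of_real_power)
    show "D_max_smooth \<epsilon> (tensor_pow \<rho> n) (tensor_pow \<sigma> n) \<le>
        ereal (real n * (1 / s * log 2 (LR.mgf s)) + 2 / s * log 2 (1 / \<epsilon>) + log 2 (1 / (1 - \<epsilon>\<^sup>2)))"
      using D_max_smooth_le_petz_renyi[OF dn tensor_pow_support[OF \<rho> \<sigma> ac] s(1) s1 eps pos] unfolding petz_n .
    have "real n * (1 / s * log 2 (LR.mgf s)) \<le> real n * (D + s * (c\<^sup>2 * ln 2))"
      using LR.log_mgf_le[OF s] unfolding D c by (intro mult_left_mono) (auto simp: mult.assoc)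
    moreover have "2 / s * log 2 (1 / \<epsilon>) = real n * (2 * log 2 (1 / \<epsilon>) / real n / s)"
      using n by simp
    moreover have "log 2 (1 / (1 - \<epsilon>\<^sup>2)) = real n * (1 / real n * log 2 (1 / (1 - \<epsilon>\<^sup>2)))" using n by simp
    ultimately show "real n * (1 / s * log 2 (LR.mgf s)) + 2 / s * log 2 (1 / \<epsilon>) + log 2 (1 / (1 - \<epsilon>\<^sup>2)) \<le>
        real n * (D + (s * (c\<^sup>2 * ln 2) + 2 * log 2 (1 / \<epsilon>) / real n / s) + 1 / real n * log 2 (1 / (1 - \<epsilon>\<^sup>2)))"
      unfolding distrib_left by linarith
  qed
  show "ereal (D - (s * (c\<^sup>2 * ln 2 * cosh (s * c * ln 2)) + 2 * log 2 (1 / (1 - \<epsilon>)) / real n / s)) \<le>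
      ereal (1 / real n) * D_max_smooth \<epsilon> (tensor_pow \<rho> n) (tensor_pow \<sigma> n)"
  proof (rule ereal_scale_ge[OF n])
    show "ereal (real n * (- 1 / s * log 2 (LR.mgf (- s))) - 1 / s * log 2 (1 / (1 - \<epsilon>\<^sup>2))) \<le>
        D_max_smooth \<epsilon> (tensor_pow \<rho> n) (tensor_pow \<sigma> n)"
      using D_max_smooth_ge_petz_renyi[OF dn s(1) s1 eps] petz_n[of "- s" n] by simp
    have "real n * (D - s * (c\<^sup>2 * ln 2 * cosh (s * c * ln 2))) \<le> real n * (- 1 / s * log 2 (LR.mgf (- s)))"
      using LR.log_mgf_minus_ge[OF s] unfolding D c by (intro mult_left_mono) (auto simp: mult.assoc)
    \<comment> \<open>A deliberate weakening, from \<open>1 - \<epsilon>^2\<close> to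
      \<open>1 - \<epsilon>\<close> and then by a factor 2. It gives both sides the same shape
      \<open>s * a + 2 * L / n / s\<close>.\<close>
    moreover have "1 / s * log 2 (1 / (1 - \<epsilon>\<^sup>2)) \<le> real n * (2 * log 2 (1 / (1 - \<epsilon>)) / real n / s)"
    proof -
      have "\<epsilon>\<^sup>2 \<le> \<epsilon>" using eps by (simp add: power2_eq_square mult_left_le)
      then have "log 2 (1 / (1 - \<epsilon>\<^sup>2)) \<le> log 2 (1 / (1 - \<epsilon>))" using eps by (simp add: frac_le)
      moreover have "0 \<le> log 2 (1 / (1 - \<epsilon>))" using eps by simp
      ultimately have "1 / s * log 2 (1 / (1 - \<epsilon>\<^sup>2)) \<le> 1 / s * (2 * log 2 (1 / (1 - \<epsilon>)))"
        using s by (intro mult_left_mono) auto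
      then show ?thesis using n by simp
    qed
    ultimately show "real n * (D - (s * (c\<^sup>2 * ln 2 * cosh (s * c * ln 2)) + 2 * log 2 (1 / (1 - \<epsilon>)) / real n / s)) \<le>
        real n * (- 1 / s * log 2 (LR.mgf (- s))) - 1 / s * log 2 (1 / (1 - \<epsilon>\<^sup>2))"
      unfolding right_diff_distrib distrib_left by linarith
  qed
qed

section \<open>Numerical constants\<close>

lemma log_2_3_bounds: "1 \<le> log 2 (3 :: real)" "log 2 (3 :: real) \<le> 46 / 29"
proof -
  show "1 \<le> log 2 (3 :: real)" by simp
  \<comment> \<open>The fraction comes from \<open>3^29 <= 2^46\<close>; half of it,
    \<open>23/29\<close>, lies in the range of \<open>exp_le_taylor_8\<close>.\<close>
  have "29 * log 2 (3 :: real) = log 2 (3 ^ 29)" by (subst log_nat_power) simp_all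
  also have "\<dots> \<le> log 2 (2 ^ 46)" by (subst log_le_cancel_iff) auto
  also have "\<dots> = 46" by (subst log_nat_power) simp_all
  finally show "log 2 (3 :: real) \<le> 46 / 29" by simp
qed

lemma exp_le_taylor_8:
  fixes y :: real
  assumes "\<bar>y\<bar> \<le> 1"
  shows "exp y \<le> (\<Sum>m<8. y ^ m / fact m) + 3 / fact 8 * y ^ 8"
proof -
  obtain t where t: "\<bar>t\<bar> \<le> \<bar>y\<bar>" "exp y = (\<Sum>m<8. y ^ m / fact m) + exp t / fact 8 * y ^ 8"
    using Maclaurin_exp_le[of y 8] by blast
  have "exp t \<le> exp 1" using t(1) assms by simp
  also have "\<dots> \<le> 3" by (rule exp_le)
  finally have "exp t / fact 8 * y ^ 8 \<le> 3 / fact 8 * y ^ 8"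
    by (intro mult_right_mono divide_right_mono) auto
  then show ?thesis using t(2) by simp
qed

lemma cosh_half_log_3_le: "cosh (log 2 3 / 2) \<le> (1.3316 :: real)"
proof -
  have "cosh (log 2 3 / 2) \<le> cosh (23 / 29 :: real)"
    using log_2_3_bounds by (subst cosh_real_nonneg_le_iff) auto
  also have "\<dots> = (exp (23 / 29) + exp (- 23 / 29)) / 2" by (simp add: cosh_def)
  also have "\<dots> \<le> 1.3316"
    using exp_le_taylor_8[of "23 / 29"] exp_le_taylor_8[of "- 23 / 29"]
    by (simp add: eval_nat_numeral fact_numeral)
  finally show ?thesis .
qed

lemma K_bounds: "K\<^sub>1 \<le> 2.72" "K\<^sub>2 \<le> 2.36"
proof -
  \<comment> \<open>Proved by a Taylor polynomial of \<open>exp\<close> at \<open>25/36\<close> that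
    already exceeds 2; the remainder has even order and is nonnegative.\<close>
  have l: "ln (2 :: real) \<le> 25 / 36"
  proof -
    obtain t where "exp (25 / 36 :: real) = (\<Sum>m<6. (25 / 36) ^ m / fact m) + exp t / fact 6 * (25 / 36) ^ 6"
      using Maclaurin_exp_le[of "25 / 36" 6] by blast
    then have "(\<Sum>m<6. (25 / 36) ^ m / fact m) \<le> exp (25 / 36 :: real)" by simp
    then have "2 \<le> exp (25 / 36 :: real)" by (simp add: eval_nat_numeral fact_numeral)
    then have "ln 2 \<le> ln (exp (25 / 36 :: real))" by (subst ln_le_cancel_iff) auto
    then show ?thesis by simp
  qed
  \<comment> \<open>Twice this product is about 1.84944, just below \<open>1.36^2 = 1.8496\<close>.
    The room left here dictates the precision of both factors.\<close>
  have "ln 2 * cosh (log 2 3 / 2) \<le> 25 / 36 * (1.3316 :: real)"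
    using l cosh_half_log_3_le by (intro mult_mono) auto
  then have "2 * ln 2 * cosh (log 2 3 / 2) \<le> (1.36 :: real)\<^sup>2" by (simp add: power2_eq_square)
  then have "sqrt (2 * ln 2 * cosh (log 2 3 / 2)) \<le> 1.36" by (intro real_le_lsqrt) auto
  then show "K\<^sub>1 \<le> 2.72" unfolding K\<^sub>1_def by simp
  have "2 * ln 2 \<le> (1.18 :: real)\<^sup>2" using l by (simp add: power2_eq_square)
  then have "sqrt (2 * ln 2) \<le> (1.18 :: real)" by (intro real_le_lsqrt) auto
  then show "K\<^sub>2 \<le> 2.36" unfolding K\<^sub>2_def by simp
qed

text \<open>The choice \<open>s = \<surd>(b / a)\<close> that minimises \<open>s a + b / s\<close>, for \<open>a = c\<^sup>2 B\<close> and \<open>b = 2 L / n\<close>.\<close>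

lemma optimal_parameter:
  fixes B c L m T :: real
  assumes B: "0 < B" and c: "0 < c" and L: "0 < L" and m: "0 < m" and T: "0 < T"
    and le: "L * (8 / (T * (2 * sqrt (2 * B))))\<^sup>2 \<le> m"
  obtains s where "0 < s" "s \<le> T / (2 * c)"
    "s * (c\<^sup>2 * B) + 2 * L / m / s = 2 * sqrt (2 * B) / sqrt m * c * sqrt L"
proof
  define s where "s = sqrt (2 * L / (m * B)) / c"
  show "0 < s" using assms by (simp add: s_def)
  \<comment> \<open>The hypothesis \<open>le\<close> thus reads \<open>8 * L <= m * T^2 * B\<close>,
    which says exactly that the minimiser \<open>s\<close> does not exceed
    \<open>T / (2 * c)\<close>.\<close>
  have "(8 / (T * (2 * sqrt (2 * B))))\<^sup>2 = 8 / (T\<^sup>2 * B)"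
    using B by (simp add: power_divide power_mult_distrib)
  then have "L * 8 \<le> m * (T\<^sup>2 * B)"
    using le B T by (simp add: field_simps)
  then have "2 * L / (m * B) \<le> (T / 2)\<^sup>2"
    using B m by (simp add: power_divide field_simps)
  then have "sqrt (2 * L / (m * B)) \<le> T / 2" using T by (intro real_le_lsqrt) auto
  then show "s \<le> T / (2 * c)" using c by (simp add: s_def field_simps)
  define r where "r = sqrt (2 * L * B / m)"
  have r: "0 < r" using assms by (simp add: r_def)
  have rr: "r * r = 2 * L * B / m" using assms by (simp add: r_def)
  have s: "s = r / (B * c)"
  proof -
    have "2 * L / (m * B) = 2 * L * B / m / B\<^sup>2" using B by (simp add: power2_eq_square)
    then have "sqrt (2 * L / (m * B)) = sqrt (2 * L * B / m) / sqrt (B\<^sup>2)" by (simp only: real_sqrt_divide)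
    also have "\<dots> = r / B" using B by (simp add: r_def)
    finally show ?thesis by (simp add: s_def)
  qed
  have "s * (c\<^sup>2 * B) = c * r" unfolding s using B c by (simp add: power2_eq_square)
  moreover have "2 * L / m / s = c * r"
  proof -
    have "2 * L / m = r * r / B" unfolding rr using B by simp
    then show ?thesis unfolding s using r B c by simp
  qed
  moreover have "2 * sqrt (2 * B) / sqrt m * c * sqrt L = 2 * (c * r)"
    by (simp add: r_def real_sqrt_divide real_sqrt_mult)
  ultimately show "s * (c\<^sup>2 * B) + 2 * L / m / s = 2 * sqrt (2 * B) / sqrt m * c * sqrt L" by simp
qed

theorem lemma15:
  fixes d :: nat and \<rho> \<sigma> :: "complex mat" and \<gamma> :: real
  assumes "\<rho> \<in> density_ops d" and "\<sigma> \<in> density_ops d"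
    and "supp \<rho> \<subseteq> supp \<sigma>"
    and "0 < \<gamma>" and "\<gamma> \<le> 1"
  shows "K\<^sub>1 \<le> 2.72 \<and> K\<^sub>2 \<le> 2.36 \<and>
    log 2 3 \<le> \<gamma> * c_gamma \<gamma> \<rho> \<sigma> \<and>
    (\<forall>(\<epsilon>::real) (n::nat). 0 < \<epsilon> \<and> \<epsilon> < 1 \<and> 1 \<le> n \<longrightarrow>
      (let D = rel_entropy \<rho> \<sigma>;
           c = c_gamma \<gamma> \<rho> \<sigma>;
           Dn = ereal (1 / real n) * D_max_smooth \<epsilon> (tensor_pow \<rho> n) (tensor_pow \<sigma> n)
       in
        Dn \<ge> ereal (D - c / sqrt (real n) *
          (ln 2 * log 2 3 / 2 * cosh (log 2 3 / 2) + 4 / log 2 3 * log 2 (1 / (1 - \<epsilon>)))) \<and>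
        Dn \<le> ereal (D + c / sqrt (real n) *
          (ln 2 * log 2 3 / 2 + 4 / log 2 3 * log 2 (1 / \<epsilon>))
          + 1 / real n * log 2 (1 / (1 - \<epsilon>\<^sup>2))) \<and>
        Dn \<ge> ereal (D - 4 * c / sqrt (real n) * log 2 (2 / (1 - \<epsilon>))) \<and>
        Dn \<le> ereal (D + 4 * c / sqrt (real n) * log 2 (2 / \<epsilon>)
          + 1 / real n * log 2 (1 / (1 - \<epsilon>\<^sup>2))) \<and>
        (real n \<ge> log 2 (1 / (1 - \<epsilon>)) * (8 / (log 2 3 * K\<^sub>1))\<^sup>2 \<longrightarrow>
          Dn \<ge> ereal (D - K\<^sub>1 / sqrt (real n) * c * sqrt (log 2 (1 / (1 - \<epsilon>))))) \<and>
        (real n \<ge> log 2 (1 / \<epsilon>) * (8 / (\<gamma> * c * K\<^sub>2))\<^sup>2 \<longrightarrow>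
          Dn \<le> ereal (D + K\<^sub>2 / sqrt (real n) * c * sqrt (log 2 (1 / \<epsilon>))
            + 1 / real n * log 2 (1 / (1 - \<epsilon>\<^sup>2)))) \<and>
        (real n \<ge> log 2 (1 / \<epsilon>) * (8 / (log 2 3 * K\<^sub>2))\<^sup>2 \<longrightarrow>
          real n \<ge> log 2 (1 / \<epsilon>) * (8 / (\<gamma> * c * K\<^sub>2))\<^sup>2)))"
proof -
  define D where "D = rel_entropy \<rho> \<sigma>"
  define c where "c = c_gamma \<gamma> \<rho> \<sigma>"
  note bnd = D_max_smooth_tensor_pow_bounds[OF assms, folded c_def D_def]
  note \<gamma> = assms(4,5)
  have l3: "1 \<le> log 2 (3 :: real)" "log 2 (3 :: real) \<le> 2" using log_2_3_bounds by auto
  have gc: "log 2 3 \<le> \<gamma> * c" by (rule bnd(1))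
  then have "0 < \<gamma> * c" using l3 by linarith
  then have c: "0 < c" using \<gamma> by (simp add: zero_less_mult_iff)
  define C where "C = cosh (log 2 3 / 2 :: real)"
  have C: "1 \<le> C" "C \<le> 1.3316" unfolding C_def using cosh_real_ge_1 cosh_half_log_3_le by auto
  have ln2: "0 < ln (2 :: real)" "ln (2 :: real) \<le> 1" using ln_le_minus_one[of "2 :: real"] by auto
  have K: "K\<^sub>1 = 2 * sqrt (2 * (ln 2 * C))" "K\<^sub>2 = 2 * sqrt (2 * ln 2)"
    unfolding K\<^sub>1_def K\<^sub>2_def C_def by (simp_all add: mult.assoc)
  have Kpos: "0 < K\<^sub>1" "0 < K\<^sub>2" unfolding K using ln2 C by simp_all
  \<comment> \<open>The argument is at most \<open>ln 2 * log 2 3 / 2\<close>; the estimate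
    \<open>ln 2 <= 1\<close> relaxes it to the one in the statement.\<close>
  have cosh_le: "cosh (s * c * ln 2) \<le> C" if s: "0 < s" "s \<le> log 2 3 / (2 * c)" for s
  proof -
    have "s * c \<le> log 2 3 / 2" using s(2) c by (simp add: field_simps)
    then have "s * c * ln 2 \<le> log 2 3 / 2 * 1" using s c ln2 l3 by (intro mult_mono) auto
    then show ?thesis unfolding C_def using s c ln2 l3 by (subst cosh_real_nonneg_le_iff) auto
  qed
  \<comment> \<open>By \<open>gc\<close>, the range of \<open>s\<close> in which \<open>cosh\<close>
    is controlled lies inside the range where the continuity bounds hold.\<close>
  have s_le: "s \<le> \<gamma> / 2" if "s \<le> log 2 3 / (2 * c)" for s
  proof -
    have "log 2 3 / (2 * c) \<le> \<gamma> / 2" using gc c by (simp add: field_simps)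
    then show ?thesis using that by linarith
  qed
  have main: "Dn \<ge> ereal (D - c / sqrt (real n) *
          (ln 2 * log 2 3 / 2 * cosh (log 2 3 / 2) + 4 / log 2 3 * log 2 (1 / (1 - \<epsilon>)))) \<and>
        Dn \<le> ereal (D + c / sqrt (real n) *
          (ln 2 * log 2 3 / 2 + 4 / log 2 3 * log 2 (1 / \<epsilon>))
          + 1 / real n * log 2 (1 / (1 - \<epsilon>\<^sup>2))) \<and>
        Dn \<ge> ereal (D - 4 * c / sqrt (real n) * log 2 (2 / (1 - \<epsilon>))) \<and>
        Dn \<le> ereal (D + 4 * c / sqrt (real n) * log 2 (2 / \<epsilon>)
          + 1 / real n * log 2 (1 / (1 - \<epsilon>\<^sup>2))) \<and>
        (real n \<ge> log 2 (1 / (1 - \<epsilon>)) * (8 / (log 2 3 * K\<^sub>1))\<^sup>2 \<longrightarrow>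
          Dn \<ge> ereal (D - K\<^sub>1 / sqrt (real n) * c * sqrt (log 2 (1 / (1 - \<epsilon>))))) \<and>
        (real n \<ge> log 2 (1 / \<epsilon>) * (8 / (\<gamma> * c * K\<^sub>2))\<^sup>2 \<longrightarrow>
          Dn \<le> ereal (D + K\<^sub>2 / sqrt (real n) * c * sqrt (log 2 (1 / \<epsilon>))
            + 1 / real n * log 2 (1 / (1 - \<epsilon>\<^sup>2)))) \<and>
        (real n \<ge> log 2 (1 / \<epsilon>) * (8 / (log 2 3 * K\<^sub>2))\<^sup>2 \<longrightarrow>
          real n \<ge> log 2 (1 / \<epsilon>) * (8 / (\<gamma> * c * K\<^sub>2))\<^sup>2)"
    if eps: "0 < \<epsilon>" "\<epsilon> < 1" and n1: "1 \<le> n"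
      and Dn: "Dn = ereal (1 / real n) * D_max_smooth \<epsilon> (tensor_pow \<rho> n) (tensor_pow \<sigma> n)" for \<epsilon> n Dn
  proof -
    have n: "0 < n" using n1 by simp
    define L where "L = log 2 (1 / (1 - \<epsilon>))"
    define L' where "L' = log 2 (1 / \<epsilon>)"
    have L: "0 < L" "0 < L'" unfolding L_def L'_def using eps by simp_all
    have L2: "log 2 (2 / (1 - \<epsilon>)) = 1 + L" "log 2 (2 / \<epsilon>) = 1 + L'"
      unfolding L_def L'_def using eps by (simp_all add: log_divide)
    define R where "R = 1 / real n * log 2 (1 / (1 - \<epsilon>\<^sup>2))"
    note up = bnd(2)[OF eps n, folded Dn L'_def R_def]
    have low: "ereal (D - (s * (c\<^sup>2 * (ln 2 * C)) + 2 * L / real n / s)) \<le> Dn"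
      if s: "0 < s" "s \<le> log 2 3 / (2 * c)" for s
    proof -
      have "s * (c\<^sup>2 * ln 2 * cosh (s * c * ln 2)) \<le> s * (c\<^sup>2 * ln 2 * C)"
        using s cosh_le[OF s] ln2 by (intro mult_left_mono) auto
      then have "ereal (D - (s * (c\<^sup>2 * (ln 2 * C)) + 2 * L / real n / s)) \<le>
          ereal (D - (s * (c\<^sup>2 * ln 2 * cosh (s * c * ln 2)) + 2 * L / real n / s))"
        by (simp add: mult.assoc)
      also have "\<dots> \<le> Dn" unfolding L_def Dn by (rule bnd(3)[OF eps n s(1) s_le[OF s(2)]])
      finally show ?thesis .
    qed
    define q where "q = sqrt (real n)"
    have q: "1 \<le> q" "real n = q * q" using n1 by (simp_all add: q_def)
    define s where "s = log 2 3 / (2 * c * q)"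
    have s: "0 < s" "s \<le> log 2 3 / (2 * c)"
    proof -
      show "0 < s" unfolding s_def using c q l3 by simp
      have "2 * c * 1 \<le> 2 * c * q" using c q by (intro mult_left_mono) auto
      then show "s \<le> log 2 3 / (2 * c)" unfolding s_def using c q l3 by (intro divide_left_mono) auto
    qed
    have s1: "s * (c\<^sup>2 * B) = c / q * (B * log 2 3 / 2)" for B
      unfolding s_def using c q by (simp add: power2_eq_square field_simps)
    have s2: "2 * M / real n / s = c / q * (4 / log 2 3 * M)" for M
      unfolding s_def using c q(1) l3 by (simp add: q(2) field_simps)
    have A1: "Dn \<ge> ereal (D - c / q * (ln 2 * log 2 3 / 2 * C + 4 / log 2 3 * L))"
      using low[OF s] unfolding s1 s2 by (simp add: distrib_left algebra_simps)
    have A2: "Dn \<le> ereal (D + c / q * (ln 2 * log 2 3 / 2 + 4 / log 2 3 * L') + R)"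
      using up[OF s(1) s_le[OF s(2)]] unfolding s1 s2 by (simp add: distrib_left algebra_simps)
    \<comment> \<open>Crude bounds by 4 on both coefficients; \<open>B\<close> is \<open>C\<close>
      for the lower bound and 1 for the upper one.\<close>
    have small: "ln 2 * log 2 3 / 2 * B + 4 / log 2 3 * M \<le> 4 * (1 + M)" if "0 \<le> B" "B \<le> 1.3316" "0 \<le> M" for B M :: real
    proof -
      have "ln 2 * log 2 3 / 2 \<le> (1 * 2 / 2 :: real)" using ln2 l3 by (intro divide_right_mono mult_mono) auto
      then have "ln 2 * log 2 3 / 2 * B \<le> 1 * 1.3316" using that by (intro mult_mono) auto
      also have "\<dots> \<le> (4 :: real)" by simp
      finally have "ln 2 * log 2 3 / 2 * B \<le> 4" .
      moreover have "4 / log 2 3 * M \<le> 4 * M" using l3 that by (intro mult_right_mono) (auto simp: divide_le_eq)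
      ultimately have "ln 2 * log 2 3 / 2 * B + 4 / log 2 3 * M \<le> 4 + 4 * M" by (rule add_mono)
      then show ?thesis by (simp only: distrib_left mult_1_right)
    qed
    have cq: "0 \<le> c / q" using c q by simp
    have c4: "4 * c / q * (1 + M) = c / q * (4 * (1 + M))" for M by simp
    have A3: "Dn \<ge> ereal (D - 4 * c / q * (1 + L))"
    proof -
      have "c / q * (ln 2 * log 2 3 / 2 * C + 4 / log 2 3 * L) \<le> c / q * (4 * (1 + L))"
        using C L by (intro mult_left_mono small cq) auto
      then have "ereal (D - 4 * c / q * (1 + L)) \<le> ereal (D - c / q * (ln 2 * log 2 3 / 2 * C + 4 / log 2 3 * L))"
        unfolding c4 ereal_less_eq by linarith
      also note A1
      finally show ?thesis .
    qed
    have A4: "Dn \<le> ereal (D + 4 * c / q * (1 + L') + R)"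
    proof -
      have "c / q * (ln 2 * log 2 3 / 2 * 1 + 4 / log 2 3 * L') \<le> c / q * (4 * (1 + L'))"
        using L by (intro mult_left_mono small cq) auto
      then have "ereal (D + c / q * (ln 2 * log 2 3 / 2 + 4 / log 2 3 * L') + R) \<le> ereal (D + 4 * c / q * (1 + L') + R)"
        unfolding c4 ereal_less_eq mult_1_right by linarith
      with A2 show ?thesis by (rule order_trans)
    qed
    \<comment> \<open>Here \<open>T = log 2 3\<close>, because the lower bound also requires
      \<open>cosh_le\<close>, which restricts \<open>s * c\<close> to
      \<open>log 2 3 / 2\<close>.\<close>
    have A5: "Dn \<ge> ereal (D - K\<^sub>1 / q * c * sqrt L)" if ge: "L * (8 / (log 2 3 * K\<^sub>1))\<^sup>2 \<le> real n"
    proof -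
      have B: "0 < ln 2 * C" "0 < log 2 (3 :: real)" "0 < real n" using ln2 C l3 n by auto
      obtain r where r: "0 < r" "r \<le> log 2 3 / (2 * c)"
        "r * (c\<^sup>2 * (ln 2 * C)) + 2 * L / real n / r = 2 * sqrt (2 * (ln 2 * C)) / sqrt (real n) * c * sqrt L"
        by (rule optimal_parameter[OF B(1) c L(1) B(3) B(2) ge[unfolded K]])
      show ?thesis using low[OF r(1,2)] unfolding r(3) K q_def .
    qed
    \<comment> \<open>No \<open>cosh\<close> has to be controlled here, so
      \<open>T = \<gamma> * c\<close> exploits the whole range up to \<open>\<gamma> / 2\<close>.
      This is why the two conditions on \<open>n\<close> differ.\<close>
    have A6: "Dn \<le> ereal (D + K\<^sub>2 / q * c * sqrt L' + R)" if ge: "L' * (8 / (\<gamma> * c * K\<^sub>2))\<^sup>2 \<le> real n"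
    proof -
      have n0: "0 < real n" using n by simp
      obtain r where r: "0 < r" "r \<le> \<gamma> * c / (2 * c)"
        "r * (c\<^sup>2 * ln 2) + 2 * L' / real n / r = 2 * sqrt (2 * ln 2) / sqrt (real n) * c * sqrt L'"
        by (rule optimal_parameter[OF ln2(1) c L(2) n0 \<open>0 < \<gamma> * c\<close> ge[unfolded K]])
      have "r \<le> \<gamma> / 2" using r(2) c by simp
      then show ?thesis using up[OF r(1)] unfolding r(3) K q_def by simp
    qed
    have A7: "L' * (8 / (\<gamma> * c * K\<^sub>2))\<^sup>2 \<le> real n" if "L' * (8 / (log 2 3 * K\<^sub>2))\<^sup>2 \<le> real n"
    proof -
      have "8 / (\<gamma> * c * K\<^sub>2) \<le> 8 / (log 2 3 * K\<^sub>2)"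
        using gc Kpos l3 \<open>0 < \<gamma> * c\<close> by (intro divide_left_mono mult_right_mono) auto
      then have "L' * (8 / (\<gamma> * c * K\<^sub>2))\<^sup>2 \<le> L' * (8 / (log 2 3 * K\<^sub>2))\<^sup>2"
        using L Kpos \<open>0 < \<gamma> * c\<close> by (intro mult_left_mono power_mono) auto
      then show ?thesis using that by linarith
    qed
    show ?thesis
      using A1 A2 A3 A4 A5 A6 A7 unfolding L2 L_def[symmetric] L'_def[symmetric] R_def[symmetric] q_def[symmetric] C_def[symmetric]
      by blast
  qed
  show ?thesis
    using K_bounds gc main unfolding Let_def c_def[symmetric] D_def[symmetric] by blast
qed

end
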